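(* For each positive integer $k$, $$\pi\,m_k(1+x_1+x_2)=2\int_0^{\pi/6}\rho_k(2\sin\vartheta)\,d\vartheta+2\sum_{j=0}^{k}\binom{k}{j}\int_{\pi/6}^{\pi/2}\rho_j\!\left(\frac{1}{2\sin\vartheta}\right)\log^{k-j}(2\sin\vartheta)\,d\vartheta\in i\,\mathfrak Z_{k+1}(3).$$
   Context: For a nonzero Laurent polynomial $P$ in $n$ variables and a positive integer $k$, $m_k(P)=\int_0^1\cdots\int_0^1\log^k|P(e^{2\pi i t_1},\dots,e^{2\pi i t_n})|\,dt_1\cdots dt_n$. For a vector $\mathbf A=(a_1,\dots,a_d)$ of positive integers (depth $d(\mathbf A)=d$, weight $w(\mathbf A)=\sum a_j$), $L_{\mathbf A}(x)=\sum_{\ell_1>\dots>\ell_d>0}x^{\ell_1}/\prod_{j=1}^d\ell_j^{a_j}$. For $X\in(0,1)$ and integers $n\ge2$, $\rho_n(X)=\frac{(-1)^n n!}{4^n}\sum 4^{d(\mathbf A)}L_{\mathbf A}(X^2)$, the sum over all vectors $\mathbf A$ of positive integers with $w(\mathbf A)=n$, $a_1=2$ and $a_2,\dots,a_{d(\mathbf A)}\in\{1,2\}$; also $\rho_0(X)=1$, $\rho_1(X)=0$. $\mathrm{Li}_{a_1,\dots,a_n}(z_1,\dots,z_n)=\sum_{\ell_1>\dots>\ell_n>0}\prod_j z_j^{\ell_j}/\ell_j^{a_j}$; for integers $k,N\ge1$, $\mathfrak Z_k(N)$ is the $\mathbb Q$-span of all convergent values $\mathrm{Li}_{a_1,\dots,a_n}(z_1,\dots,z_n)$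 with $n\ge1$, $a_j\in\mathbb Z_{>0}$, $z_j^N=1$, $\sum a_j=k$ (convergent iff $(a_1,z_1)\neq(1,1)$); $\mathfrak Z_0(N)=\mathbb Q$. *)

theory Defs
  imports "HOL-Analysis.Analysis" "HOL-Library.Poly_Mapping"
begin

text \<open>
  A complex Laurent polynomial in the variables \<open>x\<^sub>i\<close>, \<open>i :: 'n\<close>, is an element of the monoid
  algebra over the exponent vectors \<open>'n \<Rightarrow>\<^sub>0 int\<close>; the ring structure is the convolution
  one of polynomial mappings.
\<close>
type_synonym 'n laurent_poly = "('n \<Rightarrow>\<^sub>0 int) \<Rightarrow>\<^sub>0 complex"

definition laurent_var :: "'n \<Rightarrow> 'n laurent_poly"
  where "laurent_var i = Poly_Mapping.single (Poly_Mapping.single i 1) 1"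

definition laurent_eval :: "'n::finite laurent_poly \<Rightarrow> ('n \<Rightarrow> complex) \<Rightarrow> complex"
  where "laurent_eval P z =
    (\<Sum>e\<in>Poly_Mapping.keys P. Poly_Mapping.lookup P e *
      (\<Prod>i\<in>UNIV. z i powi Poly_Mapping.lookup e i))"

text \<open>
  The zeros of \<open>P\<close>, where \<open>ln 0 = 0\<close> by convention, form a null set for \<open>P \<noteq> 0\<close>.
\<close>
definition mahler :: "nat \<Rightarrow> 'n::finite laurent_poly \<Rightarrow> real"
  where "mahler k P =
    (\<integral>t. (ln (norm (laurent_eval P (\<lambda>i. exp (2 * of_real pi * \<i> * of_real (t i)))))) ^ k
      \<partial>(\<Pi>\<^sub>M i\<in>(UNIV :: 'n set). restrict_space lborel {0..1}))"

definition desc_tuples :: "nat \<Rightarrow> nat list set"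
  where "desc_tuples d = {l. length l = d \<and> sorted_wrt (>) l \<and> 0 \<notin> set l}"

text \<open>
  An unordered sum of nonnegative terms for \<open>x \<ge> 0\<close>; it converges for \<open>0 \<le> x < 1\<close>,
  and also at \<open>x = 1\<close> if \<open>hd A \<ge> 2\<close>.
\<close>
definition multi_L :: "nat list \<Rightarrow> real \<Rightarrow> real"
  where "multi_L A x =
    (\<Sum>\<^sub>\<infinity>l\<in>desc_tuples (length A). x ^ hd l / (\<Prod>j<length A. real (l ! j) ^ (A ! j)))"

definition rho_indices :: "nat \<Rightarrow> nat list set"
  where "rho_indices n = {A. sum_list A = n \<and> A \<noteq> [] \<and> hd A = 2 \<and> set (tl A) \<subseteq> {1, 2}}"

definition rho :: "nat \<Rightarrow> real \<Rightarrow> real"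
  where "rho n X =
    (if n = 0 then 1
     else if n = 1 then 0
     else (-1) ^ n * fact n / 4 ^ n * (\<Sum>A\<in>rho_indices n. 4 ^ length A * multi_L A (X\<^sup>2)))"

text \<open>
  For roots of unity the series may converge only conditionally (when \<open>a\<^sub>1 = 1\<close>), so its value is
  the limit of the partial sums over \<open>M \<ge> l\<^sub>1 > \<dots> > l\<^sub>n > 0\<close>.
\<close>
definition multi_Li :: "nat list \<Rightarrow> complex list \<Rightarrow> complex"
  where "multi_Li a z =
    lim (\<lambda>M. \<Sum>l\<in>{l \<in> desc_tuples (length a). set l \<subseteq> {..M}}.
      \<Prod>j<length a. (z ! j) ^ (l ! j) / of_nat (l ! j) ^ (a ! j))"

text \<open>
  The condition \<open>(hd a, hd z) \<noteq> (1, 1)\<close> is the convergence criterion for the series.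
\<close>
definition MPL_values :: "nat \<Rightarrow> nat \<Rightarrow> complex set"
  where "MPL_values k N = {multi_Li a z | a z.
    a \<noteq> [] \<and> length z = length a \<and> 0 \<notin> set a \<and> (\<forall>w\<in>set z. w ^ N = 1) \<and>
    sum_list a = k \<and> (hd a, hd z) \<noteq> (1, 1)}"

definition MPL_space :: "nat \<Rightarrow> nat \<Rightarrow> complex set"
  where "MPL_space k N =
    (if k = 0 then \<rat>
     else module.span (\<lambda>(q::rat) (w::complex). of_rat q * w) (MPL_values k N))"

lemma vector_space_rat_complex: "vector_space (\<lambda>(q::rat) (w::complex). of_rat q * w)"
  by unfold_locales (simp_all add: algebra_simps of_rat_add of_rat_mult)

end

theory Submission
  imports Defs "HOL-Complex_Analysis.Complex_Analysis" "HOL-Library.Function_Algebras"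
begin

text \<open>
  Integrating over one variable reduces the Mahler measure to the means of \<open>ln |1 + a e(t)| ^ k\<close>,
  \<open>|a| < 1\<close>. Parseval's identity for the powers of \<open>ln (1 + z)\<close> evaluates them: the coefficients of
  \<open>ln (1 + z) ^ j / j!\<close> are the coefficients of \<open>s ^ j\<close> in the binomials \<open>C(s, n)\<close>, and the
  coefficient of \<open>s ^ k\<close> in \<open>C(s, n) ^ 2\<close> is the weighted sum over words in 1 and 2 that defines
  \<open>rho k\<close>.

  For the membership, \<open>z = 4 sin^2 \<theta> = (1 - w)^2 / (1 + w + w^2)\<close> with \<open>0 < w < 1\<close> turns the forms
  \<open>dlog z\<close> and \<open>dlog (1 - z)\<close>, which generate the functions \<open>L_A (z)\<close>, into rational combinations
  of \<open>dw / (w - \<alpha>)\<close> with \<open>\<alpha> = 0\<close> or \<open>\<alpha> ^ 3 = 1\<close>. In the second integral \<open>1 / (4 sin^2 \<theta>) = q (1 - q)\<close>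
  with \<open>q\<close> on the line \<open>Re q = 1/2\<close>, and the integrand is the imaginary part of a holomorphic form
  \<open>Q(q) dq / q\<close> that is real on the segment from \<open>1/2\<close> to \<open>1\<close>. Hence the line can be replaced by
  the arc of \<open>|q| = 1\<close> from \<open>e^(-i pi/3)\<close> to \<open>1\<close>, on which
  \<open>q (1 - q) = (w - 1) (w - \<omega>) / (w - \<omega>^2)^2\<close> with \<open>\<omega> = e^(2 i pi/3)\<close> and \<open>0 < w < 1\<close> again.

  In both cases the powers of \<open>log z\<close> are iterated integrals from \<open>w = 0\<close> and \<open>L_A (z)\<close> is an
  iterated integral from \<open>w = 1\<close>, so their product with \<open>dlog ((w - \<omega>^2) / (w - \<omega>))\<close> integrates to a
  single concatenated iterated integral from 0 to 1. It converges at both ends, so no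
  regularisation is needed, and expanding it in powers of \<open>w\<close> gives multiple polylogarithms at
  cube roots of unity.
\<close>

section \<open>Power series on the unit disc\<close>

lemma norm_less_fps_conv_radius:
  fixes f :: "'a::{real_normed_field,banach} fps"
  assumes "Bseq (fps_nth f)" "norm z < 1"
  shows "norm z < fps_conv_radius f"
proof -
  obtain B where B: "\<And>n. norm (fps_nth f n) \<le> B"
    using assms(1) by (auto simp: Bseq_def)
  have "conv_radius (fps_nth f) \<ge> 1"
  proof (rule conv_radius_geI_ex')
    fix r :: real assume "0 < r" "ereal r < 1"
    hence "summable (\<lambda>n. B * r ^ n)" by (intro summable_mult summable_geometric) auto
    thus "summable (\<lambda>n. fps_nth f n * of_real r ^ n)"
      by (rule summable_comparison_test')
        (use \<open>0 < r\<close> B in \<open>simp add: norm_mult norm_power mult_right_mono\<close>)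
  qed
  moreover have "ereal (norm z) < 1" using assms(2) by simp
  ultimately show ?thesis unfolding fps_conv_radius_def by (rule less_le_trans[rotated])
qed

lemma eval_fps_of_poly_mult:
  fixes f :: "'a::{real_normed_field,banach} fps"
  assumes "norm z < fps_conv_radius f"
  shows "eval_fps (fps_of_poly p * f) z = poly p z * eval_fps f z"
  using assms by (simp add: eval_fps_mult)

lemma null_fps_bound:
  fixes f :: "'a::{real_normed_field,banach} fps"
  assumes "fps_nth f \<longlonglongrightarrow> 0" "e > 0"
  obtains C where "\<And>z. norm z < 1 \<Longrightarrow> norm (eval_fps f z) \<le> C + e / (1 - norm z)"
proof -
  have "Bseq (fps_nth f)" using assms(1) convergentI convergent_imp_Bseq by blast
  obtain N where N: "\<And>n. n \<ge> N \<Longrightarrow> norm (fps_nth f n) < e"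
    using assms by (metis (no_types, lifting) LIMSEQ_iff diff_zero)
  define head where "head n = (if n < N then norm (fps_nth f n) else 0)" for n
  have "norm (eval_fps f z) \<le> (\<Sum>n<N. norm (fps_nth f n)) + e / (1 - norm z)" if z: "norm z < 1" for z
  proof -
    have "head sums (\<Sum>n<N. norm (fps_nth f n))"
      using sums_If_finite[of "\<lambda>n. n < N" "\<lambda>n. norm (fps_nth f n)"]
      by (simp add: head_def[abs_def] lessThan_def)
    moreover have "(\<lambda>n. e * norm z ^ n) sums (e / (1 - norm z))"
      using sums_mult[OF geometric_sums, of "norm z" e] z by simp
    ultimately have bound_sums: "(\<lambda>n. head n + e * norm z ^ n) sums ((\<Sum>n<N. norm (fps_nth f n)) + e / (1 - norm z))"
      by (rule sums_add)
    have "norm (fps_nth f n * z ^ n) \<le> head n + e * norm z ^ n" for n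
    proof (cases "n < N")
      case True
      have "norm (fps_nth f n * z ^ n) \<le> norm (fps_nth f n) * 1"
        unfolding norm_mult norm_power using z by (intro mult_left_mono power_le_one) auto
      thus ?thesis using True assms(2) by (auto simp: head_def intro: add_increasing2)
    next
      case False
      thus ?thesis
        using less_imp_le[OF N[of n]] by (auto simp: head_def norm_mult norm_power intro!: mult_right_mono)
    qed
    with sums_eval_fps[OF norm_less_fps_conv_radius[OF \<open>Bseq (fps_nth f)\<close> z]] bound_sums
    show ?thesis by (rule norm_sums_le)
  qed
  thus ?thesis by (rule that)
qed

lemma null_fps_times_tendsto_0:
  fixes f :: "'a::{real_normed_field,banach} fps" and g z :: "'b \<Rightarrow> 'a"
  assumes null: "fps_nth f \<longlonglongrightarrow> 0" and g: "(g \<longlongrightarrow> 0) F"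
    and stolz: "\<forall>\<^sub>F x in F. norm (z x) < 1 \<and> norm (g x) \<le> K * (1 - norm (z x))"
  shows "((\<lambda>x. g x * eval_fps f (z x)) \<longlongrightarrow> 0) F"
proof (rule tendstoI)
  fix e :: real assume "e > 0"
  define \<epsilon> where "\<epsilon> = e / (2 * (\<bar>K\<bar> + 1))"
  have "\<epsilon> > 0" using \<open>e > 0\<close> by (auto simp: \<epsilon>_def intro!: divide_pos_pos)
  have "e * \<bar>K\<bar> < e * (2 * (\<bar>K\<bar> + 1))" using \<open>e > 0\<close> by (intro mult_strict_left_mono) auto
  hence "\<epsilon> * \<bar>K\<bar> < e" unfolding \<epsilon>_def times_divide_eq_left by (simp add: pos_divide_less_eq)
  obtain C where C: "\<And>z. norm z < 1 \<Longrightarrow> norm (eval_fps f z) \<le> C + \<epsilon> / (1 - norm z)"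
    using null_fps_bound[OF null \<open>\<epsilon> > 0\<close>] by blast
  have "((\<lambda>x. norm (g x) * C + \<epsilon> * \<bar>K\<bar>) \<longlongrightarrow> 0 * C + \<epsilon> * \<bar>K\<bar>) F"
    using g by (intro tendsto_intros tendsto_norm_zero)
  hence "\<forall>\<^sub>F x in F. norm (g x) * C + \<epsilon> * \<bar>K\<bar> < e"
    by (rule order_tendstoD(2)) (use \<open>\<epsilon> * \<bar>K\<bar> < e\<close> in simp)
  with stolz show "\<forall>\<^sub>F x in F. dist (g x * eval_fps f (z x)) 0 < e"
  proof eventually_elim
    case (elim x)
    hence pos: "1 - norm (z x) > 0" by simp
    have "norm (g x) \<le> \<bar>K\<bar> * (1 - norm (z x))"
      using elim pos by (meson abs_ge_self less_imp_le mult_right_mono order_trans)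
    have "norm (g x) * norm (eval_fps f (z x)) \<le> norm (g x) * (C + \<epsilon> / (1 - norm (z x)))"
      using elim C by (intro mult_left_mono) auto
    also have "\<dots> = norm (g x) * C + \<epsilon> * (norm (g x) / (1 - norm (z x)))"
      by (simp add: algebra_simps)
    also have "\<dots> \<le> norm (g x) * C + \<epsilon> * \<bar>K\<bar>"
      using pos \<open>\<epsilon> > 0\<close> \<open>norm (g x) \<le> \<bar>K\<bar> * (1 - norm (z x))\<close>
      by (intro add_left_mono mult_left_mono) (auto simp: pos_divide_le_eq)
    also have "\<dots> < e" using elim by simp
    finally show ?case by (simp add: norm_mult)
  qed
qed

lemma null_fps_times_one_minus_tendsto_0:
  fixes f :: "'a::{real_normed_field,banach} fps"
  assumes "fps_nth f \<longlonglongrightarrow> 0"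
  shows "((\<lambda>t::real. of_real (1 - t) * eval_fps f (of_real t)) \<longlongrightarrow> 0) (at_left 1)"
proof (rule null_fps_times_tendsto_0[OF assms])
  have "((\<lambda>t. of_real (1 - t) :: 'a) \<longlongrightarrow> of_real (1 - 1)) (at_left 1)" by (intro tendsto_intros)
  thus "((\<lambda>t. of_real (1 - t) :: 'a) \<longlongrightarrow> 0) (at_left 1)" by simp
  have "\<forall>\<^sub>F t::real in at_left 1. t \<in> {0<..<1}" by (rule eventually_at_left_real) simp
  thus "\<forall>\<^sub>F t::real in at_left 1. norm (of_real t :: 'a) < 1 \<and>
          norm (of_real (1 - t) :: 'a) \<le> 1 * (1 - norm (of_real t :: 'a))"
    unfolding norm_of_real by eventually_elim auto
qed

text \<open>Abel summation: \<open>f - s = (1 - X) S\<close>, where the coefficients of \<open>S\<close> tend to 0.\<close>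

lemma eval_fps_tendsto_at_left_1:
  fixes f :: "'a::{real_normed_field,banach} fps"
  assumes "fps_nth f sums s"
  shows "((\<lambda>t::real. eval_fps f (of_real t)) \<longlongrightarrow> s) (at_left 1)"
proof -
  define S where "S = Abs_fps (\<lambda>n. (\<Sum>m\<le>n. fps_nth f m) - s)"
  have "(\<lambda>n. (\<Sum>m\<le>n. fps_nth f m) - s) \<longlonglongrightarrow> s - s"
    using assms by (intro tendsto_intros) (simp add: sums_def_le)
  hence null: "fps_nth S \<longlonglongrightarrow> 0" by (simp add: S_def Abs_fps_inverse)
  hence "Bseq (fps_nth S)" using convergentI convergent_imp_Bseq by blast
  have "f = fps_of_poly [:1, - 1:] * S + fps_const s"
  proof (rule fps_ext)
    show "fps_nth f n = fps_nth (fps_of_poly [:1, - 1:] * S + fps_const s) n" for n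
      by (cases n) (simp_all add: S_def fps_of_poly_pCons algebra_simps)
  qed
  moreover have "eval_fps (fps_of_poly [:1, - 1:] * S + fps_const s) (of_real t) =
      s + of_real (1 - t) * eval_fps S (of_real t)"
    if "0 < t" "t < 1" for t :: real
  proof -
    have S: "ereal (norm (of_real t :: 'a)) < fps_conv_radius S"
      using that by (intro norm_less_fps_conv_radius \<open>Bseq (fps_nth S)\<close>) simp
    have "ereal (norm (of_real t :: 'a)) < fps_conv_radius (fps_of_poly [:1, - 1:] * S)"
      by (rule less_le_trans[OF S]) (use fps_conv_radius_mult[of "fps_of_poly [:1, - 1:]" S] in simp)
    thus ?thesis
      using S by (simp add: eval_fps_add eval_fps_of_poly_mult)
  qed
  moreover have "\<forall>\<^sub>F t::real in at_left 1. t \<in> {0<..<1}" by (rule eventually_at_left_real) simp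
  ultimately have "\<forall>\<^sub>F t in at_left 1. s + of_real (1 - t) * eval_fps S (of_real t) = eval_fps f (of_real t)"
    by (auto elim: eventually_mono)
  moreover have "((\<lambda>t. s + of_real (1 - t) * eval_fps S (of_real t)) \<longlongrightarrow> s + 0) (at_left 1)"
    by (intro tendsto_intros null_fps_times_one_minus_tendsto_0 null)
  ultimately show ?thesis by (simp add: Lim_transform_eventually)
qed

lemma summable_power_mult_bounded_variation:
  fixes b :: "nat \<Rightarrow> 'a::{real_normed_field,banach}"
  assumes "norm y = 1" "y \<noteq> 1" "b \<longlonglongrightarrow> 0" "summable (\<lambda>n. norm (b (Suc n) - b n))"
  shows "summable (\<lambda>n. y ^ n * b n)"
proof -
  have "summable (\<lambda>n. y ^ Suc n * (b (Suc n) - b n))"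
    using assms by (intro summable_norm_cancel[of "\<lambda>n. y ^ Suc n * (b (Suc n) - b n)"])
      (simp add: norm_mult norm_power)
  moreover have "(\<lambda>n. y ^ n * b n) \<longlonglongrightarrow> 0"
    using assms by (intro tendsto_norm_zero_cancel[of "\<lambda>n. y ^ n * b n"])
      (simp add: norm_mult norm_power tendsto_norm_zero)
  hence "summable (\<lambda>n. y ^ Suc n * b (Suc n) - y ^ n * b n)"
    by (rule telescope_summable)
  ultimately have "summable (\<lambda>n. y ^ Suc n * (b (Suc n) - b n) - (y ^ Suc n * b (Suc n) - y ^ n * b n))"
    by (rule summable_diff)
  hence "summable (\<lambda>n. (1 - y) * (y ^ n * b n))"
    by (rule summable_cong[THEN iffD1, rotated]) (auto simp: algebra_simps)
  thus ?thesis using assms(2) by simp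
qed

section \<open>Multiple polylogarithms in one variable\<close>

fun polylog_coeff :: "(nat \<times> 'a::real_normed_field) list \<Rightarrow> nat \<Rightarrow> 'a" where
  "polylog_coeff [] n = (if n = 0 then 1 else 0)"
| "polylog_coeff ((a, y) # ps) n = y ^ n / of_nat n ^ a * (\<Sum>m<n. polylog_coeff ps m)"

definition unimodular :: "(nat \<times> 'a::real_normed_field) list \<Rightarrow> bool"
  where "unimodular ps \<longleftrightarrow> (\<forall>(a, y)\<in>set ps. a > 0 \<and> norm y = 1)"

lemma unimodular_simps [simp]:
  "unimodular []" "unimodular ((a, y) # ps) \<longleftrightarrow> a > 0 \<and> norm y = 1 \<and> unimodular ps"
  by (auto simp: unimodular_def)

lemma polylog_coeff_0 [simp]: "ps \<noteq> [] \<Longrightarrow> polylog_coeff ps 0 = 0"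
  by (cases ps) auto

lemma sum_inverse_sqrt_le: "(\<Sum>m\<le>n. 1 / sqrt (real m)) \<le> 2 * sqrt (real n)"
proof (induction n)
  case (Suc n)
  have "2 * (sqrt (real n) * sqrt (real (Suc n))) \<le> 2 * real n + 1"
    using arith_geo_mean_sqrt[of "real n" "real (Suc n)"] by (simp add: real_sqrt_mult)
  hence "1 \<le> (2 * sqrt (real (Suc n)) - 2 * sqrt (real n)) * sqrt (real (Suc n))"
    by (simp add: algebra_simps)
  hence "1 / sqrt (real (Suc n)) \<le> 2 * sqrt (real (Suc n)) - 2 * sqrt (real n)"
    by (simp add: pos_divide_le_eq)
  with Suc show ?case by simp
qed simp

lemma norm_polylog_coeff_Cons_le:
  assumes "norm y = 1" "\<And>n. (\<Sum>m<n. norm (polylog_coeff ps m)) \<le> C * sqrt (real n)"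
  shows "norm (polylog_coeff ((a, y) # ps) n) \<le> C * sqrt (real n) / real n ^ a"
  using assms order_trans[OF norm_sum assms(2)]
  by (auto simp: norm_mult norm_divide norm_power intro!: divide_right_mono)

lemma sqrt_div_power_le: "n > 0 \<Longrightarrow> a > 0 \<Longrightarrow> sqrt (real n) / real n ^ a \<le> 1 / sqrt (real n)"
  using frac_le[of "sqrt (real n)" "sqrt (real n)" "real n ^ 1" "real n ^ a"] power_increasing[of 1 a "real n"]
  by (simp add: sqrt_divide_self_eq inverse_eq_divide)

lemma sum_norm_polylog_coeff_le:
  assumes "unimodular ps"
  obtains C where "C \<ge> 0" "\<And>n. (\<Sum>m<n. norm (polylog_coeff ps m)) \<le> C * sqrt (real n)"
  using assms
proof (induction ps arbitrary: thesis)
  case Nil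
  have "(\<Sum>m<n. norm (polylog_coeff [] m :: 'a)) \<le> 1 * sqrt (real n)" for n
    by (cases n) (auto simp: if_distrib sum.delta cong: if_cong)
  thus ?case using Nil(1)[of 1] by auto
next
  case (Cons p ps)
  obtain a y where p: "p = (a, y)" "a > 0" "norm y = 1" using Cons.prems(2) by (cases p) auto
  obtain C where C: "C \<ge> 0" "\<And>n. (\<Sum>m<n. norm (polylog_coeff ps m)) \<le> C * sqrt (real n)"
    using Cons.IH Cons.prems(2) p(1) by auto
  have coeff_le: "norm (polylog_coeff (p # ps) n) \<le> C * (1 / sqrt (real n))" for n
  proof (cases "n = 0")
    case False
    have "norm (polylog_coeff (p # ps) n) \<le> C * (sqrt (real n) / real n ^ a)"
      using norm_polylog_coeff_Cons_le[OF p(3) C(2)] p(1) by simp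
    also have "\<dots> \<le> C * (1 / sqrt (real n))"
      using False p(2) C(1) by (intro mult_left_mono sqrt_div_power_le) auto
    finally show ?thesis .
  qed simp
  have "(\<Sum>m<n. norm (polylog_coeff (p # ps) m)) \<le> (2 * C) * sqrt (real n)" for n
  proof -
    have "(\<Sum>m<n. norm (polylog_coeff (p # ps) m)) \<le> (\<Sum>m<n. C * (1 / sqrt (real m)))"
      by (intro sum_mono coeff_le)
    also have "\<dots> \<le> (\<Sum>m\<le>n. C * (1 / sqrt (real m)))"
      using C(1) by (intro sum_mono2) auto
    also have "\<dots> \<le> C * (2 * sqrt (real n))"
      unfolding sum_distrib_left[symmetric] using C(1) sum_inverse_sqrt_le by (intro mult_left_mono)
    finally show ?thesis by simp
  qed
  thus ?case using C(1) Cons.prems(1)[of "2 * C"] by simp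
qed

lemma norm_polylog_coeff_le_inverse_sqrt:
  assumes "unimodular ps"
  obtains C where "C \<ge> 0" "\<And>n. n > 0 \<Longrightarrow> norm (polylog_coeff ps n) \<le> C * (1 / sqrt (real n))"
proof (cases ps)
  case Nil
  thus ?thesis using that[of 0] by simp
next
  case (Cons p qs)
  obtain a y where p: "p = (a, y)" "a > 0" "norm y = 1" "unimodular qs"
    using assms Cons by (cases p) auto
  obtain C where C: "C \<ge> 0" "\<And>n. (\<Sum>m<n. norm (polylog_coeff qs m)) \<le> C * sqrt (real n)"
    using sum_norm_polylog_coeff_le[OF p(4)] by blast
  have "norm (polylog_coeff ps n) \<le> C * (1 / sqrt (real n))" if "n > 0" for n
  proof -
    have "norm (polylog_coeff ps n) \<le> C * (sqrt (real n) / real n ^ a)"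
      using norm_polylog_coeff_Cons_le[OF p(3) C(2)] by (simp add: Cons p(1))
    also have "\<dots> \<le> C * (1 / sqrt (real n))"
      using that p(2) C(1) by (intro mult_left_mono sqrt_div_power_le) auto
    finally show ?thesis .
  qed
  thus ?thesis using that C(1) by blast
qed

lemma polylog_coeff_tendsto_0:
  assumes "unimodular ps"
  shows "polylog_coeff ps \<longlonglongrightarrow> 0"
proof -
  obtain C where C: "\<And>n. n > 0 \<Longrightarrow> norm (polylog_coeff ps n) \<le> C * (1 / sqrt (real n))"
    using norm_polylog_coeff_le_inverse_sqrt[OF assms] by blast
  have "(\<lambda>n. C * (1 / sqrt (real n))) \<longlonglongrightarrow> C * 0"
    by (intro tendsto_intros tendsto_divide_0[OF tendsto_const] filterlim_at_top_imp_at_infinity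
          filterlim_compose[OF sqrt_at_top] filterlim_real_sequentially)
  hence "(\<lambda>n. C * (1 / sqrt (real n))) \<longlonglongrightarrow> 0" by simp
  moreover have "\<forall>\<^sub>F n in sequentially. norm (polylog_coeff ps n) \<le> C * (1 / sqrt (real n))"
    using eventually_gt_at_top[of 0] by eventually_elim (rule C)
  ultimately show ?thesis by (rule Lim_null_comparison[rotated])
qed

lemma summable_sqrt_div_sq: "summable (\<lambda>n. sqrt (real n) / real n ^ 2)"
proof -
  have "real n powr (-3/2) = sqrt (real n) / real n ^ 2" for n
  proof (cases "n = 0")
    case False
    have "real n powr (-3/2) = real n powr (1/2 - 2)" by simp
    also have "\<dots> = sqrt (real n) / real n ^ 2"
      using False by (subst powr_diff) (simp add: powr_half_sqrt powr_numeral)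
    finally show ?thesis .
  qed auto
  moreover have "summable (\<lambda>n. real n powr (-3/2))" by (simp add: summable_real_powr_iff)
  ultimately show ?thesis by simp
qed

lemma summable_norm_polylog_coeff:
  assumes "unimodular ((a, y) # ps)" "a \<ge> 2"
  shows "summable (\<lambda>n. norm (polylog_coeff ((a, y) # ps) n))"
proof -
  obtain C where C: "C \<ge> 0" "\<And>n. (\<Sum>m<n. norm (polylog_coeff ps m)) \<le> C * sqrt (real n)"
    using sum_norm_polylog_coeff_le[of ps] assms(1) by auto
  show ?thesis
  proof (rule summable_comparison_test')
    show "summable (\<lambda>n. C * (sqrt (real n) / real n ^ 2))"
      by (intro summable_mult summable_sqrt_div_sq)
    fix n :: nat assume "n \<ge> 1"
    have "norm (polylog_coeff ((a, y) # ps) n) \<le> C * sqrt (real n) / real n ^ a"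
      using assms(1) C(2) by (intro norm_polylog_coeff_Cons_le) auto
    also have "\<dots> \<le> C * sqrt (real n) / real n ^ 2"
      using \<open>n \<ge> 1\<close> assms(2) C(1) by (intro frac_le power_increasing) auto
    finally show "norm (norm (polylog_coeff ((a, y) # ps) n)) \<le> C * (sqrt (real n) / real n ^ 2)"
      by simp
  qed
qed

lemma summable_norm_diff_mean_polylog_coeff:
  fixes ps :: "(nat \<times> 'a::{real_normed_field,banach}) list"
  assumes "unimodular ps"
  defines "T \<equiv> \<lambda>n. \<Sum>m<n. polylog_coeff ps m"
  shows "summable (\<lambda>n. norm (T (Suc n) / of_nat (Suc n) - T n / of_nat n))"
proof -
  obtain C where C: "C \<ge> 0" "\<And>n. (\<Sum>m<n. norm (polylog_coeff ps m)) \<le> C * sqrt (real n)"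
    using sum_norm_polylog_coeff_le[OF assms(1)] by blast
  obtain D where D: "D \<ge> 0" "\<And>n. n > 0 \<Longrightarrow> norm (polylog_coeff ps n) \<le> D * (1 / sqrt (real n))"
    using norm_polylog_coeff_le_inverse_sqrt[OF assms(1)] by blast
  have T: "norm (T n) \<le> C * sqrt (real n)" for n
    unfolding T_def by (rule order_trans[OF norm_sum C(2)])
  show ?thesis
  proof (rule summable_comparison_test')
    show "summable (\<lambda>n. (D + C) * (sqrt (real n) / real n ^ 2))"
      by (intro summable_mult summable_sqrt_div_sq)
    fix n :: nat assume n: "n \<ge> 1"
    have "T (Suc n) / of_nat (Suc n) - T n / of_nat n =
          polylog_coeff ps n / of_nat (Suc n) + T n * (1 / of_nat (Suc n) - 1 / of_nat n)"
      by (simp add: T_def add_divide_distrib algebra_simps del: of_nat_Suc)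
    also have "1 / of_nat (Suc n) - 1 / of_nat n = (- 1 / (of_nat n * of_nat (Suc n)) :: 'a)"
      using n by (simp add: diff_frac_eq del: of_nat_Suc) simp
    also have "polylog_coeff ps n / of_nat (Suc n) + T n * \<dots> =
          polylog_coeff ps n / of_nat (Suc n) - T n / (of_nat n * of_nat (Suc n))"
      by simp
    also have "norm \<dots> \<le> norm (polylog_coeff ps n) / real (Suc n) + norm (T n) / (real n * real (Suc n))"
      by (rule norm_triangle_ineq4[THEN order_trans]) (simp add: norm_divide norm_mult del: of_nat_Suc)
    also have "\<dots> \<le> (D * (1 / sqrt (real n))) / real n + (C * sqrt (real n)) / (real n * real n)"
      using n D T[of n] C by (intro add_mono frac_le) auto
    also have "\<dots> = (D + C) * (sqrt (real n) / real n ^ 2)"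
      using n by (simp add: field_simps power2_eq_square)
    finally show "norm (norm (T (Suc n) / of_nat (Suc n) - T n / of_nat n)) \<le> (D + C) * (sqrt (real n) / real n ^ 2)"
      by simp
  qed
qed

lemma summable_polylog_coeff_weight_1:
  fixes y :: "'a::{real_normed_field,banach}"
  assumes "unimodular ps" "norm y = 1" "y \<noteq> 1"
  shows "summable (polylog_coeff ((1, y) # ps))"
proof -
  define c where "c n = (\<Sum>m<n. polylog_coeff ps m) / of_nat n" for n
  have coeff_eq: "polylog_coeff ((1, x) # ps) = (\<lambda>n. x ^ n * c n)" for x
    by (rule ext) (simp add: c_def)
  have "polylog_coeff ((1, 1) # ps) \<longlonglongrightarrow> 0"
    by (rule polylog_coeff_tendsto_0) (use assms in auto)
  hence "c \<longlonglongrightarrow> 0"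
    unfolding coeff_eq by simp
  moreover have "summable (\<lambda>n. norm (c (Suc n) - c n))"
    unfolding c_def by (rule summable_norm_diff_mean_polylog_coeff[OF assms(1)])
  ultimately show ?thesis
    unfolding coeff_eq using assms(2,3) by (intro summable_power_mult_bounded_variation)
qed

lemma summable_polylog_coeff:
  fixes ps :: "(nat \<times> 'a::{real_normed_field,banach}) list"
  assumes "unimodular ps" "ps \<noteq> []" "hd ps \<noteq> (1, 1)"
  shows "summable (polylog_coeff ps)"
proof -
  obtain a y qs where ps: "ps = (a, y) # qs" using assms(2) by (metis neq_Nil_conv surj_pair)
  show ?thesis
  proof (cases "a \<ge> 2")
    case True
    thus ?thesis using summable_norm_polylog_coeff[of a y qs] assms(1) ps summable_norm_cancel by blast
  next
    case False
    hence "a = 1" "y \<noteq> 1" using assms by (auto simp: ps)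
    thus ?thesis using summable_polylog_coeff_weight_1[of qs y] assms(1) by (simp add: ps)
  qed
qed

definition polylog_fps :: "(nat \<times> 'a::real_normed_field) list \<Rightarrow> 'a fps"
  where "polylog_fps ps = Abs_fps (polylog_coeff ps)"

definition polylog :: "(nat \<times> 'a::{real_normed_field,banach}) list \<Rightarrow> 'a \<Rightarrow> 'a"
  where "polylog ps = eval_fps (polylog_fps ps)"

lemma fps_nth_polylog_fps [simp]: "fps_nth (polylog_fps ps) = polylog_coeff ps"
  by (simp add: polylog_fps_def Abs_fps_inverse)

lemma norm_less_fps_conv_radius_polylog_fps:
  assumes "unimodular ps" "norm z < 1"
  shows "norm z < fps_conv_radius (polylog_fps ps)"
proof (rule norm_less_fps_conv_radius)
  show "Bseq (fps_nth (polylog_fps ps))"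
    using polylog_coeff_tendsto_0[OF assms(1)] by (simp add: convergentI convergent_imp_Bseq)
qed (rule assms)

lemma polylog_sums:
  assumes "unimodular ps" "norm z < 1"
  shows "(\<lambda>n. polylog_coeff ps n * z ^ n) sums polylog ps z"
  using sums_eval_fps[OF norm_less_fps_conv_radius_polylog_fps[OF assms]] by (simp add: polylog_def)

lemma polylog_Nil [simp]: "polylog [] z = 1"
  unfolding polylog_def eval_fps_def by (subst suminf_finite[of "{0}"]) auto

lemma polylog_0 [simp]: "ps \<noteq> [] \<Longrightarrow> polylog ps 0 = 0"
  by (simp add: polylog_def eval_fps_at_0)

lemma has_field_derivative_polylog:
  assumes "unimodular ps" "norm z < 1"
  shows "(polylog ps has_field_derivative eval_fps (fps_deriv (polylog_fps ps)) z) (at z)"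
  unfolding polylog_def
  by (rule has_field_derivative_eval_fps[OF norm_less_fps_conv_radius_polylog_fps[OF assms]])

lemma norm_less_fps_conv_radius_deriv_polylog_fps:
  assumes "unimodular ps" "norm z < 1"
  shows "norm z < fps_conv_radius (fps_deriv (polylog_fps ps))"
  using norm_less_fps_conv_radius_polylog_fps[OF assms] fps_conv_radius_deriv by (rule less_le_trans)

lemma continuous_on_polylog [continuous_intros]:
  assumes "unimodular ps" "continuous_on S f" "\<And>x. x \<in> S \<Longrightarrow> norm (f x) < 1"
  shows "continuous_on S (\<lambda>x. polylog ps (f x))"
proof (rule continuous_on_compose2[OF _ assms(2)])
  show "continuous_on (ball 0 1) (polylog ps)"
    by (intro continuous_at_imp_continuous_on ballI DERIV_isCont[OF has_field_derivative_polylog] assms(1)) simp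
qed (use assms(3) in auto)

lemma of_nat_times_polylog_coeff:
  "of_nat n * polylog_coeff ((Suc a, y) # ps) n = polylog_coeff ((a, y) # ps) n"
  by (cases "n = 0") auto

lemma has_field_derivative_polylog_Suc:
  assumes "unimodular ((a, y) # ps)" "norm z < 1" "z \<noteq> 0"
  shows "(polylog ((Suc a, y) # ps) has_field_derivative polylog ((a, y) # ps) z / z) (at z)"
proof -
  let ?f = "polylog_fps ((Suc a, y) # ps)"
  have um: "unimodular ((Suc a, y) # ps)" using assms(1) by simp
  have "fps_X * fps_deriv ?f = polylog_fps ((a, y) # ps)"
  proof (rule fps_ext)
    show "fps_nth (fps_X * fps_deriv ?f) n = fps_nth (polylog_fps ((a, y) # ps)) n" for n
      by (cases n) (simp_all add: of_nat_times_polylog_coeff del: of_nat_Suc polylog_coeff.simps)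
  qed
  hence "polylog ((a, y) # ps) z = eval_fps (fps_X * fps_deriv ?f) z" by (simp add: polylog_def)
  also have "\<dots> = z * eval_fps (fps_deriv ?f) z"
    by (subst eval_fps_mult) (use norm_less_fps_conv_radius_deriv_polylog_fps[OF um assms(2)] in auto)
  finally show ?thesis using has_field_derivative_polylog[OF um assms(2)] assms(3) by simp
qed

fun twist :: "'a::real_normed_field \<Rightarrow> (nat \<times> 'a) list \<Rightarrow> (nat \<times> 'a) list" where
  "twist x [] = []"
| "twist x ((a, y) # ps) = (a, x * y) # ps"

lemma unimodular_twist: "norm x = 1 \<Longrightarrow> unimodular (twist x ps) \<longleftrightarrow> unimodular ps"
  by (cases "(x, ps)" rule: twist.cases) (auto simp: norm_mult)

lemma polylog_coeff_twist: "polylog_coeff (twist x ps) n = x ^ n * polylog_coeff ps n"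
  by (cases "(x, ps)" rule: twist.cases) (auto simp: power_mult_distrib)

lemma polylog_twist: "polylog (twist x ps) z = polylog ps (x * z)"
  by (simp add: polylog_def eval_fps_def polylog_coeff_twist power_mult_distrib mult_ac)

lemma has_field_derivative_polylog_1:
  assumes "unimodular ps" "norm y = 1" "norm z < 1"
  shows "(polylog ((1, y) # ps) has_field_derivative y / (1 - y * z) * polylog ps (y * z)) (at z)"
proof -
  define g where "g = fps_deriv (polylog_fps ((1, y) # ps))"
  have um: "unimodular ((1, y) # ps)" "unimodular (twist y ps)"
    using assms by (auto simp: unimodular_twist)
  have g_nth: "fps_nth g n = y ^ Suc n * (\<Sum>m\<le>n. polylog_coeff ps m)" for n
    using of_nat_times_polylog_coeff[of "Suc n" 0 y ps]
    by (simp add: g_def lessThan_Suc_atMost del: of_nat_Suc)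
  have "fps_of_poly [:1, - y:] * g = fps_const y * polylog_fps (twist y ps)"
  proof (rule fps_ext)
    fix n
    have "fps_of_poly [:1, - y:] * g = g - fps_const y * (fps_X * g)"
      by (simp add: fps_of_poly_pCons algebra_simps flip: fps_const_neg)
    hence "fps_nth (fps_of_poly [:1, - y:] * g) n = fps_nth g n - y * (if n = 0 then 0 else fps_nth g (n - 1))"
      by simp
    thus "fps_nth (fps_of_poly [:1, - y:] * g) n = fps_nth (fps_const y * polylog_fps (twist y ps)) n"
      by (cases n) (simp_all add: g_nth polylog_coeff_twist, simp add: algebra_simps)
  qed
  moreover have "norm z < fps_conv_radius g"
    unfolding g_def by (rule norm_less_fps_conv_radius_deriv_polylog_fps[OF um(1) assms(3)])
  ultimately have "(1 - y * z) * eval_fps g z = eval_fps (fps_const y * polylog_fps (twist y ps)) z"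
    using eval_fps_of_poly_mult[of z g "[:1, - y:]"] by (simp add: mult.commute)
  also have "\<dots> = y * polylog ps (y * z)"
    using um(2) assms(3)
    by (simp add: eval_fps_mult norm_less_fps_conv_radius_polylog_fps flip: polylog_def polylog_twist)
  finally have "(1 - y * z) * eval_fps g z = y * polylog ps (y * z)" .
  moreover have "norm (y * z) < 1" using assms(2,3) by (simp add: norm_mult)
  hence "1 - y * z \<noteq> 0" by auto
  ultimately have "eval_fps g z = y / (1 - y * z) * polylog ps (y * z)"
    by (simp add: eq_divide_eq mult.commute)
  thus ?thesis using has_field_derivative_polylog[OF um(1) assms(3)] by (simp add: g_def)
qed

lemma polylog_tendsto_at_left_1:
  assumes "unimodular ps" "ps \<noteq> []" "hd ps \<noteq> (1, 1)"
  shows "((\<lambda>t::real. polylog ps (of_real t)) \<longlongrightarrow> suminf (polylog_coeff ps)) (at_left 1)"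
  unfolding polylog_def using summable_polylog_coeff[OF assms]
  by (intro eval_fps_tendsto_at_left_1) (simp add: summable_sums)

lemma polylog_times_one_minus_tendsto_0:
  assumes "unimodular ps"
  shows "((\<lambda>t::real. of_real (1 - t) * polylog ps (of_real t)) \<longlongrightarrow> 0) (at_left 1)"
  unfolding polylog_def
  by (intro null_fps_times_one_minus_tendsto_0) (simp add: polylog_coeff_tendsto_0 assms)

lemma polylog_bounded:
  assumes "unimodular ps" "ps = [] \<or> fst (hd ps) \<ge> 2"
  obtains B where "B \<ge> 0" "\<And>z. norm z < 1 \<Longrightarrow> norm (polylog ps z) \<le> B"
proof (cases ps)
  case Nil
  thus ?thesis using that[of 1] by simp
next
  case (Cons p qs)
  hence summable: "summable (\<lambda>n. norm (polylog_coeff ps n))"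
    using assms summable_norm_polylog_coeff[of "fst p" "snd p" qs] by simp
  have "norm (polylog ps z) \<le> suminf (\<lambda>n. norm (polylog_coeff ps n))" if "norm z < 1" for z
  proof -
    have "norm (polylog_coeff ps n * z ^ n) \<le> norm (polylog_coeff ps n)" for n
      using that by (simp add: norm_mult norm_power power_le_one mult_left_le)
    with polylog_sums[OF assms(1) that] summable_sums[OF summable] show ?thesis by (rule norm_sums_le)
  qed
  thus ?thesis using that suminf_nonneg[OF summable] by auto
qed

definition ones :: "nat list \<Rightarrow> (nat \<times> 'a::one) list"
  where "ones A = map (\<lambda>a. (a, 1)) A"

lemma ones_simps [simp]:
  "ones [] = []" "ones (a # A) = (a, 1) # ones A" "ones A = [] \<longleftrightarrow> A = []"
  by (auto simp: ones_def)

lemma unimodular_ones [simp]: "unimodular (ones A) \<longleftrightarrow> 0 \<notin> set A"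
  by (induction A) auto

lemma of_real_polylog_coeff_ones:
  "of_real (polylog_coeff (ones A) n) = (polylog_coeff (ones A) n :: 'a::real_normed_field)"
  by (induction A arbitrary: n) auto

lemma polylog_ones_of_real:
  assumes "0 \<notin> set A" "\<bar>x\<bar> < 1"
  shows "polylog (ones A) (of_real x :: 'a::{real_normed_field,banach}) = of_real (polylog (ones A) x)"
proof -
  have "(\<lambda>n. of_real (polylog_coeff (ones A) n * x ^ n) :: 'a) sums of_real (polylog (ones A) x)"
    using assms by (intro sums_of_real polylog_sums) auto
  moreover have "(\<lambda>n. polylog_coeff (ones A) n * of_real x ^ n) sums polylog (ones A) (of_real x :: 'a)"
    using assms by (intro polylog_sums) auto
  ultimately show ?thesis
    by (simp add: of_real_polylog_coeff_ones sums_unique2)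
qed

lemma polylog_ones_bounded:
  assumes "0 \<notin> set A" "A = [] \<or> hd A \<ge> 2"
  obtains B where "B \<ge> 0"
    "\<And>z::'a::{real_normed_field, banach}. norm z < 1 \<Longrightarrow> norm (polylog (ones A) z) \<le> B"
proof (rule polylog_bounded)
  show "unimodular (ones A :: (nat \<times> 'a) list)" using assms(1) by simp
  show "ones A = ([] :: (nat \<times> 'a) list) \<or> fst (hd (ones A :: (nat \<times> 'a) list)) \<ge> 2"
    using assms(2) by (cases A) auto
qed (rule that)

section \<open>Nested sums over descending tuples\<close>

definition bounded_tuples :: "nat \<Rightarrow> nat \<Rightarrow> nat list set"
  where "bounded_tuples d n = {l \<in> desc_tuples d. set l \<subseteq> {..<n}}"

lemma bounded_tuples_0 [simp]: "bounded_tuples 0 n = {[]}"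
  by (auto simp: bounded_tuples_def desc_tuples_def)

lemma Cons_in_desc_tuples_iff: "m # l \<in> desc_tuples (Suc d) \<longleftrightarrow> m \<ge> 1 \<and> l \<in> bounded_tuples d m"
  by (auto simp: desc_tuples_def bounded_tuples_def)

lemma desc_tuples_Suc: "desc_tuples (Suc d) = (\<lambda>(m, l). m # l) ` Sigma {1..} (bounded_tuples d)"
proof (intro equalityI subsetI)
  fix l assume "l \<in> desc_tuples (Suc d)"
  moreover from this obtain m k where "l = m # k" by (auto simp: desc_tuples_def length_Suc_conv)
  ultimately show "l \<in> (\<lambda>(m, l). m # l) ` Sigma {1..} (bounded_tuples d)"
    by (auto simp: Cons_in_desc_tuples_iff intro!: image_eqI[of _ _ "(m, k)"])
qed (auto simp: Cons_in_desc_tuples_iff)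

lemma bounded_tuples_Suc: "bounded_tuples (Suc d) n = (\<lambda>(m, l). m # l) ` Sigma {1..<n} (bounded_tuples d)"
proof -
  have "x < n" if "l \<in> bounded_tuples d m" "m < n" "x \<in> set l" for l m x
    using that by (auto simp: bounded_tuples_def)
  thus ?thesis
    unfolding bounded_tuples_def[of "Suc d"] desc_tuples_Suc by (fastforce simp: image_iff)
qed

lemma finite_bounded_tuples [simp]: "finite (bounded_tuples d n)"
  by (induction d arbitrary: n) (auto simp: bounded_tuples_Suc)

lemma sum_bounded_tuples_Suc:
  "(\<Sum>l\<in>bounded_tuples (Suc d) n. f l) = (\<Sum>m=1..<n. \<Sum>l\<in>bounded_tuples d m. f (m # l))"
  unfolding bounded_tuples_Suc
  by (subst sum.reindex) (auto simp: inj_on_def sum.Sigma intro!: sum.cong)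

lemma sum_bounded_tuples_eq_sum_polylog_coeff:
  fixes ys :: "'a::real_normed_field list"
  assumes "length ys = length as" "0 \<notin> set as" "n > 0"
  shows "(\<Sum>l\<in>bounded_tuples (length as) n.
            \<Prod>j<length as. (ys ! j) ^ (l ! j) / of_nat (l ! j) ^ (as ! j)) =
         (\<Sum>m<n. polylog_coeff (zip as ys) m)"
  using assms
proof (induction as arbitrary: ys n)
  case Nil
  thus ?case by (simp add: sum.delta)
next
  case (Cons a as)
  then obtain y ys' where ys: "ys = y # ys'" by (cases ys) auto
  have "(\<Sum>l\<in>bounded_tuples (length (a # as)) n.
            \<Prod>j<length (a # as). (ys ! j) ^ (l ! j) / of_nat (l ! j) ^ ((a # as) ! j)) =
        (\<Sum>m=1..<n. y ^ m / of_nat m ^ a * (\<Sum>l\<in>bounded_tuples (length as) m.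
            \<Prod>j<length as. (ys' ! j) ^ (l ! j) / of_nat (l ! j) ^ (as ! j)))"
    by (simp add: sum_bounded_tuples_Suc ys prod.lessThan_Suc_shift sum_distrib_left del: prod.lessThan_Suc)
  also have "\<dots> = (\<Sum>m=1..<n. polylog_coeff (zip (a # as) ys) m)"
    using Cons.prems by (intro sum.cong refl) (subst Cons.IH, auto simp: ys)
  also have "\<dots> = (\<Sum>m<n. polylog_coeff (zip (a # as) ys) m)"
    using Cons.prems by (intro sum.mono_neutral_left) (auto simp: ys)
  finally show ?case .
qed

lemma multi_Li_eq_suminf:
  assumes "length ys = length as" "0 \<notin> set as" "summable (polylog_coeff (zip as ys))"
  shows "multi_Li as ys = suminf (polylog_coeff (zip as ys))"
proof -
  have "(\<Sum>l\<in>{l \<in> desc_tuples (length as). set l \<subseteq> {..M}}.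
      \<Prod>j<length as. (ys ! j) ^ (l ! j) / of_nat (l ! j) ^ (as ! j)) =
      (\<Sum>m<Suc M. polylog_coeff (zip as ys) m)" for M
  proof -
    have "{l \<in> desc_tuples (length as). set l \<subseteq> {..M}} = bounded_tuples (length as) (Suc M)"
      by (simp add: bounded_tuples_def lessThan_Suc_atMost)
    thus ?thesis using sum_bounded_tuples_eq_sum_polylog_coeff[OF assms(1,2), of "Suc M"] by simp
  qed
  moreover have "(\<lambda>M. \<Sum>m<Suc M. polylog_coeff (zip as ys) m) \<longlonglongrightarrow> suminf (polylog_coeff (zip as ys))"
    using summable_LIMSEQ[OF assms(3)] by (rule LIMSEQ_Suc)
  ultimately show ?thesis unfolding multi_Li_def by (simp add: limI)
qed

lemma polylog_coeff_ones_nonneg: "polylog_coeff (ones A) n \<ge> (0 :: real)"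
  by (induction A arbitrary: n) (auto intro!: divide_nonneg_nonneg sum_nonneg)

lemma sum_bounded_tuples_ones:
  assumes "0 \<notin> set A" "n > 0"
  shows "(\<Sum>l\<in>bounded_tuples (length A) n. 1 / (\<Prod>j<length A. real (l ! j) ^ (A ! j))) =
           (\<Sum>m<n. polylog_coeff (ones A) m)"
proof -
  have "(\<Sum>l\<in>bounded_tuples (length A) n. 1 / (\<Prod>j<length A. real (l ! j) ^ (A ! j))) =
      (\<Sum>l\<in>bounded_tuples (length A) n. \<Prod>j<length A. (replicate (length A) 1 ! j) ^ (l ! j) / real (l ! j) ^ (A ! j))"
    by (simp add: prod_dividef)
  also have "\<dots> = (\<Sum>m<n. polylog_coeff (zip A (replicate (length A) 1)) m)"
    using assms by (intro sum_bounded_tuples_eq_sum_polylog_coeff) auto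
  also have "zip A (replicate (length A) 1) = ones A"
    by (induction A) auto
  finally show ?thesis .
qed

lemma multi_L_eq_polylog:
  assumes "A \<noteq> []" "0 \<notin> set A" "0 \<le> x" "x < 1"
  shows "multi_L A x = polylog (ones A) x"
proof -
  obtain a B where A: "A = a # B" using assms(1) by (cases A) auto
  define f where "f l = x ^ hd l / (\<Prod>j<length A. real (l ! j) ^ (A ! j))" for l
  have inner: "((\<lambda>l. f (m # l)) has_sum polylog_coeff (ones A) m * x ^ m) (bounded_tuples (length B) m)"
    if "m \<in> {1..}" for m
  proof (rule has_sum_finiteI)
    have "(\<Sum>l\<in>bounded_tuples (length B) m. f (m # l)) =
        x ^ m / real m ^ a * (\<Sum>l\<in>bounded_tuples (length B) m. 1 / (\<Prod>j<length B. real (l ! j) ^ (B ! j)))"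
      unfolding sum_distrib_left
      by (simp add: f_def A prod.lessThan_Suc_shift del: prod.lessThan_Suc)
    also have "\<dots> = polylog_coeff (ones A) m * x ^ m"
      using assms(2) that by (subst sum_bounded_tuples_ones) (auto simp: A)
    finally show "polylog_coeff (ones A) m * x ^ m = (\<Sum>l\<in>bounded_tuples (length B) m. f (m # l))" ..
  qed simp
  have "((\<lambda>m. polylog_coeff (ones A) m * x ^ m) has_sum polylog (ones A) x) UNIV"
    using assms by (intro sums_nonneg_imp_has_sum polylog_sums) (auto simp: polylog_coeff_ones_nonneg)
  hence outer: "((\<lambda>m. polylog_coeff (ones A) m * x ^ m) has_sum polylog (ones A) x) {1..}"
    by (rule has_sum_cong_neutral[THEN iffD1, rotated -1]) (use assms(1) in \<open>auto simp: not_le\<close>)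
  have "(\<lambda>(m, l). f (m # l)) summable_on Sigma {1..} (bounded_tuples (length B))"
    using assms(3) inner outer
    by (intro summable_on_SigmaI has_sum_imp_summable) (auto simp: f_def intro!: divide_nonneg_nonneg prod_nonneg)
  with inner outer have "((\<lambda>(m, l). f (m # l)) has_sum polylog (ones A) x) (Sigma {1..} (bounded_tuples (length B)))"
    by (intro has_sum_SigmaI) auto
  hence "(f has_sum polylog (ones A) x) (desc_tuples (length A))"
    by (simp add: A desc_tuples_Suc has_sum_reindex inj_on_def o_def case_prod_unfold)
  thus ?thesis unfolding multi_L_def f_def by (rule infsumI)
qed

section \<open>Polylogarithms at roots of unity\<close>

definition root_words :: "nat \<Rightarrow> nat \<Rightarrow> (nat \<times> complex) list set"
  where "root_words N n = {ps. sum_list (map fst ps) = n \<and> (\<forall>(a, y)\<in>set ps. a > 0 \<and> y ^ N = 1)}"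

definition convergent_root_words :: "nat \<Rightarrow> nat \<Rightarrow> (nat \<times> complex) list set"
  where "convergent_root_words N n = {ps \<in> root_words N n. ps \<noteq> [] \<and> hd ps \<noteq> (1, 1)}"

lemma convergent_root_words_subset: "convergent_root_words N n \<subseteq> root_words N n"
  by (auto simp: convergent_root_words_def)

lemma root_words_nonempty: "ps \<in> root_words N n \<Longrightarrow> n > 0 \<Longrightarrow> ps \<noteq> []"
  by (auto simp: root_words_def)

lemma unimodular_root_words: "N > 0 \<Longrightarrow> ps \<in> root_words N n \<Longrightarrow> unimodular ps"
  using power_eq_1_iff by (fastforce simp: root_words_def unimodular_def)

lemma twist_root_words: "ps \<in> root_words N n \<Longrightarrow> \<alpha> ^ N = 1 \<Longrightarrow> twist \<alpha> ps \<in> root_words N n"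
  by (cases "(\<alpha>, ps)" rule: twist.cases) (auto simp: root_words_def power_mult_distrib)

lemma summable_convergent_root_words:
  "N > 0 \<Longrightarrow> ps \<in> convergent_root_words N n \<Longrightarrow> summable (polylog_coeff ps)"
  by (intro summable_polylog_coeff unimodular_root_words[of N _ n]) (auto simp: convergent_root_words_def)

lemma MPL_values_eq:
  assumes "N > 0"
  shows "MPL_values n N = (\<lambda>ps. suminf (polylog_coeff ps)) ` convergent_root_words N n"
proof (intro equalityI subsetI)
  fix x assume "x \<in> MPL_values n N"
  then obtain a z where x: "x = multi_Li a z" and az: "a \<noteq> []" "length z = length a" "0 \<notin> set a"
    "\<forall>w\<in>set z. w ^ N = 1" "sum_list a = n" "(hd a, hd z) \<noteq> (1, 1)"
    by (auto simp: MPL_values_def)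
  have "zip a z \<in> convergent_root_words N n"
    using az by (cases a; cases z)
      (auto simp: convergent_root_words_def root_words_def dest: set_zip_leftD set_zip_rightD intro!: Nat.gr0I)
  moreover from this have "x = suminf (polylog_coeff (zip a z))"
    unfolding x using az assms by (intro multi_Li_eq_suminf summable_convergent_root_words) auto
  ultimately show "x \<in> (\<lambda>ps. suminf (polylog_coeff ps)) ` convergent_root_words N n" by blast
next
  fix x assume "x \<in> (\<lambda>ps. suminf (polylog_coeff ps)) ` convergent_root_words N n"
  then obtain ps where ps: "ps \<in> convergent_root_words N n" "x = suminf (polylog_coeff ps)" by blast
  have as: "0 \<notin> set (map fst ps)"
    using ps(1) by (force simp: convergent_root_words_def root_words_def)
  have "x = multi_Li (map fst ps) (map snd ps)"
    using as summable_convergent_root_words[OF assms ps(1)]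
    by (subst multi_Li_eq_suminf) (simp_all add: zip_map_fst_snd ps(2) del: set_map)
  thus "x \<in> MPL_values n N"
    unfolding MPL_values_def mem_Collect_eq using ps(1) as
    by (intro exI[of _ "map fst ps"] exI[of _ "map snd ps"])
      (auto simp: convergent_root_words_def root_words_def hd_map prod_eq_iff)
qed

interpretation rat_complex: vector_space "\<lambda>(q::rat) (w::complex). of_rat q * w"
  by (rule vector_space_rat_complex)

lemma MPL_space_eq_span:
  "N > 0 \<Longrightarrow> n > 0 \<Longrightarrow>
     MPL_space n N = rat_complex.span ((\<lambda>ps. suminf (polylog_coeff ps)) ` convergent_root_words N n)"
  by (simp add: MPL_space_def MPL_values_eq)

lemma subspace_MPL_space: "rat_complex.subspace (MPL_space n N)"
  unfolding MPL_space_def by (auto simp: rat_complex.subspace_def[of \<rat>])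

lemma suminf_polylog_coeff_in_MPL_space:
  assumes "N > 0" "ps \<in> convergent_root_words N n"
  shows "suminf (polylog_coeff ps) \<in> MPL_space n N"
proof -
  have "n > 0" using assms(2) by (cases ps) (auto simp: convergent_root_words_def root_words_def)
  thus ?thesis using assms by (simp add: MPL_space_eq_span rat_complex.span_base)
qed

lemma cnj_polylog_coeff: "cnj (polylog_coeff ps n) = polylog_coeff (map (map_prod id cnj) ps) n"
  by (induction ps n rule: polylog_coeff.induct) auto

lemma cnj_convergent_root_words:
  assumes "ps \<in> convergent_root_words N n"
  shows "map (map_prod id cnj) ps \<in> convergent_root_words N n"
  using assms
  by (cases ps) (auto simp: convergent_root_words_def root_words_def o_def case_prod_beta simp flip: complex_cnj_power)

lemma cnj_in_MPL_space:
  assumes "N > 0" "n > 0" "x \<in> MPL_space n N"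
  shows "cnj x \<in> MPL_space n N"
  using assms(3) unfolding MPL_space_eq_span[OF assms(1,2)]
proof (induction rule: rat_complex.span_induct_alt)
  case (step q x y)
  then obtain ps where ps: "ps \<in> convergent_root_words N n" "x = suminf (polylog_coeff ps)" by blast
  have "polylog_coeff ps sums x"
    using summable_sums[OF summable_convergent_root_words[OF assms(1) ps(1)]] ps(2) by simp
  hence "(\<lambda>n. cnj (polylog_coeff ps n)) sums cnj x" by (simp only: sums_cnj)
  hence "cnj x = suminf (polylog_coeff (map (map_prod id cnj) ps))"
    by (simp add: cnj_polylog_coeff sums_iff)
  hence "cnj x \<in> rat_complex.span ((\<lambda>ps. suminf (polylog_coeff ps)) ` convergent_root_words N n)"
    using cnj_convergent_root_words[OF ps(1)] by (auto intro: rat_complex.span_base)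
  moreover have "cnj (of_rat q) = of_rat q" by (cases q) (simp add: of_rat_rat)
  ultimately show ?case
    using step.IH by (simp add: rat_complex.span_add rat_complex.span_scale)
qed (simp add: rat_complex.span_zero)

interpretation rat_fun: vector_space "\<lambda>(q::rat) (f::complex \<Rightarrow> complex) z. of_rat q * f z"
  by unfold_locales (simp_all add: fun_eq_iff algebra_simps of_rat_add of_rat_mult)

definition polylog_span :: "(nat \<times> complex) list set \<Rightarrow> (complex \<Rightarrow> complex) set"
  where "polylog_span W = rat_fun.span (polylog ` W)"

lemma polylog_in_polylog_span: "ps \<in> W \<Longrightarrow> polylog ps \<in> polylog_span W"
  by (simp add: polylog_span_def rat_fun.span_base)

lemma polylog_span_0: "(\<lambda>_. 0) \<in> polylog_span W"
  using rat_fun.span_zero by (simp add: polylog_span_def zero_fun_def)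

lemma polylog_span_add: "f \<in> polylog_span W \<Longrightarrow> g \<in> polylog_span W \<Longrightarrow> (\<lambda>z. f z + g z) \<in> polylog_span W"
  using rat_fun.span_add[of f _ g] by (simp add: polylog_span_def plus_fun_def)

lemma polylog_span_scale: "f \<in> polylog_span W \<Longrightarrow> (\<lambda>z. of_rat q * f z) \<in> polylog_span W"
  unfolding polylog_span_def by (rule rat_fun.span_scale)

lemma polylog_span_mono: "W \<subseteq> W' \<Longrightarrow> polylog_span W \<subseteq> polylog_span W'"
  unfolding polylog_span_def by (intro rat_fun.span_mono image_mono)

lemma polylog_span_induct [consumes 1, case_names zero step]:
  assumes "f \<in> polylog_span W" "P (\<lambda>_. 0)"
    "\<And>q ps g. ps \<in> W \<Longrightarrow> P g \<Longrightarrow> P (\<lambda>z. of_rat q * polylog ps z + g z)"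
  shows "P f"
  using assms(1) unfolding polylog_span_def
  by (induction rule: rat_fun.span_induct_alt) (use assms(2,3) in \<open>auto simp: zero_fun_def plus_fun_def\<close>)

lemma polylog_span_at_0:
  assumes "f \<in> polylog_span (root_words N n)" "n > 0"
  shows "f 0 = 0"
  using assms(1) by (induction rule: polylog_span_induct) (use assms(2) in \<open>auto dest: root_words_nonempty\<close>)

lemma polylog_span_field_differentiable:
  assumes "f \<in> polylog_span (root_words N n)" "N > 0" "norm z < 1"
  shows "f field_differentiable (at z)"
  using assms(1)
proof (induction rule: polylog_span_induct)
  case (step q ps g)
  have "polylog ps field_differentiable (at z)"
    using has_field_derivative_polylog[OF unimodular_root_words[OF assms(2) step(1)] assms(3)]
    by (auto simp: field_differentiable_def)
  thus ?case using step(2) by (intro derivative_intros)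
qed simp

lemma polylog_span_convergent_tendsto:
  assumes "f \<in> polylog_span (convergent_root_words N n)" "N > 0"
  obtains c where "c \<in> MPL_space n N" "((\<lambda>t::real. f (of_real t)) \<longlongrightarrow> c) (at_left 1)"
  using assms(1)
proof (induction arbitrary: thesis rule: polylog_span_induct)
  case zero
  show ?case by (rule zero[of 0]) (auto intro: rat_complex.subspace_0[OF subspace_MPL_space])
next
  case (step q ps g)
  obtain c where c: "c \<in> MPL_space n N" "((\<lambda>t::real. g (of_real t)) \<longlongrightarrow> c) (at_left 1)"
    using step.IH by blast
  have "((\<lambda>t::real. polylog ps (of_real t)) \<longlongrightarrow> suminf (polylog_coeff ps)) (at_left 1)"
    using step.hyps assms(2) unimodular_root_words[of N ps n]
    by (intro polylog_tendsto_at_left_1) (auto simp: convergent_root_words_def)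
  hence "((\<lambda>t::real. of_rat q * polylog ps (of_real t) + g (of_real t)) \<longlongrightarrow>
            of_rat q * suminf (polylog_coeff ps) + c) (at_left 1)"
    by (intro tendsto_intros c)
  moreover have "of_rat q * suminf (polylog_coeff ps) + c \<in> MPL_space n N"
    by (intro rat_complex.subspace_add rat_complex.subspace_scale subspace_MPL_space c(1)
        suminf_polylog_coeff_in_MPL_space assms(2) step.hyps)
  ultimately show ?case using step.prems by blast
qed

lemma polylog_span_times_one_minus_tendsto_0:
  assumes "f \<in> polylog_span (root_words N n)" "N > 0"
  shows "((\<lambda>t::real. of_real (1 - t) * f (of_real t)) \<longlongrightarrow> 0) (at_left 1)"
  using assms(1)
proof (induction rule: polylog_span_induct)
  case (step q ps g)
  have "((\<lambda>t::real. of_rat q * (of_real (1 - t) * polylog ps (of_real t)) + of_real (1 - t) * g (of_real t))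
          \<longlongrightarrow> of_rat q * 0 + 0) (at_left 1)"
    using step.hyps assms(2)
    by (intro tendsto_intros step.IH polylog_times_one_minus_tendsto_0 unimodular_root_words)
  thus ?case by (simp add: algebra_simps)
qed simp

section \<open>Primitives with respect to logarithmic forms\<close>

definition log_form :: "(rat \<times> complex) list \<Rightarrow> complex \<Rightarrow> complex"
  where "log_form cs z = (\<Sum>(c, \<alpha>)\<leftarrow>cs. of_rat c / (z - \<alpha>))"

lemma log_form_simps [simp]:
  "log_form [] z = 0" "log_form ((c, \<alpha>) # cs) z = of_rat c / (z - \<alpha>) + log_form cs z"
  by (simp_all add: log_form_def)

lemma polylog_primitive:
  assumes "N > 0" "ps \<in> root_words N n" "\<alpha> ^ N = 1 \<or> \<alpha> = 0 \<and> n > 0"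
  obtains q qs where "qs \<in> (if \<alpha> = 1 then root_words N (Suc n) else convergent_root_words N (Suc n))"
    and "\<And>z. norm z < 1 \<Longrightarrow> z \<noteq> \<alpha> \<Longrightarrow>
      ((\<lambda>z. of_rat q * polylog qs z) has_field_derivative polylog ps z / (z - \<alpha>)) (at z)"
proof (cases "\<alpha> = 0")
  case True
  hence "n > 0" using assms(1,3) by (auto simp: power_0_left)
  then obtain a y qs where ps: "ps = (a, y) # qs"
    using root_words_nonempty[OF assms(2)] by (metis neq_Nil_conv surj_pair)
  show ?thesis
  proof (rule that[of "(Suc a, y) # qs" 1])
    show "(Suc a, y) # qs \<in> (if \<alpha> = 1 then root_words N (Suc n) else convergent_root_words N (Suc n))"
      using True assms(2) by (auto simp: ps root_words_def convergent_root_words_def)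
    show "((\<lambda>z. of_rat 1 * polylog ((Suc a, y) # qs) z) has_field_derivative polylog ps z / (z - \<alpha>)) (at z)"
      if "norm z < 1" "z \<noteq> \<alpha>" for z
      using has_field_derivative_polylog_Suc[of a y qs z] unimodular_root_words[OF assms(1,2)] that True
      by (simp add: ps)
  qed
next
  case False
  hence \<alpha>: "\<alpha> ^ N = 1" "norm \<alpha> = 1" using assms(1,3) power_eq_1_iff by auto
  have tw: "twist \<alpha> ps \<in> root_words N n" using assms(2) \<alpha>(1) by (rule twist_root_words)
  show ?thesis
  proof (rule that[of "(1, 1 / \<alpha>) # twist \<alpha> ps" "- 1"])
    show "(1, 1 / \<alpha>) # twist \<alpha> ps \<in> (if \<alpha> = 1 then root_words N (Suc n) else convergent_root_words N (Suc n))"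
      using tw \<alpha>(1) False by (auto simp: root_words_def convergent_root_words_def power_divide)
    fix z :: complex assume z: "norm z < 1" "z \<noteq> \<alpha>"
    have "(1 / \<alpha>) / (1 - 1 / \<alpha> * z) * polylog (twist \<alpha> ps) (1 / \<alpha> * z) = - (polylog ps z / (z - \<alpha>))"
      using False z(2) by (simp add: polylog_twist divide_simps) (simp add: algebra_simps)
    hence "(polylog ((1, 1 / \<alpha>) # twist \<alpha> ps) has_field_derivative - (polylog ps z / (z - \<alpha>))) (at z)"
      using has_field_derivative_polylog_1[of "twist \<alpha> ps" "1 / \<alpha>" z] z(1) \<alpha>(2)
        unimodular_root_words[OF assms(1) tw] by (simp add: norm_divide)
    from DERIV_minus[OF this]
    show "((\<lambda>z. of_rat (- 1) * polylog ((1, 1 / \<alpha>) # twist \<alpha> ps) z) has_field_derivative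
        polylog ps z / (z - \<alpha>)) (at z)"
      by (simp add: of_rat_minus)
  qed
qed

lemma polylog_span_primitive_pole:
  assumes "h \<in> polylog_span (root_words N n)" "N > 0" "\<alpha> ^ N = 1 \<or> \<alpha> = 0 \<and> n > 0"
  obtains H where "H \<in> polylog_span (if \<alpha> = 1 then root_words N (Suc n) else convergent_root_words N (Suc n))"
    and "\<And>z. norm z < 1 \<Longrightarrow> z \<noteq> \<alpha> \<Longrightarrow> (H has_field_derivative h z / (z - \<alpha>)) (at z)"
  using assms(1)
proof (induction arbitrary: thesis rule: polylog_span_induct)
  case zero
  show ?case by (rule zero[of "\<lambda>_. 0"]) (auto simp: polylog_span_0)
next
  case (step q ps h)
  let ?W = "if \<alpha> = 1 then root_words N (Suc n) else convergent_root_words N (Suc n)"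
  obtain H where H: "H \<in> polylog_span ?W"
    "\<And>z. norm z < 1 \<Longrightarrow> z \<noteq> \<alpha> \<Longrightarrow> (H has_field_derivative h z / (z - \<alpha>)) (at z)"
    using step.IH by blast
  obtain r qs where qs: "qs \<in> ?W" and deriv: "\<And>z. norm z < 1 \<Longrightarrow> z \<noteq> \<alpha> \<Longrightarrow>
      ((\<lambda>z. of_rat r * polylog qs z) has_field_derivative polylog ps z / (z - \<alpha>)) (at z)"
    using polylog_primitive[OF assms(2) step.hyps assms(3)] by metis
  show ?case
  proof (rule step.prems)
    show "(\<lambda>z. of_rat q * (of_rat r * polylog qs z) + H z) \<in> polylog_span ?W"
      by (intro polylog_span_add polylog_span_scale polylog_in_polylog_span qs H)
    show "((\<lambda>z. of_rat q * (of_rat r * polylog qs z) + H z) has_field_derivative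
        (of_rat q * polylog ps z + h z) / (z - \<alpha>)) (at z)" if "norm z < 1" "z \<noteq> \<alpha>" for z
      using DERIV_add[OF DERIV_cmult[OF deriv[OF that], of "of_rat q"] H(2)[OF that]]
      unfolding add_divide_distrib times_divide_eq_right .
  qed
qed

lemma polylog_span_primitive:
  assumes "h \<in> polylog_span (root_words N n)" "N > 0" "\<And>\<alpha>. \<alpha> \<in> snd ` set cs \<Longrightarrow> \<alpha> ^ N = 1 \<or> \<alpha> = 0 \<and> n > 0"
  obtains H where "H \<in> polylog_span (root_words N (Suc n))"
    and "1 \<notin> snd ` set cs \<Longrightarrow> H \<in> polylog_span (convergent_root_words N (Suc n))"
    and "\<And>z. norm z < 1 \<Longrightarrow> z \<notin> snd ` set cs \<Longrightarrow> (H has_field_derivative h z * log_form cs z) (at z)"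
  using assms(3)
proof (induction cs arbitrary: thesis)
  case Nil
  show ?case by (rule Nil(1)[of "\<lambda>_. 0"]) (auto simp: polylog_span_0)
next
  case (Cons p cs)
  obtain c \<alpha> where p: "p = (c, \<alpha>)" by (cases p)
  obtain H where H: "H \<in> polylog_span (root_words N (Suc n))"
    "1 \<notin> snd ` set cs \<Longrightarrow> H \<in> polylog_span (convergent_root_words N (Suc n))"
    "\<And>z. norm z < 1 \<Longrightarrow> z \<notin> snd ` set cs \<Longrightarrow> (H has_field_derivative h z * log_form cs z) (at z)"
    using Cons.IH Cons.prems(2) by auto
  obtain G where G: "G \<in> polylog_span (if \<alpha> = 1 then root_words N (Suc n) else convergent_root_words N (Suc n))"
    "\<And>z. norm z < 1 \<Longrightarrow> z \<noteq> \<alpha> \<Longrightarrow> (G has_field_derivative h z / (z - \<alpha>)) (at z)"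
    using polylog_span_primitive_pole[OF assms(1,2)] Cons.prems(2)[of \<alpha>] p by auto
  have "G \<in> polylog_span (root_words N (Suc n))"
    using G(1) polylog_span_mono[OF convergent_root_words_subset] by (auto split: if_splits)
  show ?case
  proof (rule Cons.prems(1))
    show "(\<lambda>z. of_rat c * G z + H z) \<in> polylog_span (root_words N (Suc n))"
      by (intro polylog_span_add polylog_span_scale H(1)) fact
    show "(\<lambda>z. of_rat c * G z + H z) \<in> polylog_span (convergent_root_words N (Suc n))"
      if "1 \<notin> snd ` set (p # cs)"
      using that G(1) H(2) by (intro polylog_span_add polylog_span_scale) (auto simp: p)
    show "((\<lambda>z. of_rat c * G z + H z) has_field_derivative h z * log_form (p # cs) z) (at z)"
      if "norm z < 1" "z \<notin> snd ` set (p # cs)" for z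
      using DERIV_add[OF DERIV_cmult[OF G(2)] H(3), of z c] that by (simp add: p algebra_simps)
  qed
qed

definition log_primitive :: "(rat \<times> complex) list \<Rightarrow> complex \<Rightarrow> complex"
  where "log_primitive cs z = (\<Sum>(c, \<alpha>)\<leftarrow>cs. of_rat c * Ln (1 - z / \<alpha>))"

lemma log_primitive_simps [simp]:
  "log_primitive [] z = 0"
  "log_primitive ((c, \<alpha>) # cs) z = of_rat c * Ln (1 - z / \<alpha>) + log_primitive cs z"
  by (simp_all add: log_primitive_def)

lemma log_primitive_0: "log_primitive cs 0 = 0"
  by (induction cs) auto

lemma has_field_derivative_log_primitive:
  assumes "\<And>\<alpha>. \<alpha> \<in> snd ` set cs \<Longrightarrow> norm \<alpha> = 1" "norm z < 1"
  shows "(log_primitive cs has_field_derivative log_form cs z) (at z)"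
  using assms(1)
proof (induction cs)
  case Nil
  show ?case by (simp add: log_primitive_def[abs_def])
next
  case (Cons p cs)
  obtain c \<alpha> where p: "p = (c, \<alpha>)" by (cases p)
  have \<alpha>: "norm \<alpha> = 1" using Cons.prems p by auto
  have "\<bar>Re (z / \<alpha>)\<bar> < 1"
    using abs_Re_le_cmod[of "z / \<alpha>"] assms(2) \<alpha> by (simp add: norm_divide)
  hence "1 - z / \<alpha> \<notin> \<real>\<^sub>\<le>\<^sub>0" by (auto simp: complex_nonpos_Reals_iff)
  hence "((\<lambda>z. Ln (1 - z / \<alpha>)) has_field_derivative - (1 / \<alpha>) / (1 - z / \<alpha>)) (at z)"
    using \<alpha> by (auto intro!: derivative_eq_intros simp: divide_inverse)
  also have "- (1 / \<alpha>) / (1 - z / \<alpha>) = 1 / (z - \<alpha>)"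
    using \<alpha> \<open>1 - z / \<alpha> \<notin> \<real>\<^sub>\<le>\<^sub>0\<close> by (auto simp: divide_simps)
  finally have "((\<lambda>z. of_rat c * Ln (1 - z / \<alpha>) + log_primitive cs z) has_field_derivative
      of_rat c * (1 / (z - \<alpha>)) + log_form cs z) (at z)"
    using Cons by (intro DERIV_add DERIV_cmult) auto
  thus ?case by (simp add: p log_primitive_def[abs_def])
qed

lemma log_primitive_power_in_polylog_span:
  assumes "N > 0" "\<And>\<alpha>. \<alpha> \<in> snd ` set cs \<Longrightarrow> \<alpha> ^ N = 1"
  obtains g where "g \<in> polylog_span (root_words N m)"
    "\<And>z. norm z < 1 \<Longrightarrow> g z = log_primitive cs z ^ m / fact m"
proof (induction m arbitrary: thesis)
  case 0
  have "polylog [] \<in> polylog_span (root_words N 0)"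
    by (rule polylog_in_polylog_span) (simp add: root_words_def)
  thus ?case by (rule 0) simp
next
  case (Suc m)
  let ?l = "log_primitive cs"
  have unit_letters: "norm \<alpha> = 1" if "\<alpha> \<in> snd ` set cs" for \<alpha>
    using assms that power_eq_1_iff by auto
  obtain g where g: "g \<in> polylog_span (root_words N m)" "\<And>z. norm z < 1 \<Longrightarrow> g z = ?l z ^ m / fact m"
    using Suc.IH by blast
  obtain G where G: "G \<in> polylog_span (root_words N (Suc m))"
    "\<And>z. norm z < 1 \<Longrightarrow> z \<notin> snd ` set cs \<Longrightarrow> (G has_field_derivative g z * log_form cs z) (at z)"
    using polylog_span_primitive[OF g(1) assms(1)] assms(2) by metis
  have "\<exists>C. \<forall>z\<in>ball 0 1. G z - ?l z ^ Suc m / fact (Suc m) = C"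
  proof (rule has_field_derivative_zero_constant)
    fix z :: complex assume "z \<in> ball 0 1"
    hence z: "norm z < 1" "z \<notin> snd ` set cs" using unit_letters[of z] by auto
    have "((\<lambda>z. ?l z ^ Suc m) has_field_derivative of_nat (Suc m) * ?l z ^ m * log_form cs z) (at z)"
      using DERIV_power[where n = "Suc m", OF has_field_derivative_log_primitive[OF unit_letters z(1)]]
      by (simp add: mult_ac del: of_nat_Suc power_Suc)
    hence "((\<lambda>z. G z - ?l z ^ Suc m / fact (Suc m)) has_field_derivative
        g z * log_form cs z - of_nat (Suc m) * ?l z ^ m * log_form cs z / fact (Suc m)) (at z)"
      by (intro DERIV_diff DERIV_cdivide G(2) z)
    also have "g z * log_form cs z - of_nat (Suc m) * ?l z ^ m * log_form cs z / fact (Suc m) = 0"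
      by (simp add: g(2)[OF z(1)] fact_Suc divide_simps del: of_nat_Suc)
    finally show "((\<lambda>z. G z - ?l z ^ Suc m / fact (Suc m)) has_field_derivative 0) (at z within ball 0 1)"
      by (rule has_field_derivative_at_within)
  qed simp
  then obtain C where C: "\<And>z. norm z < 1 \<Longrightarrow> G z - ?l z ^ Suc m / fact (Suc m) = C" by auto
  have "C = 0" using C[of 0] polylog_span_at_0[OF G(1)] log_primitive_0 by simp
  thus ?case using Suc.prems[OF G(1)] C by auto
qed

section \<open>Iterated integrals along a path\<close>

locale polylog_path =
  fixes N :: nat and Z :: "complex \<Rightarrow> complex" and as bs :: "(rat \<times> complex) list" and K :: real
  assumes N_pos: "N > 0"
    and letters_as: "\<alpha> \<in> snd ` set as \<Longrightarrow> \<alpha> ^ N = 1"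
    and letters_bs: "\<alpha> \<in> snd ` set bs \<Longrightarrow> \<alpha> ^ N = 1 \<or> \<alpha> = 0"
    and one_notin_letters_bs: "1 \<notin> snd ` set bs"
    and dlog_Z: "\<And>t::real. 0 < t \<Longrightarrow> t < 1 \<Longrightarrow>
      (Z has_field_derivative Z t * log_form as t) (at (of_real t))"
    and dlog_one_minus_Z: "\<And>t::real. 0 < t \<Longrightarrow> t < 1 \<Longrightarrow>
      (Z has_field_derivative (1 - Z t) * log_form bs t) (at (of_real t))"
    and Z_nonzero: "\<And>t::real. 0 < t \<Longrightarrow> t < 1 \<Longrightarrow> Z t \<noteq> 0"
    and norm_Z_less_1: "\<And>t::real. 0 < t \<Longrightarrow> t < 1 \<Longrightarrow> norm (Z t) < 1"
    and norm_Z_le: "\<And>t::real. 0 < t \<Longrightarrow> t < 1 \<Longrightarrow> norm (Z t) \<le> K * (1 - t)"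
    and one_minus_norm_Z_ge: "\<And>t::real. 0 < t \<Longrightarrow> t < 1 \<Longrightarrow> t \<le> K * (1 - norm (Z t))"
begin

lemma has_field_derivative_polylog_Z:
  fixes t :: real
  assumes "0 < t" "t < 1" "0 \<notin> set (a # A)"
  shows "((\<lambda>z. polylog (ones (a # A)) (Z z)) has_field_derivative
     polylog (ones (if a = 1 then A else (a - 1) # A)) (Z t) *
       log_form (if a = 1 then bs else as) t) (at (of_real t))"
proof (cases "a = 1")
  case True
  have "(polylog (ones (a # A)) has_field_derivative 1 / (1 - 1 * Z t) * polylog (ones A) (1 * Z t)) (at (Z t))"
    unfolding True ones_simps by (rule has_field_derivative_polylog_1) (use assms norm_Z_less_1 in auto)
  from DERIV_chain2[OF this dlog_one_minus_Z[OF assms(1,2)]]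
  moreover have "Z t \<noteq> 1" using norm_Z_less_1[OF assms(1,2)] by auto
  ultimately show ?thesis using True by (simp add: mult_ac)
next
  case False
  then obtain b where b: "a = Suc b" "b > 0" using assms(3) by (cases a) auto
  have "(polylog (ones (a # A)) has_field_derivative polylog (ones (b # A)) (Z t) / Z t) (at (Z t))"
    unfolding b(1) ones_simps
    by (rule has_field_derivative_polylog_Suc) (use assms b norm_Z_less_1 Z_nonzero in auto)
  from DERIV_chain2[OF this dlog_Z[OF assms(1,2)]]
  show ?thesis using Z_nonzero[OF assms(1,2)] False b by (simp add: mult_ac)
qed

lemma polylog_Z_derivative_in_shorter_word:
  assumes "A \<noteq> []" "0 \<notin> set A"
  obtains A' cs where "0 \<notin> set A'" "sum_list A = Suc (sum_list A')" "A' \<noteq> [] \<or> 1 \<notin> snd ` set cs"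
    "\<And>\<alpha>. \<alpha> \<in> snd ` set cs \<Longrightarrow> \<alpha> ^ N = 1 \<or> \<alpha> = 0"
    "\<And>t::real. 0 < t \<Longrightarrow> t < 1 \<Longrightarrow> ((\<lambda>z. polylog (ones A) (Z z)) has_field_derivative
       polylog (ones A') (Z t) * log_form cs t) (at (of_real t))"
proof -
  obtain a B where A: "A = a # B" using assms(1) by (cases A) auto
  define A' where "A' = (if a = 1 then B else (a - 1) # B)"
  define cs where "cs = (if a = 1 then bs else as)"
  show ?thesis
  proof (rule that[of A' cs])
    show "0 \<notin> set A'" "sum_list A = Suc (sum_list A')"
      using assms(2) by (auto simp: A A'_def)
    show "A' \<noteq> [] \<or> 1 \<notin> snd ` set cs"
      using one_notin_letters_bs by (auto simp: A'_def cs_def)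
    show "\<alpha> ^ N = 1 \<or> \<alpha> = 0" if "\<alpha> \<in> snd ` set cs" for \<alpha>
      using that letters_as[of \<alpha>] letters_bs[of \<alpha>] by (auto simp: cs_def split: if_splits)
    show "((\<lambda>z. polylog (ones A) (Z z)) has_field_derivative polylog (ones A') (Z t) * log_form cs t)
        (at (of_real t))" if "0 < t" "t < 1" for t :: real
      unfolding A A'_def cs_def using has_field_derivative_polylog_Z[OF that] assms(2) unfolding A .
  qed
qed

lemma polylog_span_times_polylog_Z_tendsto_at_left_1:
  assumes "H \<in> polylog_span (root_words N n)" "A \<noteq> []" "0 \<notin> set A"
  shows "((\<lambda>t::real. H t * polylog (ones A) (Z t)) \<longlongrightarrow> 0) (at_left 1)"
proof -
  let ?L = "polylog (ones A) :: complex \<Rightarrow> complex"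
  have near_1: "\<forall>\<^sub>F t::real in at_left 1. t \<in> {0<..<1}" by (rule eventually_at_left_real) simp
  have "((\<lambda>t::real. K * (1 - t)) \<longlongrightarrow> K * (1 - 1)) (at_left 1)" by (intro tendsto_intros)
  hence "((\<lambda>t::real. K * (1 - t)) \<longlongrightarrow> 0) (at_left 1)" by simp
  moreover have "\<forall>\<^sub>F t::real in at_left 1. norm (Z t) \<le> K * (1 - t)"
    using near_1 by eventually_elim (simp add: norm_Z_le)
  ultimately have "((\<lambda>t::real. Z t) \<longlongrightarrow> 0) (at_left 1)" by (rule Lim_null_comparison[rotated])
  moreover have "\<forall>\<^sub>F t::real in at_left 1. Z t \<noteq> 0"
    using near_1 by eventually_elim (simp add: Z_nonzero)
  ultimately have Z: "filterlim (\<lambda>t::real. Z t) (at 0) (at_left 1)" by (simp add: filterlim_at)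
  obtain D where "(?L has_field_derivative D) (at 0)"
    using has_field_derivative_polylog[of "ones A" "0::complex"] assms(3) by auto
  hence "((\<lambda>z. ?L z / z) \<longlongrightarrow> D) (at 0)" using assms(2) by (simp add: DERIV_def)
  hence "((\<lambda>t::real. ?L (Z t) / Z t) \<longlongrightarrow> D) (at_left 1)" by (rule filterlim_compose[OF _ Z])
  hence "((\<lambda>t::real. (of_real (1 - t) * H t) * (?L (Z t) / Z t)) \<longlongrightarrow> 0 * D) (at_left 1)"
    using polylog_span_times_one_minus_tendsto_0[OF assms(1) N_pos] by (intro tendsto_mult)
  hence null: "((\<lambda>t::real. (of_real (1 - t) * H t) * (?L (Z t) / Z t)) \<longlongrightarrow> 0) (at_left 1)"
    by (simp only: mult_zero_left)
  have bounded: "\<forall>\<^sub>F t::real in at_left 1. norm (Z t / of_real (1 - t)) \<le> K"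
    using near_1
  proof eventually_elim
    case (elim t)
    hence "norm (complex_of_real (1 - t)) = 1 - t" by (simp only: norm_of_real) simp
    thus ?case using norm_Z_le[of t] elim by (simp add: norm_divide pos_divide_le_eq del: of_real_diff)
  qed
  have "\<forall>\<^sub>F t::real in at_left 1.
      ((of_real (1 - t) * H t) * (?L (Z t) / Z t)) * (Z t / of_real (1 - t)) = H t * ?L (Z t)"
    using near_1 by eventually_elim (simp add: Z_nonzero del: of_real_diff)
  with lim_null_mult_right_bounded[OF null bounded] show ?thesis by (rule Lim_transform_eventually)
qed

lemma polylog_span_times_polylog_Z_tendsto_at_right_0:
  assumes "H \<in> polylog_span (root_words N n)" "n > 0" "0 \<notin> set A"
  shows "((\<lambda>t::real. H t * polylog (ones A) (Z t)) \<longlongrightarrow> 0) (at_right 0)"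
proof -
  let ?L = "polylog (ones A) :: complex \<Rightarrow> complex"
  have near_0: "\<forall>\<^sub>F t::real in at_right 0. t \<in> {0<..<1}" by (rule eventually_at_right_real) simp
  have of_real: "filterlim complex_of_real (at 0) (at_right 0)"
    unfolding filterlim_at using near_0 by (auto intro!: tendsto_eq_intros elim: eventually_mono)
  obtain D where "(H has_field_derivative D) (at 0)"
    using polylog_span_field_differentiable[OF assms(1) N_pos, of 0] by (auto simp: field_differentiable_def)
  hence "((\<lambda>z. H z / z) \<longlongrightarrow> D) (at 0)"
    using polylog_span_at_0[OF assms(1,2)] by (simp add: DERIV_def)
  hence "((\<lambda>t::real. H t / of_real t) \<longlongrightarrow> D) (at_right 0)" by (rule filterlim_compose[OF _ of_real])
  moreover have "((\<lambda>t::real. of_real t * ?L (Z t)) \<longlongrightarrow> 0) (at_right 0)"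
    unfolding polylog_def
  proof (rule null_fps_times_tendsto_0)
    show "fps_nth (polylog_fps (ones A) :: complex fps) \<longlonglongrightarrow> 0"
      using assms(3) by (simp add: polylog_coeff_tendsto_0)
    show "(complex_of_real \<longlongrightarrow> 0) (at_right 0)" using of_real by (simp add: filterlim_at)
    show "\<forall>\<^sub>F t::real in at_right 0. norm (Z t) < 1 \<and> norm (complex_of_real t) \<le> K * (1 - norm (Z t))"
      using near_0 by eventually_elim (simp add: norm_Z_less_1 one_minus_norm_Z_ge)
  qed
  ultimately have "((\<lambda>t::real. (H t / of_real t) * (of_real t * ?L (Z t))) \<longlongrightarrow> D * 0) (at_right 0)"
    by (rule tendsto_mult)
  moreover have "\<forall>\<^sub>F t::real in at_right 0. (H t / of_real t) * (of_real t * ?L (Z t)) = H t * ?L (Z t)"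
    using near_0 by eventually_elim simp
  ultimately show ?thesis by (simp add: Lim_transform_eventually)
qed

lemma primitive_on_path:
  assumes "g \<in> polylog_span (root_words N n)" "\<And>\<alpha>. \<alpha> \<in> snd ` set cs \<Longrightarrow> \<alpha> ^ N = 1 \<or> \<alpha> = 0 \<and> n > 0"
  obtains H where "H \<in> polylog_span (root_words N (Suc n))"
    "1 \<notin> snd ` set cs \<Longrightarrow> H \<in> polylog_span (convergent_root_words N (Suc n))"
    "\<And>t::real. 0 < t \<Longrightarrow> t < 1 \<Longrightarrow> (H has_field_derivative g t * log_form cs t) (at (of_real t))"
proof -
  obtain H where H: "H \<in> polylog_span (root_words N (Suc n))"
    "1 \<notin> snd ` set cs \<Longrightarrow> H \<in> polylog_span (convergent_root_words N (Suc n))"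
    and deriv: "\<And>z. norm z < 1 \<Longrightarrow> z \<notin> snd ` set cs \<Longrightarrow> (H has_field_derivative g z * log_form cs z) (at z)"
    using polylog_span_primitive[OF assms(1) N_pos assms(2)] by blast
  have "(H has_field_derivative g t * log_form cs t) (at (of_real t))" if "0 < t" "t < 1" for t :: real
  proof (rule deriv)
    show "complex_of_real t \<notin> snd ` set cs"
      using assms(2)[of "of_real t"] power_eq_1_iff[of "complex_of_real t" N] N_pos that by auto
  qed (use that in simp)
  with H show ?thesis by (rule that)
qed

lemma tendsto_by_parts:
  assumes "H \<in> polylog_span (root_words N n)" "n > 0" "A \<noteq> []" "0 \<notin> set A"
    and "((\<lambda>t::real. P t) \<longlongrightarrow> 0) (at_right 0)" "((\<lambda>t::real. P t) \<longlongrightarrow> v) (at_left 1)"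
  shows "((\<lambda>t::real. H t * polylog (ones A) (Z t) - P t) \<longlongrightarrow> 0) (at_right 0)"
    and "((\<lambda>t::real. H t * polylog (ones A) (Z t) - P t) \<longlongrightarrow> - v) (at_left 1)"
proof -
  have "((\<lambda>t::real. H t * polylog (ones A) (Z t) - P t) \<longlongrightarrow> 0 - 0) (at_right 0)"
    by (intro tendsto_diff polylog_span_times_polylog_Z_tendsto_at_right_0[OF assms(1)] assms)
  thus "((\<lambda>t::real. H t * polylog (ones A) (Z t) - P t) \<longlongrightarrow> 0) (at_right 0)" by simp
  have "((\<lambda>t::real. H t * polylog (ones A) (Z t) - P t) \<longlongrightarrow> 0 - v) (at_left 1)"
    by (intro tendsto_diff polylog_span_times_polylog_Z_tendsto_at_left_1[OF assms(1)] assms)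
  thus "((\<lambda>t::real. H t * polylog (ones A) (Z t) - P t) \<longlongrightarrow> - v) (at_left 1)" by simp
qed

text \<open>
  Integration by parts moves the letters of \<open>A\<close> one at a time from \<open>polylog (ones A) \<circ> Z\<close>, an iterated
  integral based at \<open>t = 1\<close>, to \<open>g\<close>, an iterated integral based at \<open>t = 0\<close>.
\<close>

lemma iterated_integral_in_MPL_space:
  assumes "g \<in> polylog_span (root_words N n)" "\<And>\<alpha>. \<alpha> \<in> snd ` set cs \<Longrightarrow> \<alpha> ^ N = 1 \<or> \<alpha> = 0 \<and> n > 0"
    "A \<noteq> [] \<or> 1 \<notin> snd ` set cs" "0 \<notin> set A"
  obtains F v where "v \<in> MPL_space (n + 1 + sum_list A) N"
    "\<And>t::real. 0 < t \<Longrightarrow> t < 1 \<Longrightarrow>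
       (F has_field_derivative g t * log_form cs t * polylog (ones A) (Z t)) (at (of_real t))"
    "((\<lambda>t::real. F t) \<longlongrightarrow> 0) (at_right 0)" "((\<lambda>t::real. F t) \<longlongrightarrow> v) (at_left 1)"
  using assms
proof (induction "sum_list A" arbitrary: A g n cs thesis rule: less_induct)
  case less
  obtain H where H: "H \<in> polylog_span (root_words N (Suc n))"
    and H_conv: "1 \<notin> snd ` set cs \<Longrightarrow> H \<in> polylog_span (convergent_root_words N (Suc n))"
    and dH: "\<And>t::real. 0 < t \<Longrightarrow> t < 1 \<Longrightarrow> (H has_field_derivative g t * log_form cs t) (at (of_real t))"
    using primitive_on_path[OF less.prems(2,3)] by blast
  show ?case
  proof (cases "A = []")
    case True
    obtain v where v: "v \<in> MPL_space (Suc n) N" "((\<lambda>t::real. H t) \<longlongrightarrow> v) (at_left 1)"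
      using polylog_span_convergent_tendsto[OF H_conv N_pos] less.prems(4) True by auto
    have "((\<lambda>t::real. H t) \<longlongrightarrow> 0) (at_right 0)"
      using polylog_span_times_polylog_Z_tendsto_at_right_0[OF H, of "[]"] by simp
    thus ?thesis using less.prems(1)[of v H] v dH True by simp
  next
    case False
    obtain A' ds where A': "0 \<notin> set A'" "sum_list A = Suc (sum_list A')" "A' \<noteq> [] \<or> 1 \<notin> snd ` set ds"
      and ds: "\<And>\<alpha>. \<alpha> \<in> snd ` set ds \<Longrightarrow> \<alpha> ^ N = 1 \<or> \<alpha> = 0"
      and dL: "\<And>t::real. 0 < t \<Longrightarrow> t < 1 \<Longrightarrow> ((\<lambda>z. polylog (ones A) (Z z)) has_field_derivative
        polylog (ones A') (Z t) * log_form ds t) (at (of_real t))"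
      using polylog_Z_derivative_in_shorter_word[OF False less.prems(5)] by blast
    obtain P v where v: "v \<in> MPL_space (Suc n + 1 + sum_list A') N"
      and dP: "\<And>t::real. 0 < t \<Longrightarrow> t < 1 \<Longrightarrow>
         (P has_field_derivative H t * log_form ds t * polylog (ones A') (Z t)) (at (of_real t))"
      and P: "((\<lambda>t::real. P t) \<longlongrightarrow> 0) (at_right 0)" "((\<lambda>t::real. P t) \<longlongrightarrow> v) (at_left 1)"
      by (rule less.hyps[of A' "Suc n" H ds]) (use A' H ds in auto)
    show ?thesis
    proof (rule less.prems(1))
      show "- v \<in> MPL_space (n + 1 + sum_list A) N"
        using rat_complex.subspace_neg[OF subspace_MPL_space v] A'(2) by simp
      show "((\<lambda>z. H z * polylog (ones A) (Z z) - P z) has_field_derivative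
          g t * log_form cs t * polylog (ones A) (Z t)) (at (of_real t))" if "0 < t" "t < 1" for t :: real
        using DERIV_diff[OF DERIV_mult[OF dH dL] dP] that by (simp add: algebra_simps)
    qed (use tendsto_by_parts[OF H _ False less.prems(5) P] in auto)
  qed
qed

end

section \<open>Two paths between cube roots of unity\<close>

definition omega :: complex where "omega = Complex (- 1 / 2) (sqrt 3 / 2)"

lemma omega_sq: "omega ^ 2 = Complex (- 1 / 2) (- sqrt 3 / 2)"
  by (simp add: omega_def power2_eq_square complex_eq_iff field_simps)

lemma omega_relation: "omega ^ 2 + omega + 1 = 0"
  unfolding omega_sq by (simp add: omega_def complex_eq_iff)

lemma omega_cube: "omega ^ 3 = 1"
  using omega_relation by algebra

lemma omega_power_6: "omega ^ 6 = 1"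
  using omega_relation by algebra

lemma omega_nonzero: "omega \<noteq> 0"
  by (simp add: omega_def complex_eq_iff)

lemma omega_ne_1: "omega \<noteq> 1" "omega ^ 2 \<noteq> 1"
  unfolding omega_sq by (simp_all add: omega_def complex_eq_iff)

lemma of_real_ne_omega: "complex_of_real t \<noteq> omega" "complex_of_real t \<noteq> omega ^ 2"
  unfolding omega_sq by (simp_all add: omega_def complex_eq_iff)

lemma norm_of_real_minus_omega:
  "norm (complex_of_real t - omega) = sqrt (1 + t + t ^ 2)"
  "norm (complex_of_real t - omega ^ 2) = sqrt (1 + t + t ^ 2)"
  unfolding omega_sq by (simp_all add: omega_def cmod_def power2_eq_square field_simps)

definition circle_path :: "complex \<Rightarrow> complex"
  where "circle_path z = (1 - z) ^ 2 / ((z - omega) * (z - omega ^ 2))"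

definition arc_path :: "complex \<Rightarrow> complex"
  where "arc_path z = (z - 1) * (z - omega) / (z - omega ^ 2) ^ 2"

lemma has_field_derivative_circle_path:
  assumes "z \<noteq> 1" "z \<noteq> omega" "z \<noteq> omega ^ 2"
  shows "(circle_path has_field_derivative
           circle_path z * log_form [(2, 1), (- 1, omega), (- 1, omega ^ 2)] z) (at z)"
proof -
  have nz: "1 - z \<noteq> 0" "z - omega \<noteq> 0" "z - omega ^ 2 \<noteq> 0" using assms by auto
  have quotient: "(- 2 * p * (q * r) - p ^ 2 * (q + r)) / (q * r) ^ 2 = p ^ 2 / (q * r) * (- 2 / p - 1 / q - 1 / r)"
    if "p \<noteq> 0" "q \<noteq> 0" "r \<noteq> 0" for p q r :: complex
    using that by (simp add: field_simps power2_eq_square)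
  have "(circle_path has_field_derivative
     (- 2 * (1 - z) * ((z - omega) * (z - omega ^ 2)) - (1 - z) ^ 2 * ((z - omega) + (z - omega ^ 2))) /
     ((z - omega) * (z - omega ^ 2)) ^ 2) (at z)"
    unfolding circle_path_def
    by (rule derivative_eq_intros refl)+ (use nz in \<open>simp; fail | simp add: power2_eq_square algebra_simps; fail\<close>)+
  also note quotient[OF nz]
  also have "- 2 / (1 - z) - 1 / (z - omega) - 1 / (z - omega ^ 2) =
      log_form [(2, 1), (- 1, omega), (- 1, omega ^ 2)] z"
    using nz(1) minus_divide_right[of 2 "1 - z"] by (simp add: of_rat_minus)
  finally show ?thesis by (simp only: circle_path_def[abs_def])
qed

lemma has_field_derivative_arc_path:
  assumes "z \<noteq> 1" "z \<noteq> omega" "z \<noteq> omega ^ 2"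
  shows "(arc_path has_field_derivative
           arc_path z * log_form [(1, 1), (1, omega), (- 2, omega ^ 2)] z) (at z)"
proof -
  have nz: "z - 1 \<noteq> 0" "z - omega \<noteq> 0" "z - omega ^ 2 \<noteq> 0" using assms by auto
  have quotient: "((p + q) * r ^ 2 - p * q * (2 * r)) / (r ^ 2) ^ 2 = p * q / r ^ 2 * (1 / p + 1 / q - 2 / r)"
    if "p \<noteq> 0" "q \<noteq> 0" "r \<noteq> 0" for p q r :: complex
    using that by (simp add: field_simps power2_eq_square)
  have "(arc_path has_field_derivative
     (((z - 1) + (z - omega)) * (z - omega ^ 2) ^ 2 - (z - 1) * (z - omega) * (2 * (z - omega ^ 2))) /
     ((z - omega ^ 2) ^ 2) ^ 2) (at z)"
    unfolding arc_path_def
    by (rule derivative_eq_intros refl)+ (use nz in \<open>simp; fail | simp add: power2_eq_square algebra_simps; fail\<close>)+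
  also note quotient[OF nz]
  also have "1 / (z - 1) + 1 / (z - omega) - 2 / (z - omega ^ 2) =
      log_form [(1, 1), (1, omega), (- 2, omega ^ 2)] z"
    by (simp add: of_rat_minus)
  finally show ?thesis by (simp only: arc_path_def[abs_def])
qed

lemma circle_path_log_form:
  assumes "z \<noteq> 0" "z \<noteq> 1" "z \<noteq> omega" "z \<noteq> omega ^ 2"
  shows "circle_path z * log_form [(2, 1), (- 1, omega), (- 1, omega ^ 2)] z =
         (1 - circle_path z) * log_form [(- 1, 0), (1, omega), (1, omega ^ 2)] z"
proof -
  define w where "w = omega"
  have "w ^ 2 + w + 1 = 0" "z \<noteq> 0" "z - 1 \<noteq> 0" "z - w \<noteq> 0" "z - w ^ 2 \<noteq> 0"
    using omega_relation assms by (auto simp: w_def)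
  moreover from this have "circle_path z * (2 / (z - 1) - 1 / (z - w) - 1 / (z - w ^ 2)) =
      (1 - circle_path z) * (- 1 / z + 1 / (z - w) + 1 / (z - w ^ 2))"
    unfolding circle_path_def w_def[symmetric] by (simp add: divide_simps) algebra
  ultimately show ?thesis by (simp add: w_def of_rat_minus algebra_simps)
qed

lemma arc_path_log_form:
  assumes "z \<noteq> 0" "z \<noteq> 1" "z \<noteq> omega" "z \<noteq> omega ^ 2"
  shows "arc_path z * log_form [(1, 1), (1, omega), (- 2, omega ^ 2)] z =
         (1 - arc_path z) * log_form [(- 1, 0), (2, omega ^ 2)] z"
proof -
  define w where "w = omega"
  have "w ^ 2 + w + 1 = 0" "z \<noteq> 0" "z - 1 \<noteq> 0" "z - w \<noteq> 0" "z - w ^ 2 \<noteq> 0"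
    using omega_relation assms by (auto simp: w_def)
  moreover from this have "arc_path z * (1 / (z - 1) + 1 / (z - w) - 2 / (z - w ^ 2)) =
      (1 - arc_path z) * (- 1 / z + 2 / (z - w ^ 2))"
    unfolding arc_path_def w_def[symmetric] by (simp add: divide_simps) algebra
  ultimately show ?thesis by (simp add: w_def of_rat_minus algebra_simps)
qed

lemma norm_circle_path:
  assumes "0 < t" "t < 1"
  shows "norm (circle_path (of_real t)) = (1 - t) ^ 2 / (1 + t + t ^ 2)"
proof -
  have "norm (complex_of_real (1 - t)) = 1 - t" using assms by (simp only: norm_of_real)
  moreover have "sqrt (1 + t + t ^ 2) * sqrt (1 + t + t ^ 2) = 1 + t + t ^ 2" using assms by simp
  ultimately show ?thesis
    by (simp add: circle_path_def norm_divide norm_mult norm_power norm_of_real_minus_omega)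
qed

lemma norm_arc_path:
  assumes "0 < t" "t < 1"
  shows "norm (arc_path (of_real t)) = (1 - t) / sqrt (1 + t + t ^ 2)"
proof -
  have "norm (complex_of_real (t - 1)) = 1 - t" using assms by (simp only: norm_of_real)
  moreover define s where "s = sqrt (1 + t + t ^ 2)"
  moreover have "s > 0" using assms by (simp add: s_def add_pos_pos)
  ultimately show ?thesis
    unfolding arc_path_def norm_divide norm_mult norm_power norm_of_real_minus_omega s_def[symmetric]
    by (simp add: power2_eq_square)
qed

lemma one_minus_sq_div_bounds:
  assumes "0 < t" "t < 1"
  shows "(1 - t) ^ 2 / (1 + t + t ^ 2) \<le> (1 - t) ^ 2" "t \<le> 1 - (1 - t) ^ 2 / (1 + t + t ^ (2::nat) :: real)"
proof -
  have "1 + t + t ^ 2 \<ge> 1" using assms by simp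
  thus "(1 - t) ^ 2 / (1 + t + t ^ 2) \<le> (1 - t) ^ 2" using frac_le[of "(1 - t) ^ 2" "(1 - t) ^ 2" 1] by simp
  have "t ^ 2 \<le> 1" using assms by (simp add: power_le_one)
  hence "t * (1 + t + t ^ 2) \<le> t * 3" using assms by (intro mult_left_mono) auto
  also have "\<dots> = 1 + t + t ^ 2 - (1 - t) ^ 2" by (simp add: power2_eq_square algebra_simps)
  finally show "t \<le> 1 - (1 - t) ^ 2 / (1 + t + t ^ 2)"
    using \<open>1 + t + t ^ 2 \<ge> 1\<close> by (simp add: field_simps)
qed

interpretation circle: polylog_path 3 circle_path
  "[(2, 1), (- 1, omega), (- 1, omega ^ 2)]" "[(- 1, 0), (1, omega), (1, omega ^ 2)]" 1
proof
  fix t :: real assume t: "0 < t" "t < 1"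
  hence nz: "complex_of_real t \<noteq> 0" "complex_of_real t \<noteq> 1" by auto
  show "(circle_path has_field_derivative
      circle_path t * log_form [(2, 1), (- 1, omega), (- 1, omega ^ 2)] t) (at (of_real t))"
    by (intro has_field_derivative_circle_path nz of_real_ne_omega)
  thus "(circle_path has_field_derivative
      (1 - circle_path t) * log_form [(- 1, 0), (1, omega), (1, omega ^ 2)] t) (at (of_real t))"
    unfolding circle_path_log_form[OF nz of_real_ne_omega] .
  show "circle_path t \<noteq> 0" using nz of_real_ne_omega[of t] by (auto simp: circle_path_def)
  show "t \<le> 1 * (1 - norm (circle_path t))"
    using one_minus_sq_div_bounds(2)[OF t] by (simp add: norm_circle_path[OF t])
  thus "norm (circle_path t) < 1" using t by simp
  have "(1 - t) ^ 2 \<le> 1 - t" using t by (simp add: power2_eq_square mult_left_le)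
  thus "norm (circle_path t) \<le> 1 * (1 - t)"
    using one_minus_sq_div_bounds(1)[OF t] by (simp add: norm_circle_path[OF t])
qed (auto simp: omega_cube omega_power_6 omega_ne_1[symmetric])

interpretation arc: polylog_path 3 arc_path
  "[(1, 1), (1, omega), (- 2, omega ^ 2)]" "[(- 1, 0), (2, omega ^ 2)]" 2
proof
  fix t :: real assume t: "0 < t" "t < 1"
  hence nz: "complex_of_real t \<noteq> 0" "complex_of_real t \<noteq> 1" by auto
  show "(arc_path has_field_derivative
      arc_path t * log_form [(1, 1), (1, omega), (- 2, omega ^ 2)] t) (at (of_real t))"
    by (intro has_field_derivative_arc_path nz of_real_ne_omega)
  thus "(arc_path has_field_derivative
      (1 - arc_path t) * log_form [(- 1, 0), (2, omega ^ 2)] t) (at (of_real t))"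
    unfolding arc_path_log_form[OF nz of_real_ne_omega] .
  show "arc_path t \<noteq> 0" using nz of_real_ne_omega[of t] by (auto simp: arc_path_def)
  define X where "X = norm (arc_path t)"
  have X_sq: "X ^ 2 = (1 - t) ^ 2 / (1 + t + t ^ 2)"
    using t by (simp add: X_def norm_arc_path[OF t] power_divide add_nonneg_nonneg)
  have X_le: "X \<le> 1 - t"
    by (rule power2_le_imp_le) (use one_minus_sq_div_bounds(1)[OF t] t in \<open>simp_all add: X_sq\<close>)
  thus "norm (arc_path t) < 1" "norm (arc_path t) \<le> 2 * (1 - t)" using t by (auto simp: X_def)
  have "t \<le> 1 - X ^ 2" using one_minus_sq_div_bounds(2)[OF t] by (simp add: X_sq)
  also have "\<dots> = (1 + X) * (1 - X)" by (simp add: power2_eq_square algebra_simps)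
  also have "\<dots> \<le> 2 * (1 - X)" using X_le t by (intro mult_right_mono) auto
  finally show "t \<le> 2 * (1 - norm (arc_path t))" by (simp add: X_def)
qed (auto simp: omega_cube omega_power_6 omega_ne_1[symmetric])

section \<open>The angular parameter\<close>

lemma sin_cos_less_pi_6:
  assumes "0 < \<theta>" "\<theta> < pi / 6"
  shows "0 < sin \<theta>" "sin \<theta> < 1 / 2" "sqrt 3 / 2 < cos \<theta>"
proof -
  show "0 < sin \<theta>" using assms by (intro sin_gt_zero) auto
  show "sin \<theta> < 1 / 2" using sin_monotone_2pi[of \<theta> "pi / 6"] assms by (simp add: sin_30)
  show "sqrt 3 / 2 < cos \<theta>" using cos_monotone_0_pi[of \<theta> "pi / 6"] assms by (simp add: cos_30)
qed

definition cubic_denom :: "real \<Rightarrow> real"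
  where "cubic_denom \<theta> = cos \<theta> + sqrt 3 * sin \<theta>"

definition cubic_param :: "real \<Rightarrow> real"
  where "cubic_param \<theta> = (cos \<theta> - sqrt 3 * sin \<theta>) / cubic_denom \<theta>"

lemma cubic_denom_pos: "0 < \<theta> \<Longrightarrow> \<theta> < pi / 6 \<Longrightarrow> 0 < cubic_denom \<theta>"
  unfolding cubic_denom_def
  using sin_cos_less_pi_6[of \<theta>] mult_pos_pos[of "sqrt 3" "sin \<theta>"] real_sqrt_gt_zero[of 3] by linarith

lemma cubic_param_bounds:
  assumes "0 < \<theta>" "\<theta> < pi / 6"
  shows "0 < cubic_param \<theta>" "cubic_param \<theta> < 1"
proof -
  note sin_cos = sin_cos_less_pi_6[OF assms] and denom = cubic_denom_pos[OF assms]
  have "sqrt 3 * sin \<theta> < sqrt 3 * (1 / 2)" using sin_cos by (intro mult_strict_left_mono) auto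
  hence "0 < cos \<theta> - sqrt 3 * sin \<theta>" using sin_cos by linarith
  thus "0 < cubic_param \<theta>" using denom by (simp add: cubic_param_def)
  show "cubic_param \<theta> < 1" using denom sin_cos(1) by (simp add: cubic_param_def) (simp add: cubic_denom_def)
qed

lemma filterlim_cubic_param_at_right_0: "filterlim cubic_param (at_left 1) (at_right 0)"
  unfolding filterlim_at
proof
  have "(cubic_param \<longlongrightarrow> (cos 0 - sqrt 3 * sin 0) / (cos 0 + sqrt 3 * sin 0)) (at_right 0)"
    unfolding cubic_param_def[abs_def] cubic_denom_def by (intro tendsto_intros) auto
  thus "(cubic_param \<longlongrightarrow> 1) (at_right 0)" by simp
  have "\<forall>\<^sub>F \<theta> in at_right 0. \<theta> \<in> {0<..<pi/6}" by (rule eventually_at_right_real) simp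
  thus "\<forall>\<^sub>F \<theta> in at_right 0. cubic_param \<theta> \<in> {..<1} \<and> cubic_param \<theta> \<noteq> 1"
    by eventually_elim (use cubic_param_bounds in fastforce)
qed

lemma filterlim_cubic_param_at_left_pi_6: "filterlim cubic_param (at_right 0) (at_left (pi / 6))"
  unfolding filterlim_at
proof
  have "(cubic_param \<longlongrightarrow> (cos (pi/6) - sqrt 3 * sin (pi/6)) / (cos (pi/6) + sqrt 3 * sin (pi/6))) (at_left (pi/6))"
    unfolding cubic_param_def[abs_def] cubic_denom_def by (intro tendsto_intros) (auto simp: sin_30 cos_30)
  thus "(cubic_param \<longlongrightarrow> 0) (at_left (pi/6))" by (simp add: sin_30 cos_30)
  have "\<forall>\<^sub>F \<theta> in at_left (pi/6). \<theta> \<in> {0<..<pi/6}" by (rule eventually_at_left_real) simp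
  thus "\<forall>\<^sub>F \<theta> in at_left (pi/6). cubic_param \<theta> \<in> {0<..} \<and> cubic_param \<theta> \<noteq> 0"
    by eventually_elim (use cubic_param_bounds in fastforce)
qed

lemma has_real_derivative_cubic_param:
  assumes "cubic_denom \<theta> \<noteq> 0"
  shows "(cubic_param has_real_derivative - 2 * sqrt 3 / cubic_denom \<theta> ^ 2) (at \<theta>)"
proof -
  define C S r where "C = cos \<theta>" and "S = sin \<theta>" and "r = sqrt 3"
  have rel: "C ^ 2 + S ^ 2 = 1" "r ^ 2 = 3" by (auto simp: C_def S_def r_def)
  have "(cubic_param has_real_derivative
      ((- S - r * C) * (C + r * S) - (C - r * S) * (- S + r * C)) / ((C + r * S) * (C + r * S))) (at \<theta>)"
    unfolding cubic_param_def[abs_def] cubic_denom_def C_def S_def r_def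
    by (rule derivative_eq_intros refl)+ (use assms in \<open>auto simp: cubic_denom_def mult.commute\<close>)
  also have "(- S - r * C) * (C + r * S) - (C - r * S) * (- S + r * C) = - 2 * r"
    using rel by algebra
  finally show ?thesis by (simp add: C_def S_def r_def power2_eq_square cubic_denom_def)
qed

lemma cubic_param_minus_roots:
  assumes "cubic_denom \<theta> \<noteq> 0"
  shows "cubic_param \<theta> - 1 = - 2 * sqrt 3 * sin \<theta> / cubic_denom \<theta>"
    "of_real (cubic_param \<theta>) - omega = (1 - omega) * cis (- \<theta>) / of_real (cubic_denom \<theta>)"
    "of_real (cubic_param \<theta>) - omega ^ 2 = (1 - omega ^ 2) * cis \<theta> / of_real (cubic_denom \<theta>)"
proof -
  show "cubic_param \<theta> - 1 = - 2 * sqrt 3 * sin \<theta> / cubic_denom \<theta>"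
    using assms by (simp add: cubic_param_def divide_simps) (simp add: cubic_denom_def)
  have param: "complex_of_real (cubic_param \<theta>) = of_real (cos \<theta> - sqrt 3 * sin \<theta>) / of_real (cubic_denom \<theta>)"
    by (simp add: cubic_param_def)
  have quotient_diff: "x / of_real (cubic_denom \<theta>) - y = (x - y * of_real (cubic_denom \<theta>)) / of_real (cubic_denom \<theta>)"
    for x y :: complex using assms by (simp add: diff_divide_distrib)
  have "of_real (cos \<theta> - sqrt 3 * sin \<theta>) - omega * of_real (cubic_denom \<theta>) = (1 - omega) * cis (- \<theta>)"
    by (simp add: omega_def cubic_denom_def complex_eq_iff algebra_simps)
  thus "of_real (cubic_param \<theta>) - omega = (1 - omega) * cis (- \<theta>) / of_real (cubic_denom \<theta>)"
    by (simp only: param quotient_diff)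
  have "of_real (cos \<theta> - sqrt 3 * sin \<theta>) - omega ^ 2 * of_real (cubic_denom \<theta>) = (1 - omega ^ 2) * cis \<theta>"
    unfolding omega_sq by (simp add: cubic_denom_def complex_eq_iff algebra_simps)
  thus "of_real (cubic_param \<theta>) - omega ^ 2 = (1 - omega ^ 2) * cis \<theta> / of_real (cubic_denom \<theta>)"
    by (simp only: param quotient_diff)
qed

lemma cis_plus_minus: "cis \<theta> * cis (- \<theta>) = 1"
  by (simp add: cis_mult)

lemma circle_path_cubic_param:
  assumes "cubic_denom \<theta> \<noteq> 0"
  shows "circle_path (of_real (cubic_param \<theta>)) = of_real ((2 * sin \<theta>) ^ 2)"
proof -
  define D where "D = complex_of_real (cubic_denom \<theta>)"
  have "D \<noteq> 0" using assms by (simp add: D_def)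
  have "1 - complex_of_real (cubic_param \<theta>) = of_real (- (cubic_param \<theta> - 1))" by simp
  also have "\<dots> = of_real (2 * sqrt 3 * sin \<theta>) / D"
    unfolding cubic_param_minus_roots(1)[OF assms] by (simp add: D_def)
  finally have "(1 - complex_of_real (cubic_param \<theta>)) ^ 2 = of_real (3 * (2 * sin \<theta>) ^ 2) / D ^ 2"
    by (simp add: power_divide power_mult_distrib flip: of_real_power)
  moreover have "(of_real (cubic_param \<theta>) - omega) * (of_real (cubic_param \<theta>) - omega ^ 2) =
      ((1 - omega) * (1 - omega ^ 2)) * (cis \<theta> * cis (- \<theta>)) / D ^ 2"
    unfolding cubic_param_minus_roots(2,3)[OF assms] by (simp add: D_def power2_eq_square mult_ac)
  moreover have "(1 - omega) * (1 - omega ^ 2) = 3"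
    using omega_relation by algebra
  ultimately show ?thesis using \<open>D \<noteq> 0\<close> by (simp add: circle_path_def cis_plus_minus)
qed

lemma arc_path_cubic_param:
  assumes "cubic_denom \<theta> \<noteq> 0"
  shows "arc_path (of_real (cubic_param \<theta>)) = cis (- 2 * \<theta>) * (1 - cis (- 2 * \<theta>))"
proof -
  define D u v where "D = complex_of_real (cubic_denom \<theta>)" and "u = cis \<theta>" and "v = cis (- \<theta>)"
  have nz: "D \<noteq> 0" "1 - omega ^ 2 \<noteq> 0" "u \<noteq> 0" using assms omega_ne_1 by (auto simp: D_def u_def)
  have uv: "u * v = 1" by (simp add: u_def v_def cis_plus_minus)
  have "complex_of_real (cubic_param \<theta>) - 1 = of_real (cubic_param \<theta> - 1)" by simp
  also have "\<dots> = of_real (sqrt 3) * (\<i> * (u - v)) / D"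
    unfolding cubic_param_minus_roots(1)[OF assms] by (simp add: D_def u_def v_def complex_eq_iff)
  finally have "arc_path (of_real (cubic_param \<theta>)) =
      (of_real (sqrt 3) * (\<i> * (u - v)) / D) * ((1 - omega) * v / D) / ((1 - omega ^ 2) * u / D) ^ 2"
    unfolding arc_path_def cubic_param_minus_roots(2,3)[OF assms] by (simp only: D_def u_def v_def)
  also have "\<dots> = (of_real (sqrt 3) * \<i> * (1 - omega)) * (u - v) * v / ((1 - omega ^ 2) ^ 2 * u ^ 2)"
    using nz by (simp add: power2_eq_square mult_ac)
  also have "of_real (sqrt 3) * \<i> * (1 - omega) = (1 - omega ^ 2) ^ 2"
    unfolding omega_sq by (simp add: omega_def complex_eq_iff power2_eq_square)
  also have "(1 - omega ^ 2) ^ 2 * (u - v) * v / ((1 - omega ^ 2) ^ 2 * u ^ 2) = (u - v) * v / u ^ 2"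
    using nz by simp
  also have "\<dots> = v ^ 2 * (1 - v ^ 2)"
    using nz uv by (simp add: divide_simps) algebra
  also have "v ^ 2 = cis (- 2 * \<theta>)" by (simp add: v_def power2_eq_square cis_mult)
  finally show ?thesis .
qed

lemma one_minus_cubic_param_div_omega:
  assumes "cubic_denom \<theta> \<noteq> 0"
  shows "1 - of_real (cubic_param \<theta>) / omega = rcis (sqrt 3 / cubic_denom \<theta>) (pi / 6 - \<theta>)"
    and "1 - of_real (cubic_param \<theta>) / omega ^ 2 = rcis (sqrt 3 / cubic_denom \<theta>) (\<theta> - pi / 6)"
proof -
  define D where "D = cubic_denom \<theta>"
  define w where "w = complex_of_real (cubic_param \<theta>)"
  have D: "D \<noteq> 0" using assms by (simp add: D_def)
  have "1 - w / omega = - (w - omega) / omega" using omega_nonzero by (simp add: divide_simps)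
  also have "\<dots> = (1 - omega ^ 2) * cis (- \<theta>) / of_real D"
    unfolding w_def cubic_param_minus_roots(2)[OF assms] using omega_nonzero omega_cube
    by (simp add: D D_def[symmetric] divide_simps) algebra
  also have "1 - omega ^ 2 = of_real (sqrt 3) * cis (pi / 6)"
    unfolding omega_sq by (simp add: complex_eq_iff cos_30 sin_30)
  finally show "1 - w / omega = rcis (sqrt 3 / D) (pi / 6 - \<theta>)"
    by (simp add: rcis_def mult.assoc cis_mult)
  have "1 - w / omega ^ 2 = - (w - omega ^ 2) / omega ^ 2" using omega_nonzero by (simp add: divide_simps)
  also have "\<dots> = (1 - omega) * cis \<theta> / of_real D"
    unfolding w_def cubic_param_minus_roots(3)[OF assms] using omega_nonzero omega_cube
    by (simp add: D D_def[symmetric] divide_simps) algebra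
  also have "1 - omega = of_real (sqrt 3) * cis (- (pi / 6))"
    by (simp add: omega_def complex_eq_iff cos_30 sin_30)
  finally show "1 - w / omega ^ 2 = rcis (sqrt 3 / D) (\<theta> - pi / 6)"
    by (simp add: rcis_def mult.assoc cis_mult)
qed

lemma log_primitive_cubic_param:
  assumes "0 < \<theta>" "\<theta> < pi / 6"
  shows "log_primitive [(1, 1), (1, omega), (- 2, omega ^ 2)] (of_real (cubic_param \<theta>)) =
           of_real (ln (2 * sin \<theta>)) + \<i> * of_real (pi / 2 - 3 * \<theta>)"
proof -
  define D where "D = cubic_denom \<theta>"
  define w where "w = complex_of_real (cubic_param \<theta>)"
  have D: "D > 0" "cubic_denom \<theta> \<noteq> 0" using cubic_denom_pos[OF assms] by (auto simp: D_def)
  have sin_pos: "sin \<theta> > 0" using sin_cos_less_pi_6[OF assms] by simp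
  have "1 - w = of_real (- (cubic_param \<theta> - 1))" by (simp add: w_def)
  also have "- (cubic_param \<theta> - 1) = 2 * sin \<theta> * (sqrt 3 / D)"
    unfolding cubic_param_minus_roots(1)[OF D(2)] by (simp add: D_def)
  finally have "Ln (1 - w / 1) = of_real (ln (2 * sin \<theta> * (sqrt 3 / D)))"
    using D(1) sin_pos
    by (simp only: div_by_1 Ln_of_real mult_pos_pos divide_pos_pos real_sqrt_gt_zero zero_less_numeral)
  also have "ln (2 * sin \<theta> * (sqrt 3 / D)) = ln (2 * sin \<theta>) + ln (sqrt 3 / D)"
    using D(1) sin_pos by (intro ln_mult_pos) auto
  finally have "Ln (1 - w / 1) = of_real (ln (2 * sin \<theta>) + ln (sqrt 3 / D))" .
  moreover have "Ln (1 - w / omega) = Complex (ln (sqrt 3 / D)) (pi / 6 - \<theta>)"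
    "Ln (1 - w / omega ^ 2) = Complex (ln (sqrt 3 / D)) (\<theta> - pi / 6)"
    using one_minus_cubic_param_div_omega[OF D(2)] D(1) assms by (simp_all add: w_def Ln_rcis flip: D_def)
  ultimately show ?thesis
    unfolding log_primitive_simps w_def[symmetric] by (simp add: complex_eq_iff of_rat_minus)
qed

lemma log_form_cubic_param:
  assumes "cubic_denom \<theta> \<noteq> 0"
  shows "of_real (- 2 * sqrt 3 / cubic_denom \<theta> ^ 2) *
           log_form [(- 1, omega), (1, omega ^ 2)] (of_real (cubic_param \<theta>)) = 2 * \<i>"
proof -
  define D u v where "D = complex_of_real (cubic_denom \<theta>)" and "u = cis \<theta>" and "v = cis (- \<theta>)"
  have nz: "D \<noteq> 0" "1 - omega \<noteq> 0" "1 - omega ^ 2 \<noteq> 0" "u \<noteq> 0" "v \<noteq> 0"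
    using assms omega_ne_1 by (auto simp: D_def u_def v_def)
  have "log_form [(- 1, omega), (1, omega ^ 2)] (of_real (cubic_param \<theta>)) =
      D / ((1 - omega ^ 2) * u) - D / ((1 - omega) * v)"
    unfolding log_form_simps cubic_param_minus_roots(2,3)[OF assms] by (simp add: D_def u_def v_def of_rat_minus)
  also have "\<dots> = D * ((1 - omega) * v - (1 - omega ^ 2) * u) / (((1 - omega) * (1 - omega ^ 2)) * (u * v))"
    using nz by (simp add: divide_simps) (simp add: algebra_simps)
  also have "(1 - omega) * v - (1 - omega ^ 2) * u = - \<i> * of_real (sqrt 3) * D"
    unfolding omega_sq by (simp add: omega_def u_def v_def D_def cubic_denom_def complex_eq_iff algebra_simps)
  also have "((1 - omega) * (1 - omega ^ 2)) * (u * v) = 3"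
    using omega_relation cis_plus_minus[of \<theta>] by (simp add: u_def v_def) algebra
  finally have "log_form [(- 1, omega), (1, omega ^ 2)] (of_real (cubic_param \<theta>)) =
      - \<i> * of_real (sqrt 3) * D ^ 2 / 3" by (simp add: power2_eq_square)
  moreover have "complex_of_real (sqrt 3) * of_real (sqrt 3) = 3"
    by (simp flip: of_real_mult)
  ultimately show ?thesis using nz(1) by (simp flip: D_def)
qed

section \<open>Integrals over intervals\<close>

lemma set_integral_Icc_eq_Ioo:
  fixes f :: "real \<Rightarrow> 'a::{banach, second_countable_topology}"
  shows "(LBINT x:{a..b}. f x) = (LBINT x:{a<..<b}. f x)"
  by (rule set_integral_discrete_difference[where X = "{a, b}"]) auto

lemma set_integrable_Icc_iff_Ioo:
  fixes f :: "real \<Rightarrow> 'a::{banach, second_countable_topology}"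
  shows "set_integrable lborel {a..b} f \<longleftrightarrow> set_integrable lborel {a<..<b} f"
  by (rule set_integrable_discrete_difference[where X = "{a, b}"]) auto

lemma set_integral_cong_Ioo:
  fixes f g :: "real \<Rightarrow> 'a::{banach, second_countable_topology}"
  assumes "\<And>x. a < x \<Longrightarrow> x < b \<Longrightarrow> f x = g x"
  shows "(LBINT x:{a..b}. f x) = (LBINT x:{a..b}. g x)"
  unfolding set_integral_Icc_eq_Ioo by (rule set_lebesgue_integral_cong) (use assms in auto)

lemma set_integrable_cong_Ioo:
  fixes f g :: "real \<Rightarrow> 'a::{banach, second_countable_topology}"
  assumes "\<And>x. a < x \<Longrightarrow> x < b \<Longrightarrow> f x = g x"
  shows "set_integrable lborel {a..b} f \<longleftrightarrow> set_integrable lborel {a..b} g"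
  unfolding set_integrable_Icc_iff_Ioo by (rule set_integrable_cong) (use assms in auto)

lemma set_integrable_bounded_continuous:
  fixes g :: "real \<Rightarrow> 'a::{banach, second_countable_topology}"
  assumes "continuous_on {a<..<b} g" "\<And>x. a < x \<Longrightarrow> x < b \<Longrightarrow> norm (g x) \<le> M"
  shows "set_integrable lborel {a..b} g"
proof -
  have "set_integrable lborel {a<..<b} (\<lambda>_. M)"
    using integrable_real_indicator[of "{a<..<b}" lborel] emeasure_bounded_finite[of "{a<..<b}"]
    by (simp add: set_integrable_def)
  thus ?thesis unfolding set_integrable_Icc_iff_Ioo
  proof (rule set_integrable_bound)
    show "set_borel_measurable lborel {a<..<b} g"
      using borel_measurable_continuous_on_indicator[of "{a<..<b}" g] assms(1)
      by (simp add: set_borel_measurable_def)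
    show "AE x in lborel. x \<in> {a<..<b} \<longrightarrow> norm (g x) \<le> norm M"
      using assms(2) by (intro AE_I2) fastforce
  qed
qed

lemma set_integral_eq_tendsto_diff:
  fixes g G :: "real \<Rightarrow> 'a::euclidean_space"
  assumes "a < b"
    and G: "\<And>x. a < x \<Longrightarrow> x < b \<Longrightarrow> (G has_vector_derivative g x) (at x)"
    and g: "continuous_on {a<..<b} g" "set_integrable lborel {a..b} g"
    and A: "(G \<longlongrightarrow> A) (at_right a)" and B: "(G \<longlongrightarrow> B) (at_left b)"
  shows "(LBINT x:{a..b}. g x) = B - A"
proof -
  have "(LBINT x=a..b. g x) = B - A"
  proof (rule interval_integral_FTC_integrable)
    show "ereal a < ereal b" using assms(1) by simp
    show "(G has_vector_derivative g x) (at x)" if "ereal a < ereal x" "ereal x < ereal b" for x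
      using G that by simp
    show "isCont g x" if "ereal a < ereal x" "ereal x < ereal b" for x
      using g(1) that by (simp add: continuous_on_eq_continuous_at)
    show "set_integrable lborel (einterval (ereal a) (ereal b)) g"
      using g(2) by (simp add: set_integrable_Icc_iff_Ioo)
    show "((G \<circ> real_of_ereal) \<longlongrightarrow> A) (at_right (ereal a))"
      using A by (simp add: ereal_tendsto_simps)
    show "((G \<circ> real_of_ereal) \<longlongrightarrow> B) (at_left (ereal b))"
      using B by (simp add: ereal_tendsto_simps)
  qed
  thus ?thesis using assms(1) by (simp add: interval_integral_Icc)
qed

lemma set_integral_sum_scale:
  fixes c :: "'i \<Rightarrow> real" and f :: "'i \<Rightarrow> 'b \<Rightarrow> real"
  assumes "\<And>i. i \<in> I \<Longrightarrow> set_integrable M S (f i)"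
  shows "set_integrable M S (\<lambda>x. \<Sum>i\<in>I. c i * f i x)"
    and "(LINT x:S|M. (\<Sum>i\<in>I. c i * f i x)) = (\<Sum>i\<in>I. c i * (LINT x:S|M. f i x))"
proof -
  have "(\<lambda>x. indicator S x *\<^sub>R (\<Sum>i\<in>I. c i * f i x)) = (\<lambda>x. \<Sum>i\<in>I. c i * (indicator S x *\<^sub>R f i x))"
    by (simp add: sum_distrib_left mult.left_commute)
  thus "set_integrable M S (\<lambda>x. \<Sum>i\<in>I. c i * f i x)"
    "(LINT x:S|M. (\<Sum>i\<in>I. c i * f i x)) = (\<Sum>i\<in>I. c i * (LINT x:S|M. f i x))"
    using assms by (simp_all add: set_integrable_def set_lebesgue_integral_def)
qed

lemma set_integral_even:
  fixes f :: "real \<Rightarrow> real"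
  assumes "a \<ge> 0" "set_integrable lborel {0..a} f" and even: "\<And>x. f (- x) = f x"
  shows "(LBINT x:{- a..a}. f x) = 2 * (LBINT x:{0..a}. f x)"
proof -
  have reflect: "{x. - x \<in> {0..a}} = {- a..0}" by auto
  have "indicator {0..a} (0 + - 1 * x) = (indicator {- a..0} x :: real)" for x
    by (auto simp: indicator_def)
  hence "set_integrable lborel {- a..0} f"
    using lborel_integrable_real_affine[of "\<lambda>x. indicator {0..a} x *\<^sub>R f x" "- 1" 0] assms(2) even
    by (simp add: set_integrable_def)
  moreover have "AE x in lborel. \<not> (x \<in> {- a..0} \<and> x \<in> {0..a})"
    using AE_lborel_singleton[of 0] by eventually_elim auto
  ultimately have "(LBINT x:{- a..0} \<union> {0..a}. f x) = (LBINT x:{- a..0}. f x) + (LBINT x:{0..a}. f x)"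
    using assms(2) by (intro set_integral_Un_AE) auto
  moreover have "(LBINT x:{- a..0}. f x) = (LBINT x:{0..a}. f x)"
    using set_integral_reflect[of "{0..a}" f] by (simp only: reflect even)
  moreover have "{- a..0} \<union> {0..a} = {- a..a}" using assms(1) by auto
  ultimately show ?thesis by simp
qed

lemma set_integrable_polylog_ones:
  fixes f g :: "real \<Rightarrow> real"
  assumes "0 \<notin> set A" "A = [] \<or> hd A \<ge> 2"
    and f: "continuous_on {a<..<b} f" "\<And>x. a < x \<Longrightarrow> x < b \<Longrightarrow> \<bar>f x\<bar> < 1"
    and g: "continuous_on {a<..<b} g" "\<And>x. a < x \<Longrightarrow> x < b \<Longrightarrow> \<bar>g x\<bar> \<le> C"
  shows "set_integrable lborel {a..b} (\<lambda>x. polylog (ones A) (f x) * g x)"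
proof -
  obtain B where B: "B \<ge> 0" "\<And>x::real. norm x < 1 \<Longrightarrow> norm (polylog (ones A) x) \<le> B"
    using polylog_ones_bounded[OF assms(1,2)] by blast
  show ?thesis
  proof (rule set_integrable_bounded_continuous)
    show "continuous_on {a<..<b} (\<lambda>x. polylog (ones A) (f x) * g x)"
      using assms(1) f by (intro continuous_intros g(1)) auto
    show "norm (polylog (ones A) (f x) * g x) \<le> B * C" if "a < x" "x < b" for x
      unfolding norm_mult using B f(2)[OF that] g(2)[OF that] by (intro mult_mono) auto
  qed
qed

lemma of_real_Im_in_times_MPL_space:
  assumes "v \<in> MPL_space n N" "N > 0" "n > 0"
  shows "of_real (Im v) \<in> (*) \<i> ` MPL_space n N"
proof
  show "of_real (Im v) = \<i> * (of_rat (- 1 / 2) * (v - cnj v))"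
    by (simp add: complex_eq_iff of_rat_divide of_rat_minus)
  show "of_rat (- 1 / 2) * (v - cnj v) \<in> MPL_space n N"
    by (intro rat_complex.subspace_scale rat_complex.subspace_diff subspace_MPL_space cnj_in_MPL_space assms)
qed

lemma subspace_times_MPL_space: "rat_complex.subspace ((*) c ` MPL_space n N)"
proof (rule rat_complex.subspaceI)
  note subspace = subspace_MPL_space[of n N]
  show "0 \<in> (*) c ` MPL_space n N"
    by (rule image_eqI[of _ _ 0]) (simp_all add: rat_complex.subspace_0[OF subspace])
  show "x + y \<in> (*) c ` MPL_space n N" if "x \<in> (*) c ` MPL_space n N" "y \<in> (*) c ` MPL_space n N" for x y
    using that by (auto simp flip: distrib_left intro!: imageI rat_complex.subspace_add[OF subspace])
  show "of_rat q * x \<in> (*) c ` MPL_space n N" if "x \<in> (*) c ` MPL_space n N" for q x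
    using that by (auto simp: mult.left_commute[of _ c] intro!: imageI rat_complex.subspace_scale[OF subspace])
qed

section \<open>The integral over small angles\<close>

lemma has_vector_derivative_comp_cubic_param:
  fixes F :: "complex \<Rightarrow> complex"
  assumes "0 < \<theta>" "\<theta> < pi / 6" "w = of_real (cubic_param \<theta>)"
    "(F has_field_derivative g * log_form [(- 1, omega), (1, omega ^ 2)] w * x) (at w)"
  shows "((\<lambda>\<theta>. F (of_real (cubic_param \<theta>))) has_vector_derivative 2 * \<i> * (g * x)) (at \<theta>)"
proof -
  have denom: "cubic_denom \<theta> \<noteq> 0" using cubic_denom_pos[OF assms(1,2)] by simp
  have "((\<lambda>\<theta>. complex_of_real (cubic_param \<theta>)) has_vector_derivative
       of_real (- 2 * sqrt 3 / cubic_denom \<theta> ^ 2)) (at \<theta>)"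
    using has_real_derivative_cubic_param[OF denom]
    by (intro has_vector_derivative_of_real) (simp add: has_real_derivative_iff_has_vector_derivative)
  from field_vector_diff_chain_at[OF this assms(4)[unfolded assms(3)]]
  have "((\<lambda>\<theta>. F (of_real (cubic_param \<theta>))) has_vector_derivative
      (of_real (- 2 * sqrt 3 / cubic_denom \<theta> ^ 2) *
         log_form [(- 1, omega), (1, omega ^ 2)] (of_real (cubic_param \<theta>))) * (g * x)) (at \<theta>)"
    by (simp only: o_def mult_ac)
  thus ?thesis by (simp only: log_form_cubic_param[OF denom])
qed

lemma (in polylog_path) integral_cubic_param:
  assumes "N = 3" "g \<in> polylog_span (root_words N m)" "0 \<notin> set A"
  obtains v and F :: "real \<Rightarrow> complex" where "v \<in> MPL_space (m + 1 + sum_list A) 3"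
    "\<And>\<theta> w. 0 < \<theta> \<Longrightarrow> \<theta> < pi / 6 \<Longrightarrow> w = of_real (cubic_param \<theta>) \<Longrightarrow>
       (F has_vector_derivative 2 * \<i> * (g w * polylog (ones A) (Z w))) (at \<theta>)"
    "(F \<longlongrightarrow> 0) (at_left (pi / 6))" "(F \<longlongrightarrow> v) (at_right 0)"
proof -
  obtain F v where v: "v \<in> MPL_space (m + 1 + sum_list A) N"
    and F: "\<And>t::real. 0 < t \<Longrightarrow> t < 1 \<Longrightarrow> (F has_field_derivative
         g t * log_form [(- 1, omega), (1, omega ^ 2)] t * polylog (ones A) (Z t)) (at (of_real t))"
    and F_0: "((\<lambda>t::real. F t) \<longlongrightarrow> 0) (at_right 0)" and F_1: "((\<lambda>t::real. F t) \<longlongrightarrow> v) (at_left 1)"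
    by (rule iterated_integral_in_MPL_space[OF assms(2) _ _ assms(3), of "[(- 1, omega), (1, omega ^ 2)]"])
      (auto simp: assms(1) omega_cube omega_power_6 omega_ne_1[symmetric])
  show ?thesis
  proof (rule that[of v "\<lambda>\<theta>. F (of_real (cubic_param \<theta>))"])
    show "v \<in> MPL_space (m + 1 + sum_list A) 3" using v assms(1) by simp
    show "((\<lambda>\<theta>. F (of_real (cubic_param \<theta>))) has_vector_derivative 2 * \<i> * (g w * polylog (ones A) (Z w))) (at \<theta>)"
      if "0 < \<theta>" "\<theta> < pi / 6" "w = of_real (cubic_param \<theta>)" for \<theta> w
      using has_vector_derivative_comp_cubic_param[OF that] F[OF cubic_param_bounds[OF that(1,2)]] that(3) by blast
    show "((\<lambda>\<theta>. F (of_real (cubic_param \<theta>))) \<longlongrightarrow> 0) (at_left (pi / 6))"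
      by (rule filterlim_compose[OF F_0 filterlim_cubic_param_at_left_pi_6])
    show "((\<lambda>\<theta>. F (of_real (cubic_param \<theta>))) \<longlongrightarrow> v) (at_right 0)"
      by (rule filterlim_compose[OF F_1 filterlim_cubic_param_at_right_0])
  qed
qed

lemma sq_double_sin_less_1:
  assumes "0 < \<theta>" "\<theta> < pi / 6"
  shows "\<bar>(2 * sin \<theta>) ^ 2\<bar> < 1"
  using sin_cos_less_pi_6[OF assms] power_strict_mono[of "2 * sin \<theta>" 1 2] by auto

lemma integral_polylog_small_angles:
  assumes A: "0 \<notin> set A" "A = [] \<or> hd A \<ge> 2"
  shows "complex_of_real (LBINT \<theta>:{0..pi/6}. polylog (ones A) ((2 * sin \<theta>) ^ 2))
    \<in> (*) \<i> ` MPL_space (Suc (sum_list A)) 3"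
proof -
  define L where "L \<theta> = polylog (ones A) ((2 * sin \<theta>) ^ 2)" for \<theta> :: real
  have "polylog [] \<in> polylog_span (root_words 3 0)"
    by (rule polylog_in_polylog_span) (simp add: root_words_def)
  from circle.integral_cubic_param[OF refl this A(1)]
  obtain v F where v: "v \<in> MPL_space (Suc (sum_list A)) 3"
    and F: "\<And>\<theta> w. 0 < \<theta> \<Longrightarrow> \<theta> < pi / 6 \<Longrightarrow> w = complex_of_real (cubic_param \<theta>) \<Longrightarrow>
       (F has_vector_derivative 2 * \<i> * (polylog [] w * polylog (ones A) (circle_path w))) (at \<theta>)"
    and lim: "(F \<longlongrightarrow> 0) (at_left (pi / 6))" "(F \<longlongrightarrow> v) (at_right 0)"
    by auto
  have "(LBINT \<theta>:{0..pi/6}. 2 * L \<theta>) = Im 0 - Im v"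
  proof (rule set_integral_eq_tendsto_diff)
    show "((\<lambda>\<theta>. Im (F \<theta>)) has_vector_derivative 2 * L \<theta>) (at \<theta>)"
      if \<theta>: "0 < \<theta>" "\<theta> < pi / 6" for \<theta>
    proof -
      have "circle_path (of_real (cubic_param \<theta>)) = of_real ((2 * sin \<theta>) ^ 2)"
        using cubic_denom_pos[OF \<theta>] by (intro circle_path_cubic_param) simp
      hence "polylog (ones A) (circle_path (of_real (cubic_param \<theta>))) = of_real (L \<theta>)"
        using polylog_ones_of_real[OF A(1) sq_double_sin_less_1[OF \<theta>]] by (simp only: L_def)
      with bounded_linear.has_vector_derivative[OF bounded_linear_Im F[OF \<theta> refl]] show ?thesis by simp
    qed
    have "set_integrable lborel {0..pi/6} (\<lambda>\<theta>. L \<theta> * 2)"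
      unfolding L_def
      by (rule set_integrable_polylog_ones[where C = 2])
        (use A sq_double_sin_less_1 in \<open>auto intro!: continuous_intros\<close>)
    thus "set_integrable lborel {0..pi/6} (\<lambda>\<theta>. 2 * L \<theta>)" by (simp only: mult.commute)
    show "continuous_on {0<..<pi/6} (\<lambda>\<theta>. 2 * L \<theta>)"
      unfolding L_def using A(1) sq_double_sin_less_1 by (intro continuous_intros) auto
  qed (use tendsto_Im[OF lim(1)] tendsto_Im[OF lim(2)] in auto)
  hence "complex_of_real (LBINT \<theta>:{0..pi/6}. L \<theta>) = of_rat (- 1 / 2) * of_real (Im v)"
    by (simp add: of_rat_divide of_rat_minus complex_eq_iff)
  also have "\<dots> \<in> (*) \<i> ` MPL_space (Suc (sum_list A)) 3"
    using v by (intro rat_complex.subspace_scale subspace_times_MPL_space of_real_Im_in_times_MPL_space) auto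
  finally show ?thesis unfolding L_def .
qed

section \<open>The integral over large angles\<close>

definition lens :: "complex set"
  where "lens = {q. norm (q * (1 - q)) < 1 \<and> 0 < Re q \<and> Re q < 1}"

definition half_lens :: "complex set"
  where "half_lens = {q. 1 / 2 \<le> Re q \<and> Re q < 1 \<and> norm q \<le> 1 \<and> norm (1 - q) < 1}"

definition log_lens :: "complex \<Rightarrow> complex"
  where "log_lens q = Ln q + Ln (1 - q)"

definition lens_integrand :: "nat \<Rightarrow> nat list \<Rightarrow> complex \<Rightarrow> complex"
  where "lens_integrand m A q = log_lens q ^ m * polylog (ones A) (q * (1 - q)) / q"

lemma open_lens: "open lens"
  unfolding lens_def by (intro open_Collect_conj open_Collect_less continuous_intros)

lemma starlike_lens: "starlike lens"
  unfolding starlike_def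
proof (intro bexI[of _ "1 / 2"] ballI subsetI)
  show half: "1 / 2 \<in> lens" by (simp add: lens_def norm_mult)
  fix x y assume x: "x \<in> lens" and y: "y \<in> closed_segment (1 / 2) x"
  have "convex {q. 0 < Re q \<and> Re q < 1}"
    using convex_Int[OF convex_halfspace_Re_gt[of 0] convex_halfspace_Re_lt[of 1]] by (simp add: Int_def)
  hence "y \<in> {q. 0 < Re q \<and> Re q < 1}"
    using closed_segment_subset[of "1 / 2" "{q. 0 < Re q \<and> Re q < 1}" x] x y by (auto simp: lens_def)
  moreover have "y * (1 - y) \<in> closed_segment (1 / 4) (x * (1 - x))"
  proof -
    obtain u where u: "0 \<le> u" "u \<le> 1" "y = (1 - u) *\<^sub>R (1 / 2) + u *\<^sub>R x"
      using y by (auto simp: closed_segment_def)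
    have "y * (1 - y) = (1 - u ^ 2) *\<^sub>R (1 / 4) + u ^ 2 *\<^sub>R (x * (1 - x))"
      unfolding u(3) scaleR_conv_of_real by (simp add: field_simps power2_eq_square)
    moreover have "u ^ 2 \<le> 1" using u by (simp add: power_le_one)
    ultimately show ?thesis unfolding closed_segment_def by (auto intro!: exI[of _ "u ^ 2"])
  qed
  moreover have "closed_segment (1 / 4) (x * (1 - x)) \<subseteq> ball 0 1"
    using x by (intro closed_segment_subset) (auto simp: lens_def)
  ultimately show "y \<in> lens" by (auto simp: lens_def)
qed

lemma convex_half_lens: "convex half_lens"
proof -
  have half_lens: "half_lens = {q. Re q \<ge> 1 / 2} \<inter> {q. Re q < 1} \<inter> cball 0 1 \<inter> ball 1 1"
    by (auto simp: half_lens_def dist_norm)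
  show ?thesis
    unfolding half_lens by (intro convex_Int convex_halfspace_Re_ge convex_halfspace_Re_lt convex_cball convex_ball)
qed

lemma half_lens_subset_lens: "half_lens \<subseteq> lens"
proof
  fix q assume q: "q \<in> half_lens"
  have "norm q * norm (1 - q) \<le> 1 * norm (1 - q)" using q by (intro mult_right_mono) (auto simp: half_lens_def)
  thus "q \<in> lens" using q by (auto simp: half_lens_def lens_def norm_mult)
qed

lemma lens_not_nonpos_Reals:
  assumes "q \<in> lens"
  shows "q \<notin> \<real>\<^sub>\<le>\<^sub>0" "1 - q \<notin> \<real>\<^sub>\<le>\<^sub>0"
  using assms by (auto simp: lens_def complex_nonpos_Reals_iff)

lemma lens_integrand_field_differentiable:
  assumes "q \<in> lens" "0 \<notin> set A"
  shows "lens_integrand m A field_differentiable (at q)"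
proof -
  have "q \<noteq> 0" using assms(1) by (auto simp: lens_def)
  have "polylog (ones A) field_differentiable (at (q * (1 - q)))"
    using has_field_derivative_polylog[of "ones A" "q * (1 - q)"] assms
    by (auto simp: field_differentiable_def lens_def)
  moreover have "(\<lambda>q. q * (1 - q)) field_differentiable (at q)"
    by (intro derivative_intros)
  ultimately have "(polylog (ones A) \<circ> (\<lambda>q. q * (1 - q))) field_differentiable (at q)"
    by (intro field_differentiable_compose)
  moreover have "Ln field_differentiable (at q)"
    by (rule field_differentiable_at_Ln[OF lens_not_nonpos_Reals(1)[OF assms(1)]])
  moreover have "(Ln \<circ> (\<lambda>q. 1 - q)) field_differentiable (at q)"
    by (intro field_differentiable_compose derivative_intros field_differentiable_at_Ln lens_not_nonpos_Reals assms)
  ultimately show ?thesis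
    unfolding lens_integrand_def[abs_def] log_lens_def o_def using \<open>q \<noteq> 0\<close>
    by (intro derivative_intros) auto
qed

lemma power_le_fact_times_exp:
  assumes "0 \<le> (y::real)"
  shows "y ^ m \<le> fact m * exp y"
proof -
  have "(\<Sum>n\<in>{m}. y ^ n /\<^sub>R fact n) \<le> suminf (\<lambda>n. y ^ n /\<^sub>R fact n)"
    by (rule sum_le_suminf) (use summable_exp_generic[of y] assms in auto)
  thus ?thesis by (simp add: exp_def field_simps)
qed

lemma norm_Ln_le: "q \<noteq> 0 \<Longrightarrow> norm (Ln q) \<le> \<bar>ln (norm q)\<bar> + 4"
proof -
  assume "q \<noteq> 0"
  hence "\<bar>Im (Ln q)\<bar> \<le> pi" "Re (Ln q) = ln (norm q)"
    using mpi_less_Im_Ln[of q] Im_Ln_le_pi[of q] by (auto simp: abs_le_iff)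
  thus ?thesis using cmod_le[of "Ln q"] pi_less_4 by linarith
qed

lemma norm_log_lens_le:
  assumes "q \<in> half_lens"
  shows "norm (log_lens q) \<le> 9 - ln (norm (1 - q))"
proof -
  have nz: "q \<noteq> 0" "1 - q \<noteq> 0" using assms by (auto simp: half_lens_def)
  have "1 / 2 \<le> norm q" using assms complex_Re_le_cmod[of q] by (auto simp: half_lens_def)
  hence "ln (1 / 2) \<le> ln (norm q)" using nz by (intro ln_mono) auto
  moreover have "ln (1 / 2 :: real) \<ge> - 1" using ln_2_less_1 by (simp add: ln_div)
  moreover have "ln (norm q) \<le> 0" "ln (norm (1 - q)) \<le> 0" using assms nz by (auto simp: half_lens_def)
  ultimately have "\<bar>ln (norm q)\<bar> \<le> 1" "\<bar>ln (norm (1 - q))\<bar> = - ln (norm (1 - q))" by auto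
  thus ?thesis
    using norm_triangle_ineq[of "Ln q" "Ln (1 - q)"] norm_Ln_le[OF nz(1)] norm_Ln_le[OF nz(2)]
    unfolding log_lens_def by linarith
qed

text \<open>
  Any exponent between \<open>- 1 / 2\<close> and \<open>0\<close> would do: the points of the real axis and of the unit circle
  with real part \<open>x\<close> have distance \<open>sqrt (1 - x\<^sup>2)\<close>, which tends to 0 like \<open>sqrt (1 - x)\<close>.
\<close>

lemma norm_lens_integrand_le:
  assumes "0 \<notin> set A" "A = [] \<or> hd A \<ge> 2"
  obtains K where "K \<ge> 0"
    "\<And>q. q \<in> half_lens \<Longrightarrow> norm (lens_integrand m A q) \<le> K * norm (1 - q) powr (- 1 / 4)"
proof -
  obtain B where B: "B \<ge> 0" "\<And>z::complex. norm z < 1 \<Longrightarrow> norm (polylog (ones A) z) \<le> B"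
    using polylog_ones_bounded[OF assms] by blast
  define K where "K = 4 ^ m * fact m * exp (9 / 4) * B * 2"
  have "norm (lens_integrand m A q) \<le> K * norm (1 - q) powr (- 1 / 4)" if q: "q \<in> half_lens" for q
  proof -
    define d where "d = norm (1 - q)"
    have d: "0 < d" "d < 1" using q by (auto simp: d_def half_lens_def)
    have q': "norm (q * (1 - q)) < 1" "1 / 2 \<le> norm q"
      using q half_lens_subset_lens complex_Re_le_cmod[of q] by (auto simp: half_lens_def lens_def)
    have "norm (log_lens q) ^ m \<le> (4 * ((9 - ln d) / 4)) ^ m"
      using norm_log_lens_le[OF q] by (intro power_mono) (auto simp: d_def)
    also have "\<dots> \<le> 4 ^ m * (fact m * exp ((9 - ln d) / 4))"
      unfolding power_mult_distrib using d
      by (intro mult_left_mono power_le_fact_times_exp) (auto intro: order_trans[of _ 0])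
    also have "exp ((9 - ln d) / 4) = exp (9 / 4) * d powr (- 1 / 4)"
      using d(1) by (simp add: powr_def diff_divide_distrib flip: exp_add)
    finally have "norm (log_lens q) ^ m \<le> 4 ^ m * fact m * exp (9 / 4) * d powr (- 1 / 4)" by (simp add: mult_ac)
    moreover have "norm (lens_integrand m A q) =
        norm (log_lens q) ^ m * norm (polylog (ones A) (q * (1 - q))) / norm q"
      by (simp add: lens_integrand_def norm_mult norm_divide norm_power)
    ultimately have "norm (lens_integrand m A q) \<le> (4 ^ m * fact m * exp (9 / 4) * d powr (- 1 / 4)) * B / (1 / 2)"
      using B q' by (simp only:) (intro frac_le mult_mono, auto)
    thus ?thesis by (simp add: K_def d_def mult_ac)
  qed
  moreover have "K \<ge> 0" using B by (simp add: K_def)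
  ultimately show ?thesis by (rule that[rotated])
qed

lemma one_minus_cis: "1 - cis (- 2 * \<theta>) = rcis (2 * sin \<theta>) (pi / 2 - \<theta>)"
  by (simp add: complex_eq_iff cos_diff sin_diff cos_double_sin sin_double power2_eq_square)

lemma cis_in_half_lens:
  assumes "0 < \<theta>" "\<theta> < pi / 6"
  shows "cis (- 2 * \<theta>) \<in> half_lens"
proof -
  note sin_cos = sin_cos_less_pi_6[OF assms]
  have "(sin \<theta>) ^ 2 < 1 / 4" using power_strict_mono[of "sin \<theta>" "1 / 2" 2] sin_cos by (simp add: power_divide)
  thus ?thesis
    using sin_cos unfolding half_lens_def mem_Collect_eq one_minus_cis by (simp add: cos_double_sin)
qed

lemma cos_in_half_lens:
  assumes "0 < \<theta>" "\<theta> < pi / 6"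
  shows "complex_of_real (cos (2 * \<theta>)) \<in> half_lens"
proof -
  have "Re (cis (- 2 * \<theta>)) = cos (2 * \<theta>)" by simp
  hence cos: "1 / 2 \<le> cos (2 * \<theta>)" "cos (2 * \<theta>) < 1"
    using cis_in_half_lens[OF assms] by (auto simp: half_lens_def)
  have "norm (1 - complex_of_real (cos (2 * \<theta>))) = \<bar>1 - cos (2 * \<theta>)\<bar>"
    by (metis norm_of_real of_real_1 of_real_diff)
  thus ?thesis using cos by (simp add: half_lens_def)
qed

lemma log_lens_cis:
  assumes "0 < \<theta>" "\<theta> < pi / 6"
  shows "log_lens (cis (- 2 * \<theta>)) = of_real (ln (2 * sin \<theta>)) + \<i> * of_real (pi / 2 - 3 * \<theta>)"
  unfolding log_lens_def one_minus_cis using assms sin_cos_less_pi_6[OF assms]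
  by (simp add: Ln_cis Ln_rcis complex_eq_iff)

definition vertical_param :: "real \<Rightarrow> complex"
  where "vertical_param \<theta> = rcis (1 / (2 * sin \<theta>)) (\<theta> - pi / 2)"

lemma sin_cos_greater_pi_6:
  assumes "pi / 6 < \<theta>" "\<theta> < pi / 2"
  shows "1 / 2 < sin \<theta>" "sin \<theta> < 1" "0 < cos \<theta>"
proof -
  show "1 / 2 < sin \<theta>" using sin_monotone_2pi[of "pi / 6" \<theta>] assms by (simp add: sin_30)
  show "sin \<theta> < 1" using sin_monotone_2pi[of \<theta> "pi / 2"] assms by simp
  show "0 < cos \<theta>" using assms by (intro cos_gt_zero_pi) auto
qed

lemma sq_inverse_double_sin_less_1:
  assumes "pi / 6 < \<theta>" "\<theta> < pi / 2"
  shows "\<bar>(1 / (2 * sin \<theta>)) ^ 2\<bar> < 1"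
  using sin_cos_greater_pi_6[OF assms] power_strict_mono[of "1 / (2 * sin \<theta>)" 1 2] by auto

lemma abs_ln_double_sin_le_1:
  assumes "pi / 6 < \<theta>" "\<theta> < pi / 2"
  shows "\<bar>ln (2 * sin \<theta>)\<bar> \<le> 1"
  using sin_cos_greater_pi_6[OF assms] ln_le_minus_one[of "2 * sin \<theta>"] ln_ge_zero[of "2 * sin \<theta>"] by auto

lemma one_minus_vertical_param:
  "sin \<theta> \<noteq> 0 \<Longrightarrow> 1 - vertical_param \<theta> = rcis (1 / (2 * sin \<theta>)) (pi / 2 - \<theta>)"
  by (simp add: vertical_param_def complex_eq_iff cos_diff sin_diff)

lemma vertical_param_times_one_minus:
  "sin \<theta> \<noteq> 0 \<Longrightarrow> vertical_param \<theta> * (1 - vertical_param \<theta>) = of_real ((1 / (2 * sin \<theta>)) ^ 2)"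
  unfolding one_minus_vertical_param by (simp add: vertical_param_def rcis_mult power2_eq_square)

lemma vertical_param_in_half_lens:
  assumes "pi / 6 < \<theta>" "\<theta> < pi / 2"
  shows "vertical_param \<theta> \<in> half_lens"
proof -
  have "sin \<theta> \<noteq> 0" "1 / (2 * sin \<theta>) < 1" using sin_cos_greater_pi_6[OF assms] by auto
  moreover have "norm (1 - vertical_param \<theta>) = \<bar>1 / (2 * sin \<theta>)\<bar>"
    by (simp only: one_minus_vertical_param[OF \<open>sin \<theta> \<noteq> 0\<close>] complex_mod_rcis)
  ultimately show ?thesis
    using sin_cos_greater_pi_6[OF assms] by (simp add: half_lens_def) (simp add: vertical_param_def cos_diff)
qed

lemma log_lens_vertical_param:
  assumes "pi / 6 < \<theta>" "\<theta> < pi / 2"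
  shows "log_lens (vertical_param \<theta>) = of_real (- 2 * ln (2 * sin \<theta>))"
proof -
  have "sin \<theta> \<noteq> 0" "0 < sin \<theta>" using sin_cos_greater_pi_6[OF assms] by auto
  thus ?thesis
    unfolding log_lens_def one_minus_vertical_param[OF \<open>sin \<theta> \<noteq> 0\<close>] unfolding vertical_param_def using assms
    by (simp add: Ln_rcis complex_eq_iff ln_div)
qed

lemma has_vector_derivative_vertical_param:
  assumes "sin \<theta> \<noteq> 0"
  shows "(vertical_param has_vector_derivative vertical_param \<theta> * (\<i> - of_real (cos \<theta> / sin \<theta>))) (at \<theta>)"
proof -
  have "((\<lambda>\<theta>. 1 / (2 * sin \<theta>)) has_real_derivative - (cos \<theta> / sin \<theta>) * (1 / (2 * sin \<theta>))) (at \<theta>)"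
    using assms by (auto intro!: derivative_eq_intros simp: field_simps)
  hence "((\<lambda>\<theta>. complex_of_real (1 / (2 * sin \<theta>))) has_vector_derivative
      of_real (- (cos \<theta> / sin \<theta>) * (1 / (2 * sin \<theta>)))) (at \<theta>)"
    by (intro has_vector_derivative_of_real) (simp add: has_real_derivative_iff_has_vector_derivative)
  moreover have "((\<lambda>\<theta>. cis (\<theta> - pi / 2)) has_vector_derivative \<i> * cis (\<theta> - pi / 2)) (at \<theta>)"
    unfolding has_vector_derivative_def by (auto intro!: derivative_eq_intros)
  ultimately have "((\<lambda>\<theta>. complex_of_real (1 / (2 * sin \<theta>)) * cis (\<theta> - pi / 2)) has_vector_derivative
      of_real (1 / (2 * sin \<theta>)) * (\<i> * cis (\<theta> - pi / 2)) +
      of_real (- (cos \<theta> / sin \<theta>) * (1 / (2 * sin \<theta>))) * cis (\<theta> - pi / 2)) (at \<theta>)"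
    by (rule has_vector_derivative_mult)
  also have "of_real (1 / (2 * sin \<theta>)) * (\<i> * cis (\<theta> - pi / 2)) +
      of_real (- (cos \<theta> / sin \<theta>) * (1 / (2 * sin \<theta>))) * cis (\<theta> - pi / 2) =
      vertical_param \<theta> * (\<i> - of_real (cos \<theta> / sin \<theta>))"
    using assms by (simp add: vertical_param_def rcis_def field_simps)
  finally show ?thesis by (simp only: vertical_param_def[abs_def] rcis_def)
qed

definition lower_half_lens :: "complex set"
  where "lower_half_lens = half_lens \<inter> {q. Im q \<le> - 1 / 2}"

lemma cis_notin_lower_half_lens: "cis (- pi / 3) \<notin> lower_half_lens"
  by (simp add: lower_half_lens_def half_lens_def cmod_def cos_60 sin_60 power_divide)

lemma filterlim_cis_lower_corner:
  "filterlim (\<lambda>\<theta>. cis (- 2 * \<theta>)) (at (cis (- pi / 3)) within lower_half_lens) (at_left (pi / 6))"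
proof -
  have "\<forall>\<^sub>F \<theta> in at_left (pi / 6). \<theta> \<in> {pi/12<..<pi/6}" by (rule eventually_at_left_real) simp
  hence "\<forall>\<^sub>F \<theta> in at_left (pi / 6). cis (- 2 * \<theta>) \<in> lower_half_lens"
  proof eventually_elim
    case (elim \<theta>)
    hence "sin (pi / 6) \<le> sin (2 * \<theta>)" by (intro sin_monotone_2pi_le) auto
    thus ?case using cis_in_half_lens[of \<theta>] elim by (simp add: lower_half_lens_def sin_30)
  qed
  moreover have "((\<lambda>\<theta>. cis (- 2 * \<theta>)) \<longlongrightarrow> cis (- 2 * (pi / 6))) (at_left (pi / 6))"
    by (intro tendsto_intros)
  ultimately show ?thesis
    using cis_notin_lower_half_lens by (auto simp: filterlim_at elim: eventually_mono)
qed

lemma filterlim_vertical_param_lower_corner: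
  "filterlim vertical_param (at (cis (- pi / 3)) within lower_half_lens) (at_right (pi / 6))"
proof -
  have "\<forall>\<^sub>F \<theta> in at_right (pi / 6). \<theta> \<in> {pi/6<..<pi/4}" by (rule eventually_at_right_real) simp
  hence "\<forall>\<^sub>F \<theta> in at_right (pi / 6). vertical_param \<theta> \<in> lower_half_lens"
  proof eventually_elim
    case (elim \<theta>)
    hence \<theta>: "pi / 6 < \<theta>" "\<theta> < pi / 2" by auto
    have "sin \<theta> \<le> sin (pi / 4)" "cos (pi / 4) \<le> cos \<theta>"
      using elim by (intro sin_monotone_2pi_le cos_monotone_0_pi_le; simp)+
    hence "sin \<theta> \<le> cos \<theta>" by (simp add: sin_45 cos_45)
    thus ?case
      using vertical_param_in_half_lens[OF \<theta>] sin_cos_greater_pi_6[OF \<theta>]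
      by (simp add: lower_half_lens_def) (simp add: vertical_param_def sin_diff)
  qed
  moreover have "(vertical_param \<longlongrightarrow> rcis (1 / (2 * sin (pi / 6))) (pi / 6 - pi / 2)) (at_right (pi / 6))"
    unfolding vertical_param_def[abs_def] by (intro tendsto_intros) (simp add: sin_30)
  moreover have "rcis (1 / (2 * sin (pi / 6))) (pi / 6 - pi / 2) = cis (- pi / 3)" by (simp add: sin_30 rcis_def)
  ultimately show ?thesis
    using cis_notin_lower_half_lens by (auto simp: filterlim_at elim: eventually_mono)
qed

lemma double_sin_nonzero: "\<theta> \<in> {pi/6<..<pi/2} \<Longrightarrow> 2 * sin \<theta> \<noteq> 0"
  using sin_cos_greater_pi_6[of \<theta>] by auto

lemma set_integrable_polylog_large_angles:
  assumes "0 \<notin> set A" "A = [] \<or> hd A \<ge> 2"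
  shows "set_integrable lborel {pi/6..pi/2} (\<lambda>\<theta>. polylog (ones A) ((1 / (2 * sin \<theta>)) ^ 2) * ln (2 * sin \<theta>) ^ m)"
proof (rule set_integrable_polylog_ones[OF assms])
  show "continuous_on {pi/6<..<pi/2} (\<lambda>\<theta>. (1 / (2 * sin \<theta>)) ^ 2)"
    "continuous_on {pi/6<..<pi/2} (\<lambda>\<theta>. ln (2 * sin \<theta>) ^ m)"
    using double_sin_nonzero by (intro continuous_intros; blast)+
  show "\<bar>ln (2 * sin \<theta>) ^ m\<bar> \<le> 1" if "pi / 6 < \<theta>" "\<theta> < pi / 2" for \<theta>
    using abs_ln_double_sin_le_1[OF that] by (simp add: power_abs power_le_one)
qed (rule sq_inverse_double_sin_less_1)

lemma of_rat_fact: "of_rat (fact n) = (fact n :: 'a::field_char_0)"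
  by (metis of_nat_fact of_rat_of_nat_eq)

text \<open>
  At the corners \<open>cis (- pi / 3)\<close> and \<open>1\<close> of the region between the line \<open>Re q = 1 / 2\<close>, the real axis
  and the unit circle, the primitive is not defined, and the integrand has a logarithmic
  singularity at the second one.
\<close>

locale lens_primitive =
  fixes \<Phi> :: "complex \<Rightarrow> complex" and m :: nat and A :: "nat list"
  assumes deriv: "\<And>q. q \<in> lens \<Longrightarrow> (\<Phi> has_field_derivative lens_integrand m A q) (at q)"
    and positive: "0 \<notin> set A" and bounded: "A = [] \<or> hd A \<ge> 2"
begin

lemma norm_primitive_diff_le:
  obtains K where "K \<ge> 0"
    "\<And>p q d. p \<in> half_lens \<Longrightarrow> q \<in> half_lens \<Longrightarrow> 0 < d \<Longrightarrow>
       (\<And>s. s \<in> closed_segment p q \<Longrightarrow> d \<le> norm (1 - s)) \<Longrightarrow>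
       norm (\<Phi> p - \<Phi> q) \<le> K * d powr (- 1 / 4) * norm (p - q)"
proof -
  obtain K where K: "K \<ge> 0"
    "\<And>q. q \<in> half_lens \<Longrightarrow> norm (lens_integrand m A q) \<le> K * norm (1 - q) powr (- 1 / 4)"
    using norm_lens_integrand_le[OF positive bounded] by blast
  have "norm (\<Phi> p - \<Phi> q) \<le> K * d powr (- 1 / 4) * norm (p - q)"
    if pq: "p \<in> half_lens" "q \<in> half_lens" and d: "0 < d" "\<And>s. s \<in> closed_segment p q \<Longrightarrow> d \<le> norm (1 - s)"
    for p q d
  proof (rule field_differentiable_bound[of "closed_segment p q"])
    fix s assume s: "s \<in> closed_segment p q"
    hence "s \<in> half_lens" using closed_segment_subset[OF pq convex_half_lens] by blast
    thus "(\<Phi> has_field_derivative lens_integrand m A s) (at s within closed_segment p q)"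
      using half_lens_subset_lens by (blast intro: has_field_derivative_at_within[OF deriv])
    have "norm (lens_integrand m A s) \<le> K * norm (1 - s) powr (- 1 / 4)" by (rule K(2)) fact
    also have "\<dots> \<le> K * d powr (- 1 / 4)"
      using K(1) d(1) d(2)[OF s] by (intro mult_left_mono powr_mono2') auto
    finally show "norm (lens_integrand m A s) \<le> K * d powr (- 1 / 4)" .
  qed auto
  thus ?thesis using that K(1) by blast
qed

lemma primitive_cos_minus_cis_tendsto_0:
  "((\<lambda>\<theta>. \<Phi> (of_real (cos (2 * \<theta>))) - \<Phi> (cis (- 2 * \<theta>))) \<longlongrightarrow> 0) (at_right 0)"
proof -
  obtain K where K: "K \<ge> 0" "\<And>p q d. p \<in> half_lens \<Longrightarrow> q \<in> half_lens \<Longrightarrow> 0 < d \<Longrightarrow>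
      (\<And>s. s \<in> closed_segment p q \<Longrightarrow> d \<le> norm (1 - s)) \<Longrightarrow>
      norm (\<Phi> p - \<Phi> q) \<le> K * d powr (- 1 / 4) * norm (p - q)"
    using norm_primitive_diff_le by blast
  have "((\<lambda>\<theta>. 2 * K * sqrt (sin \<theta>)) \<longlongrightarrow> 2 * K * sqrt (sin 0)) (at_right 0)"
    by (intro tendsto_intros)
  hence "((\<lambda>\<theta>. 2 * K * sqrt (sin \<theta>)) \<longlongrightarrow> 0) (at_right 0)" by simp
  moreover have "\<forall>\<^sub>F \<theta> in at_right 0. \<theta> \<in> {0<..<pi/6}" by (rule eventually_at_right_real) simp
  hence "\<forall>\<^sub>F \<theta> in at_right 0. norm (\<Phi> (of_real (cos (2 * \<theta>))) - \<Phi> (cis (- 2 * \<theta>))) \<le> 2 * K * sqrt (sin \<theta>)"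
  proof eventually_elim
    case (elim \<theta>)
    hence \<theta>: "0 < \<theta>" "\<theta> < pi / 6" by auto
    have sin_pos: "0 < sin \<theta>" using sin_cos_less_pi_6[OF \<theta>] by simp
    have "sin \<theta> ^ 2 \<le> norm (1 - s)"
      if "s \<in> closed_segment (of_real (cos (2 * \<theta>))) (cis (- 2 * \<theta>))" for s
    proof -
      have "Re s = cos (2 * \<theta>)" using that by (auto simp: closed_segment_def) (simp add: algebra_simps)
      hence "2 * sin \<theta> ^ 2 \<le> norm (1 - s)"
        using complex_Re_le_cmod[of "1 - s"] by (simp add: cos_double_sin)
      thus ?thesis using zero_le_power2[of "sin \<theta>"] by linarith
    qed
    hence "norm (\<Phi> (of_real (cos (2 * \<theta>))) - \<Phi> (cis (- 2 * \<theta>))) \<le>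
        K * (sin \<theta> ^ 2) powr (- 1 / 4) * norm (of_real (cos (2 * \<theta>)) - cis (- 2 * \<theta>))"
      using sin_pos by (intro K(2) cos_in_half_lens cis_in_half_lens \<theta>) auto
    also have "(sin \<theta> ^ 2) powr (- 1 / 4) = 1 / sqrt (sin \<theta>)"
      using sin_pos by (simp add: powr_half_sqrt powr_minus_divide powr_powr powr_numeral[symmetric] del: powr_numeral)
    also have "norm (of_real (cos (2 * \<theta>)) - cis (- 2 * \<theta>)) = 2 * sin \<theta> * \<bar>cos \<theta>\<bar>"
      using sin_pos by (simp add: cmod_def sin_double abs_mult)
    also have "K * (1 / sqrt (sin \<theta>)) * (2 * sin \<theta> * \<bar>cos \<theta>\<bar>) = 2 * K * (sin \<theta> / sqrt (sin \<theta>)) * \<bar>cos \<theta>\<bar>"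
      by simp
    also have "\<dots> \<le> 2 * K * (sin \<theta> / sqrt (sin \<theta>)) * 1"
      using K(1) sin_pos by (intro mult_left_mono) auto
    finally show ?case using sin_pos by (simp add: real_div_sqrt)
  qed
  ultimately show ?thesis by (rule Lim_null_comparison[rotated])
qed

lemma uniformly_continuous_on_lower_half_lens: "uniformly_continuous_on lower_half_lens \<Phi>"
proof -
  obtain K where K: "K \<ge> 0" "\<And>p q d. p \<in> half_lens \<Longrightarrow> q \<in> half_lens \<Longrightarrow> 0 < d \<Longrightarrow>
      (\<And>s. s \<in> closed_segment p q \<Longrightarrow> d \<le> norm (1 - s)) \<Longrightarrow>
      norm (\<Phi> p - \<Phi> q) \<le> K * d powr (- 1 / 4) * norm (p - q)"
    using norm_primitive_diff_le by blast
  have convex: "convex lower_half_lens"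
    unfolding lower_half_lens_def by (intro convex_Int convex_half_lens convex_halfspace_Im_le)
  have "(K * (1 / 2) powr (- 1 / 4))-lipschitz_on lower_half_lens \<Phi>"
  proof (rule lipschitz_onI)
    fix p q assume pq: "p \<in> lower_half_lens" "q \<in> lower_half_lens"
    have "1 / 2 \<le> norm (1 - s)" if "s \<in> closed_segment p q" for s
      using closed_segment_subset[OF pq convex] that abs_Im_le_cmod[of "1 - s"]
      by (auto simp: lower_half_lens_def)
    thus "dist (\<Phi> p) (\<Phi> q) \<le> K * (1 / 2) powr (- 1 / 4) * dist p q"
      unfolding dist_norm using pq by (intro K(2)) (auto simp: lower_half_lens_def)
  qed (use K(1) in simp)
  thus ?thesis by (rule lipschitz_on_uniformly_continuous)
qed

lemma tendsto_lower_corner: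
  obtains C where "((\<lambda>\<theta>. \<Phi> (cis (- 2 * \<theta>))) \<longlongrightarrow> C) (at_left (pi / 6))"
    "((\<lambda>\<theta>. \<Phi> (vertical_param \<theta>)) \<longlongrightarrow> C) (at_right (pi / 6))"
proof -
  have "cis (- pi / 3) \<in> closure lower_half_lens"
    using filterlim_cis_lower_corner
    by (intro Lim_in_closed_set[of "closure lower_half_lens" "\<lambda>\<theta>. cis (- 2 * \<theta>)" "at_left (pi / 6)"])
      (auto simp: filterlim_at elim: eventually_mono intro: subsetD[OF closure_subset])
  with uniformly_continuous_on_lower_half_lens
  obtain C where C: "(\<Phi> \<longlongrightarrow> C) (at (cis (- pi / 3)) within lower_half_lens)"
    by (rule uniformly_continuous_on_extension_at_closure)
  show ?thesis
    by (rule that[OF filterlim_compose[OF C filterlim_cis_lower_corner]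
          filterlim_compose[OF C filterlim_vertical_param_lower_corner]])
qed

lemma Im_eq_on_real_segment:
  assumes "0 < x" "x < 1"
  shows "Im (\<Phi> (of_real x)) = Im (\<Phi> (1 / 2))"
proof -
  have "\<exists>C. \<forall>x\<in>{0<..<1}. Im (\<Phi> (of_real x)) = C"
  proof (rule has_vector_derivative_zero_constant)
    fix x :: real assume "x \<in> {0<..<1}"
    hence x: "0 < x" "x < 1" by auto
    have "x * (1 - x) < 1 * 1" using x by (intro mult_strict_mono) auto
    hence product: "\<bar>x * (1 - x)\<bar> < 1" using x by (simp add: abs_mult)
    have of_real_product: "complex_of_real x * (1 - of_real x) = of_real (x * (1 - x))" by simp
    hence "complex_of_real x \<in> lens"
      using x product unfolding lens_def mem_Collect_eq of_real_product norm_of_real by simp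
    from has_vector_derivative_real_field[OF deriv[OF this]]
    have "((\<lambda>x. Im (\<Phi> (of_real x))) has_vector_derivative Im (lens_integrand m A (of_real x))) (at x)"
      by (rule bounded_linear.has_vector_derivative[OF bounded_linear_Im])
    moreover have "lens_integrand m A (of_real x) \<in> \<real>"
    proof -
      have "Ln (complex_of_real x) = of_real (ln x)" "Ln (1 - complex_of_real x) = of_real (ln (1 - x))"
        using x Ln_of_real[of x] Ln_of_real[of "1 - x"] by auto
      thus ?thesis
        unfolding lens_integrand_def log_lens_def of_real_product polylog_ones_of_real[OF positive product] by simp
    qed
    ultimately show "((\<lambda>x. Im (\<Phi> (of_real x))) has_vector_derivative 0) (at x within {0<..<1})"
      by (simp add: has_vector_derivative_at_within complex_is_Real_iff)
  qed auto
  then obtain C where "\<And>x. 0 < x \<Longrightarrow> x < 1 \<Longrightarrow> Im (\<Phi> (of_real x)) = C" by auto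
  from this[OF assms] this[of "1 / 2"] show ?thesis by simp
qed

lemma has_vector_derivative_cis_arc:
  assumes "0 < \<theta>" "\<theta> < pi / 6"
  defines "q \<equiv> cis (- 2 * \<theta>)"
  shows "((\<lambda>\<theta>. \<Phi> (cis (- 2 * \<theta>))) has_vector_derivative
    - (2 * \<i> * (log_lens q ^ m * polylog (ones A) (q * (1 - q))))) (at \<theta>)"
proof -
  have cis_deriv: "((\<lambda>\<theta>. cis (- 2 * \<theta>)) has_vector_derivative - 2 * \<i> * q) (at \<theta>)"
    unfolding has_vector_derivative_def q_def
    by (auto intro!: derivative_eq_intros simp: fun_eq_iff scaleR_conv_of_real mult_ac)
  have "(\<Phi> has_field_derivative lens_integrand m A q) (at (cis (- 2 * \<theta>)))"
    unfolding q_def using cis_in_half_lens[OF assms(1,2)] half_lens_subset_lens by (intro deriv) auto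
  note field_vector_diff_chain_at[OF cis_deriv this]
  moreover have "q \<noteq> 0" by (simp add: q_def)
  ultimately show ?thesis by (simp add: o_def lens_integrand_def mult.assoc)
qed

lemma cis_arc_integral:
  obtains v and F :: "real \<Rightarrow> complex" where "v \<in> MPL_space (m + 1 + sum_list A) 3"
    "\<And>\<theta> q. 0 < \<theta> \<Longrightarrow> \<theta> < pi / 6 \<Longrightarrow> q = cis (- 2 * \<theta>) \<Longrightarrow>
       (F has_vector_derivative 2 * \<i> * (log_lens q ^ m * polylog (ones A) (q * (1 - q)))) (at \<theta>)"
    "(F \<longlongrightarrow> 0) (at_left (pi / 6))" "(F \<longlongrightarrow> v) (at_right 0)"
proof -
  have letters: "\<alpha> ^ 3 = 1" if "\<alpha> \<in> snd ` set [(1, 1), (1, omega), (- 2, omega ^ 2)]" for \<alpha> :: complex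
    using that by (auto simp: omega_cube omega_power_6)
  obtain g where g: "g \<in> polylog_span (root_words 3 m)"
    "\<And>z. norm z < 1 \<Longrightarrow> g z = log_primitive [(1, 1), (1, omega), (- 2, omega ^ 2)] z ^ m / fact m"
    using log_primitive_power_in_polylog_span[OF _ letters] by (metis zero_less_numeral)
  from arc.integral_cubic_param[OF refl g(1) positive]
  obtain v F where v: "v \<in> MPL_space (m + 1 + sum_list A) 3"
    and F: "\<And>\<theta> w. 0 < \<theta> \<Longrightarrow> \<theta> < pi / 6 \<Longrightarrow> w = complex_of_real (cubic_param \<theta>) \<Longrightarrow>
       (F has_vector_derivative 2 * \<i> * (g w * polylog (ones A) (arc_path w))) (at \<theta>)"
    and F_lim: "(F \<longlongrightarrow> 0) (at_left (pi / 6))" "(F \<longlongrightarrow> v) (at_right 0)"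
    by blast
  show ?thesis
  proof (rule that[of "fact m * v" "\<lambda>\<theta>. fact m * F \<theta>"])
    show "fact m * v \<in> MPL_space (m + 1 + sum_list A) 3"
      using rat_complex.subspace_scale[OF subspace_MPL_space v, of "fact m"] by (simp add: of_rat_fact)
    fix \<theta> :: real and q assume \<theta>: "0 < \<theta>" "\<theta> < pi / 6" and q: "q = cis (- 2 * \<theta>)"
    define w where "w = complex_of_real (cubic_param \<theta>)"
    have "norm w < 1" using cubic_param_bounds[OF \<theta>] by (simp add: w_def)
    hence "g w = log_lens q ^ m / fact m"
      by (simp only: g(2) w_def log_primitive_cubic_param[OF \<theta>] log_lens_cis[OF \<theta>] q)
    moreover have "arc_path w = q * (1 - q)"
      unfolding w_def q using cubic_denom_pos[OF \<theta>] by (intro arc_path_cubic_param) simp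
    ultimately show "((\<lambda>\<theta>. fact m * F \<theta>) has_vector_derivative
        2 * \<i> * (log_lens q ^ m * polylog (ones A) (q * (1 - q)))) (at \<theta>)"
      using has_vector_derivative_mult_right[OF F[OF \<theta> w_def], of "fact m"] by simp
  qed (use F_lim in \<open>auto intro: tendsto_mult_right_zero tendsto_mult_left\<close>)
qed

lemma tendsto_cis_diff_in_MPL_space:
  obtains C v where "v \<in> MPL_space (m + 1 + sum_list A) 3"
    "((\<lambda>\<theta>. \<Phi> (cis (- 2 * \<theta>))) \<longlongrightarrow> C) (at_left (pi / 6))"
    "((\<lambda>\<theta>. \<Phi> (cis (- 2 * \<theta>))) \<longlongrightarrow> C - v) (at_right 0)"
proof -
  obtain v F where v: "v \<in> MPL_space (m + 1 + sum_list A) 3"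
    and F: "\<And>\<theta> q. 0 < \<theta> \<Longrightarrow> \<theta> < pi / 6 \<Longrightarrow> q = cis (- 2 * \<theta>) \<Longrightarrow>
       (F has_vector_derivative 2 * \<i> * (log_lens q ^ m * polylog (ones A) (q * (1 - q)))) (at \<theta>)"
    and F_lim: "(F \<longlongrightarrow> 0) (at_left (pi / 6))" "(F \<longlongrightarrow> v) (at_right 0)"
    by (rule cis_arc_integral) blast
  have "((\<lambda>\<theta>. F \<theta> + \<Phi> (cis (- 2 * \<theta>))) has_vector_derivative 0) (at \<theta> within {0<..<pi/6})"
    if "\<theta> \<in> {0<..<pi/6}" for \<theta>
    using has_vector_derivative_add[OF F[OF _ _ refl] has_vector_derivative_cis_arc, of \<theta>] that
    by (auto intro: has_vector_derivative_at_within)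
  from has_vector_derivative_zero_constant[OF _ this]
  have "\<exists>C. \<forall>\<theta>\<in>{0<..<pi/6}. F \<theta> + \<Phi> (cis (- 2 * \<theta>)) = C"
    by (metis convex_real_interval(8))
  then obtain C where C: "\<And>\<theta>. \<theta> \<in> {0<..<pi/6} \<Longrightarrow> C - F \<theta> = \<Phi> (cis (- 2 * \<theta>))"
    by (metis add_diff_cancel_left')
  have "\<forall>\<^sub>F \<theta> in at_left (pi / 6). \<theta> \<in> {0<..<pi/6}" by (rule eventually_at_left_real) simp
  hence "\<forall>\<^sub>F \<theta> in at_left (pi / 6). C - F \<theta> = \<Phi> (cis (- 2 * \<theta>))" by eventually_elim (rule C)
  with tendsto_diff[OF tendsto_const F_lim(1)]
  have "((\<lambda>\<theta>. \<Phi> (cis (- 2 * \<theta>))) \<longlongrightarrow> C - 0) (at_left (pi / 6))" by (rule Lim_transform_eventually)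
  hence C_lim: "((\<lambda>\<theta>. \<Phi> (cis (- 2 * \<theta>))) \<longlongrightarrow> C) (at_left (pi / 6))" by simp
  have "\<forall>\<^sub>F \<theta> in at_right 0. \<theta> \<in> {0<..<pi/6}" by (rule eventually_at_right_real) simp
  hence "\<forall>\<^sub>F \<theta> in at_right 0. C - F \<theta> = \<Phi> (cis (- 2 * \<theta>))" by eventually_elim (rule C)
  with tendsto_diff[OF tendsto_const F_lim(2)]
  have "((\<lambda>\<theta>. \<Phi> (cis (- 2 * \<theta>))) \<longlongrightarrow> C - v) (at_right 0)" by (rule Lim_transform_eventually)
  with v C_lim show ?thesis by (rule that)
qed

lemma Im_half_eq_Im_upper_limit:
  assumes "((\<lambda>\<theta>. \<Phi> (cis (- 2 * \<theta>))) \<longlongrightarrow> l) (at_right 0)"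
  shows "Im (\<Phi> (1 / 2)) = Im l"
proof -
  have "((\<lambda>\<theta>. (\<Phi> (of_real (cos (2 * \<theta>))) - \<Phi> (cis (- 2 * \<theta>))) + \<Phi> (cis (- 2 * \<theta>))) \<longlongrightarrow> 0 + l) (at_right 0)"
    by (intro tendsto_add primitive_cos_minus_cis_tendsto_0 assms)
  hence "((\<lambda>\<theta>. Im (\<Phi> (of_real (cos (2 * \<theta>))))) \<longlongrightarrow> Im l) (at_right 0)"
    by (intro tendsto_Im) simp
  moreover have "\<forall>\<^sub>F \<theta> in at_right 0. \<theta> \<in> {0<..<pi/6}" by (rule eventually_at_right_real) simp
  hence "\<forall>\<^sub>F \<theta> in at_right 0. Im (\<Phi> (of_real (cos (2 * \<theta>)))) = Im (\<Phi> (1 / 2))"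
  proof eventually_elim
    case (elim \<theta>)
    thus ?case using cos_in_half_lens[of \<theta>] by (intro Im_eq_on_real_segment) (auto simp: half_lens_def)
  qed
  ultimately have "((\<lambda>\<theta>::real. Im (\<Phi> (1 / 2))) \<longlongrightarrow> Im l) (at_right 0)"
    by (rule Lim_transform_eventually)
  thus ?thesis by (simp add: tendsto_const_iff)
qed

lemma tendsto_vertical_param_at_left_pi_2: "((\<lambda>\<theta>. \<Phi> (vertical_param \<theta>)) \<longlongrightarrow> \<Phi> (1 / 2)) (at_left (pi / 2))"
proof -
  have "(vertical_param \<longlongrightarrow> rcis (1 / (2 * sin (pi / 2))) (pi / 2 - pi / 2)) (at_left (pi / 2))"
    unfolding vertical_param_def[abs_def] by (intro tendsto_intros) auto
  hence "(vertical_param \<longlongrightarrow> 1 / 2) (at_left (pi / 2))" by (simp add: rcis_def)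
  moreover have "1 / 2 \<in> lens" by (simp add: lens_def norm_mult)
  hence "isCont \<Phi> (1 / 2)" using deriv DERIV_isCont by blast
  ultimately show ?thesis by (intro isCont_tendsto_compose[of _ \<Phi>])
qed

lemma has_vector_derivative_Im_vertical_param:
  assumes "pi / 6 < \<theta>" "\<theta> < pi / 2"
  shows "((\<lambda>\<theta>. Im (\<Phi> (vertical_param \<theta>))) has_vector_derivative
    (- 2) ^ m * (polylog (ones A) ((1 / (2 * sin \<theta>)) ^ 2) * ln (2 * sin \<theta>) ^ m)) (at \<theta>)"
proof -
  define f where "f = (- 2) ^ m * (polylog (ones A) ((1 / (2 * sin \<theta>)) ^ 2) * ln (2 * sin \<theta>) ^ m)"
  have sin: "sin \<theta> \<noteq> 0" using sin_cos_greater_pi_6[OF assms] by auto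
  have "vertical_param \<theta> \<noteq> 0" using sin by (simp add: vertical_param_def)
  hence "vertical_param \<theta> * lens_integrand m A (vertical_param \<theta>) =
      of_real (- 2 * ln (2 * sin \<theta>)) ^ m * of_real (polylog (ones A) ((1 / (2 * sin \<theta>)) ^ 2))"
    unfolding lens_integrand_def vertical_param_times_one_minus[OF sin] log_lens_vertical_param[OF assms]
      polylog_ones_of_real[OF positive sq_inverse_double_sin_less_1[OF assms]] by simp
  also have "\<dots> = of_real f" by (simp add: f_def flip: power_mult_distrib)
  finally have integrand: "vertical_param \<theta> * lens_integrand m A (vertical_param \<theta>) = of_real f" .
  have "vertical_param \<theta> \<in> lens" using vertical_param_in_half_lens[OF assms] half_lens_subset_lens by blast
  from field_vector_diff_chain_at[OF has_vector_derivative_vertical_param[OF sin] deriv[OF this]]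
  have "((\<lambda>\<theta>. \<Phi> (vertical_param \<theta>)) has_vector_derivative
      (\<i> - of_real (cos \<theta> / sin \<theta>)) * (vertical_param \<theta> * lens_integrand m A (vertical_param \<theta>))) (at \<theta>)"
    by (simp only: o_def mult.assoc mult.left_commute[of "vertical_param \<theta>"])
  from bounded_linear.has_vector_derivative[OF bounded_linear_Im this]
  have "((\<lambda>\<theta>. Im (\<Phi> (vertical_param \<theta>))) has_vector_derivative
      Im ((\<i> - of_real (cos \<theta> / sin \<theta>)) * of_real f)) (at \<theta>)"
    unfolding integrand .
  also have "Im ((\<i> - of_real (cos \<theta> / sin \<theta>)) * of_real f) = f" by simp
  finally show ?thesis unfolding f_def .
qed

lemma integral_vertical_line:
  assumes "((\<lambda>\<theta>. \<Phi> (cis (- 2 * \<theta>))) \<longlongrightarrow> C) (at_left (pi / 6))"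
  shows "(LBINT \<theta>:{pi/6..pi/2}. (- 2) ^ m * (polylog (ones A) ((1 / (2 * sin \<theta>)) ^ 2) * ln (2 * sin \<theta>) ^ m)) =
    Im (\<Phi> (1 / 2)) - Im C"
proof (rule set_integral_eq_tendsto_diff[OF _ has_vector_derivative_Im_vertical_param])
  show "continuous_on {pi/6<..<pi/2}
      (\<lambda>\<theta>. (- 2) ^ m * (polylog (ones A) ((1 / (2 * sin \<theta>)) ^ 2) * ln (2 * sin \<theta>) ^ m))"
    using positive sq_inverse_double_sin_less_1 double_sin_nonzero by (intro continuous_intros) auto
  show "set_integrable lborel {pi/6..pi/2}
      (\<lambda>\<theta>. (- 2) ^ m * (polylog (ones A) ((1 / (2 * sin \<theta>)) ^ 2) * ln (2 * sin \<theta>) ^ m))"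
    by (intro set_integrable_mult_right set_integrable_polylog_large_angles positive bounded)
  obtain C' where C': "((\<lambda>\<theta>. \<Phi> (cis (- 2 * \<theta>))) \<longlongrightarrow> C') (at_left (pi / 6))"
    "((\<lambda>\<theta>. \<Phi> (vertical_param \<theta>)) \<longlongrightarrow> C') (at_right (pi / 6))"
    by (rule tendsto_lower_corner)
  have "C' = C" using tendsto_unique[OF _ C'(1) assms] by simp
  thus "((\<lambda>\<theta>. Im (\<Phi> (vertical_param \<theta>))) \<longlongrightarrow> Im C) (at_right (pi / 6))"
    using tendsto_Im[OF C'(2)] by simp
  show "((\<lambda>\<theta>. Im (\<Phi> (vertical_param \<theta>))) \<longlongrightarrow> Im (\<Phi> (1 / 2))) (at_left (pi / 2))"
    by (intro tendsto_Im tendsto_vertical_param_at_left_pi_2)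
qed simp_all

end

lemma lens_primitive_exists:
  assumes "0 \<notin> set A" "A = [] \<or> hd A \<ge> 2"
  obtains \<Phi> where "lens_primitive \<Phi> m A"
proof -
  have "continuous_on lens (lens_integrand m A)"
    using lens_integrand_field_differentiable[OF _ assms(1)] field_differentiable_imp_continuous_at
    by (intro continuous_at_imp_continuous_on) blast
  from holomorphic_starlike_primitive[OF this starlike_lens open_lens, of "{}"]
  obtain \<Phi> where "\<And>q. q \<in> lens \<Longrightarrow> (\<Phi> has_field_derivative lens_integrand m A q) (at q)"
    using lens_integrand_field_differentiable[OF _ assms(1)] by auto
  with assms have "lens_primitive \<Phi> m A" by unfold_locales
  thus ?thesis by (rule that)
qed

lemma integral_polylog_large_angles:
  assumes "0 \<notin> set A" "A = [] \<or> hd A \<ge> 2"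
  shows "complex_of_real (LBINT \<theta>:{pi/6..pi/2}. polylog (ones A) ((1 / (2 * sin \<theta>)) ^ 2) * ln (2 * sin \<theta>) ^ m)
    \<in> (*) \<i> ` MPL_space (m + 1 + sum_list A) 3"
proof -
  define f where "f \<theta> = polylog (ones A) ((1 / (2 * sin \<theta>)) ^ 2) * ln (2 * sin \<theta>) ^ m" for \<theta> :: real
  obtain \<Phi> where "lens_primitive \<Phi> m A" using lens_primitive_exists[OF assms] .
  then interpret lens_primitive \<Phi> m A .
  obtain C v where v: "v \<in> MPL_space (m + 1 + sum_list A) 3"
    and C: "((\<lambda>\<theta>. \<Phi> (cis (- 2 * \<theta>))) \<longlongrightarrow> C) (at_left (pi / 6))"
      "((\<lambda>\<theta>. \<Phi> (cis (- 2 * \<theta>))) \<longlongrightarrow> C - v) (at_right 0)"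
    by (rule tendsto_cis_diff_in_MPL_space)
  have "(LBINT \<theta>:{pi/6..pi/2}. (- 2) ^ m * f \<theta>) = Im (\<Phi> (1 / 2)) - Im C"
    unfolding f_def by (rule integral_vertical_line[OF C(1)])
  also have "Im (\<Phi> (1 / 2)) - Im C = - Im v"
    using Im_half_eq_Im_upper_limit[OF C(2)] by simp
  finally have "(- 2) ^ m * (LBINT \<theta>:{pi/6..pi/2}. f \<theta>) = - Im v" by simp
  hence "(LBINT \<theta>:{pi/6..pi/2}. f \<theta>) = - 1 / (- 2) ^ m * Im v" by (simp add: field_simps)
  hence "complex_of_real (LBINT \<theta>:{pi/6..pi/2}. f \<theta>) = of_rat (- 1 / (- 2) ^ m) * of_real (Im v)"
    by (simp add: of_rat_divide of_rat_power of_rat_minus)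
  also have "\<dots> \<in> (*) \<i> ` MPL_space (m + 1 + sum_list A) 3"
    by (intro rat_complex.subspace_scale subspace_times_MPL_space of_real_Im_in_times_MPL_space v) auto
  finally show ?thesis unfolding f_def .
qed

section \<open>Power series of powers of the logarithm\<close>

fun binom_poly :: "nat \<Rightarrow> real poly" where
  "binom_poly 0 = 1"
| "binom_poly (Suc n) = smult (1 / real (Suc n)) (binom_poly n * [:- real n, 1:])"

declare binom_poly.simps(2) [simp del]

lemma coeff_binom_poly_Suc:
  "real (Suc n) * coeff (binom_poly (Suc n)) j =
     (if j = 0 then 0 else coeff (binom_poly n) (j - 1)) - real n * coeff (binom_poly n) j"
  by (cases j) (simp_all add: binom_poly.simps(2) del: of_nat_Suc)

lemma binom_poly_Suc_eq_prod:
  "binom_poly (Suc n) = smult ((- 1) ^ n / real (Suc n)) (monom 1 1 * (\<Prod>m=1..n. [:1, - 1 / real m:]))"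
proof (induction n)
  case 0
  show ?case by (simp add: binom_poly.simps(2) monom_altdef)
next
  case (Suc n)
  have factor: "[:- real (Suc n), 1:] = smult (- real (Suc n)) [:1, - 1 / real (Suc n):]"
    by (simp del: of_nat_Suc)
  have "1 / real (Suc (Suc n)) * (- real (Suc n) * ((- 1) ^ n / real (Suc n))) = (- 1) ^ Suc n / real (Suc (Suc n))"
    by (simp del: of_nat_Suc)
  moreover have "(\<Prod>m=1..Suc n. [:1, - 1 / real m:]) = (\<Prod>m=1..n. [:1, - 1 / real m:]) * [:1, - 1 / real (Suc n):]"
    by simp
  ultimately show ?case
    unfolding binom_poly.simps(2)[of "Suc n"] Suc.IH factor
    by (simp only: mult_smult_left mult_smult_right smult_smult mult.assoc)
qed

lemma binom_poly_Suc_square: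
  "binom_poly (Suc n) ^ 2 = smult (1 / real (Suc n) ^ 2) (monom 1 2 * (\<Prod>m=1..n. [:1, - 1 / real m:] ^ 2))"
proof -
  have "((- 1) ^ n / real (Suc n)) ^ 2 = 1 / real (Suc n) ^ 2"
    by (simp add: power_divide flip: power_mult)
  moreover have "monom (1::real) 1 ^ 2 = monom 1 2" by (simp add: monom_power)
  ultimately show ?thesis
    by (simp only: binom_poly_Suc_eq_prod smult_power power_mult_distrib prod_power_distrib)
qed

definition log_power_fps :: "nat \<Rightarrow> complex fps"
  where "log_power_fps j = fps_const (1 / fact j) * fps_ln 1 ^ j"

lemma log_power_fps_deriv: "fps_deriv (log_power_fps (Suc j)) * (1 + fps_X) = log_power_fps j"
proof -
  have "inverse (1 + fps_X) * (1 + fps_X) = (1 :: complex fps)" by (rule inverse_mult_eq_1) simp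
  moreover have "fps_const (1 / fact (Suc j)) * fps_const (of_nat (Suc j)) = (fps_const (1 / fact j) :: complex fps)"
    by (simp add: fps_const_mult del: of_nat_Suc)
  moreover have "fps_deriv (log_power_fps (Suc j)) =
      fps_const (1 / fact (Suc j)) * fps_const (of_nat (Suc j)) * (inverse (1 + fps_X) * fps_ln 1 ^ j)"
    by (simp add: log_power_fps_def fps_deriv_power fps_ln_deriv mult_ac del: power_Suc of_nat_Suc)
  ultimately show ?thesis by (simp add: log_power_fps_def mult_ac)
qed

lemma fps_nth_log_power_fps: "fps_nth (log_power_fps j) n = of_real (coeff (binom_poly n) j)"
proof (induction n arbitrary: j)
  case 0
  show ?case by (cases j) (simp_all add: log_power_fps_def)
next
  case (Suc n)
  show ?case
  proof (cases j)
    case 0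
    have "coeff (binom_poly (Suc n)) 0 = 0" by (simp add: binom_poly_Suc_eq_prod coeff_monom_mult)
    thus ?thesis by (simp add: 0 log_power_fps_def)
  next
    case (Suc i)
    have "real (Suc n) * coeff (binom_poly (Suc n)) (Suc i) + real n * coeff (binom_poly n) (Suc i) =
        coeff (binom_poly n) i"
      using coeff_binom_poly_Suc[of n "Suc i"] by simp
    hence "complex_of_real (real (Suc n) * coeff (binom_poly (Suc n)) (Suc i) +
        real n * coeff (binom_poly n) (Suc i)) =
        of_real (coeff (binom_poly n) i)"
      by (rule arg_cong)
    hence coeff_rec: "of_nat (Suc n) * complex_of_real (coeff (binom_poly (Suc n)) (Suc i)) +
        of_nat n * of_real (coeff (binom_poly n) (Suc i)) = of_real (coeff (binom_poly n) i)"
      by (simp only: of_real_add of_real_mult of_real_of_nat_eq)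
    have fps_rec: "of_nat (Suc n) * fps_nth (log_power_fps (Suc i)) (Suc n) +
        of_nat n * fps_nth (log_power_fps (Suc i)) n = fps_nth (log_power_fps i) n"
      unfolding log_power_fps_deriv[of i, symmetric] by (cases n) (simp_all add: distrib_left)
    have "of_nat (Suc n) * fps_nth (log_power_fps (Suc i)) (Suc n) =
        of_nat (Suc n) * complex_of_real (coeff (binom_poly (Suc n)) (Suc i))"
      using fps_rec[unfolded Suc.IH, folded coeff_rec] by (rule add_right_imp_eq)
    thus ?thesis unfolding Suc by (metis mult_left_cancel of_nat_neq_0)
  qed
qed

lemma norm_less_fps_conv_radius_log_power_fps:
  assumes "norm z < 1"
  shows "ereal (norm z) < fps_conv_radius (log_power_fps j)"
proof -
  have "1 \<le> fps_conv_radius (fps_ln (1::complex) ^ j)"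
    using fps_conv_radius_power[of "fps_ln (1::complex)" j] by simp
  also have "\<dots> = fps_conv_radius (log_power_fps j)"
    unfolding log_power_fps_def by (rule fps_conv_radius_cmult_left[symmetric]) simp
  finally show ?thesis using assms by (metis ereal_less(3) less_le_trans)
qed

lemma eval_log_power_fps:
  assumes "norm z < 1"
  shows "eval_fps (log_power_fps j) z = Ln (1 + z) ^ j / fact j"
proof -
  have radius: "ereal (norm z) < fps_conv_radius (fps_ln (1::complex))"
    using assms by simp
  have "eval_fps (fps_ln 1) z = Ln (1 + z)"
  proof (rule sums_unique2[OF sums_eval_fps[OF radius]])
    have "(- 1) ^ Suc n / of_nat n * z ^ n = fps_nth (fps_ln 1) n * z ^ n" for n
      by (cases n) (simp_all add: fps_ln_nth)
    thus "(\<lambda>n. fps_nth (fps_ln 1) n * z ^ n) sums Ln (1 + z)"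
      using Ln_series[OF assms] by simp
  qed
  moreover have "ereal (norm z) < fps_conv_radius (fps_ln (1::complex) ^ j)"
    using radius fps_conv_radius_power less_le_trans by blast
  ultimately show ?thesis by (simp add: log_power_fps_def eval_fps_mult eval_fps_power[OF radius])
qed

section \<open>The words in the definition of \<open>rho\<close>\<close>

definition one_two_words :: "nat \<Rightarrow> nat list set"
  where "one_two_words j = {A. set A \<subseteq> {1, 2} \<and> sum_list A = j}"

lemma finite_one_two_words [simp]: "finite (one_two_words j)"
proof (rule finite_subset)
  have "length A \<le> sum_list A" if "set A \<subseteq> {1, 2}" for A :: "nat list"
    using that by (induction A) auto
  thus "one_two_words j \<subseteq> {A. set A \<subseteq> {1, 2} \<and> length A \<le> j}" by (auto simp: one_two_words_def)
  show "finite {A :: nat list. set A \<subseteq> {1, 2} \<and> length A \<le> j}" by (rule finite_lists_length_le) auto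
qed

lemma Cons_in_one_two_words_iff:
  "a # A \<in> one_two_words j \<longleftrightarrow> a \<in> {1, 2} \<and> a \<le> j \<and> A \<in> one_two_words (j - a)"
  by (auto simp: one_two_words_def)

lemma one_two_words_0: "one_two_words 0 = {[]}"
proof (intro set_eqI)
  fix A show "A \<in> one_two_words 0 \<longleftrightarrow> A \<in> {[]}"
    by (cases A) (auto simp: one_two_words_def)
qed

lemma one_two_words_rec:
  assumes "j > 0"
  shows "one_two_words j = (\<Union>a\<in>{1, 2} \<inter> {..j}. (#) a ` one_two_words (j - a))"
proof (intro set_eqI)
  fix A
  show "A \<in> one_two_words j \<longleftrightarrow> A \<in> (\<Union>a\<in>{1, 2} \<inter> {..j}. (#) a ` one_two_words (j - a))"
  proof (cases A)
    case Nil
    thus ?thesis using assms by (auto simp: one_two_words_def)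
  qed (auto simp: Cons_in_one_two_words_iff)
qed

lemma sum_one_two_words_rec:
  assumes "j > 0"
  shows "sum f (one_two_words j) = (\<Sum>a\<in>{1, 2} \<inter> {..j}. \<Sum>A\<in>one_two_words (j - a). f (a # A))"
  unfolding one_two_words_rec[OF assms] by (subst sum.UNION_disjoint) (auto simp: sum.reindex)

lemma coeff_mult_linear_square:
  fixes p :: "'a::comm_ring_1 poly"
  assumes "j > 0"
  shows "coeff (p * [:1, - c:] ^ 2) j =
    coeff p j + (\<Sum>a\<in>{1, 2} \<inter> {..j}. (if a = 1 then - 2 * c else c ^ 2) * coeff p (j - a))"
proof -
  have "p * [:1, - c:] ^ 2 = p + pCons 0 (smult (- 2 * c) p) + pCons 0 (pCons 0 (smult (c ^ 2) p))"
    by (simp add: power2_eq_square algebra_simps)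
  moreover have "{1, 2} \<inter> {..Suc 0} = {1::nat}" "{1, 2} \<inter> {..Suc (Suc i)} = {1::nat, 2}" for i by auto
  moreover obtain i where "j = Suc i" using assms by (metis gr0_implies_Suc)
  ultimately show ?thesis by (cases i) simp_all
qed

definition one_two_sum :: "nat \<Rightarrow> nat \<Rightarrow> real"
  where "one_two_sum n j = (\<Sum>A\<in>one_two_words j. 4 ^ length A * (\<Sum>m\<le>n. polylog_coeff (ones A) m))"

lemma one_two_sum_0: "one_two_sum 0 j = (if j = 0 then 1 else 0)"
proof -
  have "4 ^ length A * polylog_coeff (ones A) 0 = (if A = [] then 1 else 0 :: real)" for A
    by (cases A) auto
  moreover have "[] \<in> one_two_words j \<longleftrightarrow> j = 0" by (auto simp: one_two_words_def)
  ultimately show ?thesis by (simp add: one_two_sum_def sum.delta)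
qed

lemma one_two_sum_weight_0: "one_two_sum n 0 = 1"
  by (simp add: one_two_sum_def one_two_words_0 sum.delta)

lemma one_two_sum_Suc:
  assumes "j > 0"
  shows "one_two_sum (Suc n) j =
    one_two_sum n j + (\<Sum>a\<in>{1, 2} \<inter> {..j}. 4 / real (Suc n) ^ a * one_two_sum n (j - a))"
proof -
  define S where "S n A = 4 ^ length A * (\<Sum>m\<le>n. polylog_coeff (ones A) m :: real)" for n A
  have S_Cons: "S (Suc n) (a # A) = S n (a # A) + 4 / real (Suc n) ^ a * S n A" for a A
    by (simp add: S_def distrib_left lessThan_Suc_atMost)
  have sum_eq: "one_two_sum n j = sum (S n) (one_two_words j)" for n j
    by (simp add: one_two_sum_def S_def)
  show ?thesis
    unfolding sum_eq sum_one_two_words_rec[OF assms] S_Cons sum.distrib sum_distrib_left ..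
qed

lemma coeff_prod_linear_square:
  "coeff (\<Prod>m=1..n. [:1, - 1 / real m:] ^ 2) j = (- 1 / 2) ^ j * one_two_sum n j"
proof (induction n arbitrary: j)
  case 0
  show ?case by (simp add: one_two_sum_0 coeff_1)
next
  case (Suc n)
  define P where "P = (\<Prod>m=1..n. [:1, - 1 / real m:] ^ 2)"
  have IH: "coeff P j = (- 1 / 2) ^ j * one_two_sum n j" for j
    using Suc.IH by (simp add: P_def)
  have prod: "(\<Prod>m=1..Suc n. [:1, - 1 / real m:] ^ 2) = P * [:1, - (1 / real (Suc n)):] ^ 2"
    by (simp add: P_def)
  show ?case
  proof (cases "j = 0")
    case True
    thus ?thesis
      unfolding prod using IH[of 0] by (simp add: coeff_mult power2_eq_square one_two_sum_weight_0)
  next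
    case False
    have "(if a = 1 then - 2 * (1 / real (Suc n)) else (1 / real (Suc n)) ^ 2) * coeff P (j - a) =
        (- 1 / 2) ^ j * (4 / real (Suc n) ^ a * one_two_sum n (j - a))"
      if "a \<in> {1, 2} \<inter> {..j}" for a
    proof -
      have "(- 1 / 2 :: real) ^ j = (- 1 / 2) ^ a * (- 1 / 2) ^ (j - a)"
        using that by (simp flip: power_add)
      thus ?thesis using that by (auto simp: IH power2_eq_square simp del: of_nat_Suc)
    qed
    thus ?thesis
      unfolding prod using False
      by (simp add: coeff_mult_linear_square one_two_sum_Suc IH distrib_left sum_distrib_left del: of_nat_Suc)
  qed
qed

definition rho_words :: "nat \<Rightarrow> nat list set"
  where "rho_words k = (if k = 0 then {[]} else rho_indices k)"

lemma rho_words_Suc_0: "rho_words (Suc 0) = {}"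
proof -
  have "sum_list A \<ge> 2" if "A \<noteq> []" "hd A = 2" for A :: "nat list"
    using that by (cases A) auto
  thus ?thesis by (force simp: rho_words_def rho_indices_def)
qed

lemma rho_words_Suc_Suc: "rho_words (Suc (Suc k)) = (#) 2 ` one_two_words k"
proof (intro set_eqI)
  fix A show "A \<in> rho_words (Suc (Suc k)) \<longleftrightarrow> A \<in> (#) 2 ` one_two_words k"
    by (cases A) (auto simp: rho_words_def rho_indices_def one_two_words_def)
qed

lemma finite_rho_words [simp]: "finite (rho_words k)"
proof -
  consider "k = 0" | "k = Suc 0" | j where "k = Suc (Suc j)" by (metis not0_implies_Suc)
  thus ?thesis by cases (simp_all add: rho_words_def[of 0] rho_words_Suc_0 rho_words_Suc_Suc)
qed

lemma rho_wordsD: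
  assumes "A \<in> rho_words k"
  shows "0 \<notin> set A" "A = [] \<or> hd A \<ge> 2" "sum_list A = k" "k > 0 \<Longrightarrow> A \<noteq> []"
  using assms by (cases A; auto simp: rho_words_def rho_indices_def split: if_splits)+

lemma rho_eq_sum_polylog:
  assumes "0 \<le> X" "X < 1"
  shows "rho k X = (- 1) ^ k * fact k / 4 ^ k * (\<Sum>A\<in>rho_words k. 4 ^ length A * polylog (ones A) (X ^ 2))"
proof -
  have sq: "0 \<le> X ^ 2" "X ^ 2 < 1" using assms by (auto simp: power_less_one_iff)
  consider "k = 0" | "k = 1" | "k \<ge> 2" by linarith
  thus ?thesis
  proof cases
    case 3
    have "4 ^ length A * multi_L A (X ^ 2) = 4 ^ length A * polylog (ones A) (X ^ 2)" if "A \<in> rho_words k" for A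
      using multi_L_eq_polylog[OF _ _ sq, of A] rho_wordsD[OF that] 3 by simp
    moreover have "rho_words k = rho_indices k" using 3 by (simp add: rho_words_def)
    ultimately show ?thesis using 3 by (simp add: rho_def)
  qed (simp_all add: rho_def rho_words_def[of 0] rho_words_Suc_0)
qed

lemma coeff_binom_poly_square:
  "coeff (binom_poly n ^ 2) k = (- 1 / 2) ^ k * (\<Sum>A\<in>rho_words k. 4 ^ length A * polylog_coeff (ones A) n)"
proof (cases n)
  case 0
  have "4 ^ length A * polylog_coeff (ones A) n = (if A = [] then 1 else 0 :: real)" for A
    using 0 by (cases A) auto
  moreover have "[] \<in> rho_words k \<longleftrightarrow> k = 0" by (auto simp: rho_words_def rho_indices_def)
  ultimately show ?thesis by (simp add: 0 coeff_1 sum.delta)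
next
  case (Suc m)
  have lhs: "coeff (binom_poly n ^ 2) k =
      (if k < 2 then 0 else 1 / real n ^ 2 * coeff (\<Prod>i=1..m. [:1, - 1 / real i:] ^ 2) (k - 2))"
    unfolding Suc binom_poly_Suc_square by (simp add: coeff_monom_mult)
  consider "k = 0" | "k = Suc 0" | j where "k = Suc (Suc j)" by (metis not0_implies_Suc)
  thus ?thesis
  proof cases
    case 3
    have "(\<Sum>A\<in>rho_words k. 4 ^ length A * polylog_coeff (ones A) n) =
        4 / real n ^ 2 * one_two_sum m j"
      by (simp add: one_two_sum_def 3 rho_words_Suc_Suc sum.reindex Suc lessThan_Suc_atMost sum_distrib_left mult_ac)
    thus ?thesis unfolding lhs coeff_prod_linear_square by (simp add: 3 power2_eq_square)
  qed (use lhs Suc in \<open>simp_all add: rho_words_def[of 0] rho_words_Suc_0\<close>)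
qed

section \<open>Mean values on the unit circle\<close>

abbreviation unit_interval :: "real measure"
  where "unit_interval \<equiv> restrict_space lborel {0..1}"

interpretation unit_interval: finite_measure unit_interval
  by (intro finite_measureI) (simp add: emeasure_restrict_space space_restrict_space)

lemma measure_unit_interval [simp]: "measure unit_interval {0..1} = 1"
  by (simp add: measure_restrict_space)

lemma integral_unit_interval: "integral\<^sup>L unit_interval f = (LBINT x:{0..1}. f x)"
  for f :: "real \<Rightarrow> 'a::{banach, second_countable_topology}"
  by (subst integral_restrict_space) (auto simp: set_lebesgue_integral_def)

lemma integrable_unit_interval_continuous:
  fixes f :: "real \<Rightarrow> 'a::{banach, second_countable_topology}"
  assumes "continuous_on {0..1} f"
  shows "integrable unit_interval f"
  using borel_integrable_atLeastAtMost'[OF assms]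
  by (subst integrable_restrict_space) (auto simp: set_integrable_def)

lemma sums_integral_unit_interval:
  fixes u :: "nat \<Rightarrow> real \<Rightarrow> 'a::{banach, second_countable_topology}"
  assumes "\<And>n. continuous_on {0..1} (u n)"
    and bound: "\<And>n t. t \<in> {0..1} \<Longrightarrow> norm (u n t) \<le> B n" and "summable B"
  shows "(\<lambda>n. integral\<^sup>L unit_interval (u n)) sums (\<integral>t. suminf (\<lambda>n. u n t) \<partial>unit_interval)"
proof (rule sums_integral)
  show integrable: "integrable unit_interval (u n)" for n
    by (rule integrable_unit_interval_continuous[OF assms(1)])
  show "AE t in unit_interval. summable (\<lambda>n. norm (u n t))"
    using bound by (intro AE_I2 summable_comparison_test'[OF \<open>summable B\<close>]) (auto simp: space_restrict_space)
  show "summable (\<lambda>n. \<integral>t. norm (u n t) \<partial>unit_interval)"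
  proof (rule summable_comparison_test'[OF \<open>summable B\<close>])
    fix n :: nat
    have "(\<integral>t. norm (u n t) \<partial>unit_interval) \<le> (\<integral>t. B n \<partial>unit_interval)"
      using bound by (intro integral_mono integrable_norm integrable) (auto simp: space_restrict_space)
    thus "norm (\<integral>t. norm (u n t) \<partial>unit_interval) \<le> B n" by simp
  qed
qed

definition e2pi :: "real \<Rightarrow> complex" where "e2pi t = cis (2 * pi * t)"

lemma continuous_on_e2pi [continuous_intros]: "continuous_on A f \<Longrightarrow> continuous_on A (\<lambda>x. e2pi (f x))"
  unfolding e2pi_def by (intro continuous_intros)

lemma norm_e2pi [simp]: "norm (e2pi t) = 1" by (simp add: e2pi_def)

lemma e2pi_times_cnj [simp]: "e2pi t * cnj (e2pi t) = 1"
  by (simp add: e2pi_def cis_cnj cis_mult)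

lemma integral_cis_int:
  assumes "k \<noteq> 0"
  shows "(LBINT t:{0..1}. cis (2 * pi * of_int k * t)) = 0"
proof -
  define c where "c = 2 * \<i> * of_real pi * of_int k"
  define G where "G t = exp (c * of_real t) / c" for t :: real
  have cis: "cis (2 * pi * of_int k * t) = exp (c * of_real t)" for t
    by (simp add: cis_conv_exp c_def mult_ac)
  have "(LBINT t. indicator {0..1} t *\<^sub>R exp (c * of_real t)) = G 1 - G 0"
  proof (rule integral_FTC_atLeastAtMost)
    fix t :: real
    have "c \<noteq> 0" using assms by (simp add: c_def)
    hence "((\<lambda>z. exp (c * z) / c) has_field_derivative exp (c * of_real t)) (at (of_real t))"
      by (auto intro!: derivative_eq_intros)
    hence "(G has_vector_derivative exp (c * of_real t)) (at t)"
      unfolding G_def[abs_def] by (rule has_vector_derivative_real_field)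
    thus "(G has_vector_derivative exp (c * of_real t)) (at t within {0..1})"
      by (rule has_vector_derivative_at_within)
  qed (auto intro!: continuous_intros)
  also have "exp c = 1"
    unfolding c_def exp_eq_1 by (auto intro!: exI[of _ k])
  hence "G 1 - G 0 = 0" by (simp add: G_def)
  finally show ?thesis by (simp add: cis set_lebesgue_integral_def)
qed

lemma integral_e2pi_power:
  "(\<integral>t. e2pi t ^ m * cnj (e2pi t) ^ n \<partial>unit_interval) = (if m = n then 1 else 0)"
proof (cases "m = n")
  case True
  thus ?thesis by (simp flip: power_mult_distrib)
next
  case False
  have "e2pi t ^ m * cnj (e2pi t) ^ n = cis (2 * pi * of_int (int m - int n) * t)" for t
    unfolding e2pi_def cis_cnj Complex.DeMoivre cis_mult by (simp add: algebra_simps)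
  thus ?thesis using integral_cis_int[of "int m - int n"] False
    by (simp only: integral_unit_interval) simp
qed

lemma integral_eval_fps_e2pi:
  assumes radius: "ereal (norm a) < fps_conv_radius f"
  shows "(\<integral>t. eval_fps f (a * e2pi t) * cnj (e2pi t) ^ n \<partial>unit_interval) = fps_nth f n * a ^ n"
proof -
  define u where "u m t = fps_nth f m * (a * e2pi t) ^ m * cnj (e2pi t) ^ n" for m t
  have "(\<lambda>m. integral\<^sup>L unit_interval (u m)) sums (\<integral>t. suminf (\<lambda>m. u m t) \<partial>unit_interval)"
  proof (rule sums_integral_unit_interval)
    show "continuous_on {0..1} (u m)" for m unfolding u_def by (intro continuous_intros)
    show "norm (u m t) \<le> norm (fps_nth f m * a ^ m)" for m t
      by (simp add: u_def norm_mult norm_power)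
    show "summable (\<lambda>m. norm (fps_nth f m * a ^ m))" by (rule norm_summable_fps[OF radius])
  qed
  moreover have "integral\<^sup>L unit_interval (u m) = (if m = n then fps_nth f n * a ^ n else 0)" for m
  proof -
    have "u m = (\<lambda>t. fps_nth f m * a ^ m * (e2pi t ^ m * cnj (e2pi t) ^ n))"
      by (simp add: u_def fun_eq_iff power_mult_distrib mult_ac)
    thus ?thesis by (simp add: integral_e2pi_power)
  qed
  moreover have "suminf (\<lambda>m. u m t) = eval_fps f (a * e2pi t) * cnj (e2pi t) ^ n" for t
    unfolding u_def eval_fps_def
    using radius by (intro suminf_mult2[symmetric] summable_fps) (simp add: norm_mult)
  ultimately have "(\<lambda>m. if m = n then fps_nth f n * a ^ n else 0) sums
      (\<integral>t. eval_fps f (a * e2pi t) * cnj (e2pi t) ^ n \<partial>unit_interval)"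
    by simp
  from sums_unique2[OF this sums_single[of n "\<lambda>_. fps_nth f n * a ^ n"]] show ?thesis .
qed

lemma continuous_on_eval_fps_e2pi [continuous_intros]:
  "ereal (norm a) < fps_conv_radius f \<Longrightarrow> continuous_on A (\<lambda>t. eval_fps f (a * e2pi t))"
  by (intro continuous_intros) (auto simp: in_eball_iff norm_mult)

lemma parseval_eval_fps:
  assumes radius: "ereal (norm a) < fps_conv_radius f" "ereal (norm a) < fps_conv_radius g"
  shows "(\<lambda>n. fps_nth f n * cnj (fps_nth g n) * of_real (norm a ^ 2) ^ n) sums
    (\<integral>t. eval_fps f (a * e2pi t) * cnj (eval_fps g (a * e2pi t)) \<partial>unit_interval)"
proof -
  define u where "u n t = eval_fps f (a * e2pi t) * cnj (fps_nth g n * (a * e2pi t) ^ n)" for n t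
  have cont: "continuous_on {0..1} (\<lambda>t. eval_fps f (a * e2pi t))" by (intro continuous_intros radius)
  hence "compact ((\<lambda>t. eval_fps f (a * e2pi t)) ` {0..1})" by (rule compact_continuous_image) simp
  then obtain M where M: "\<And>t. t \<in> {0..1} \<Longrightarrow> norm (eval_fps f (a * e2pi t)) \<le> M"
    by (metis bounded_iff compact_imp_bounded imageI)
  have "(\<lambda>n. integral\<^sup>L unit_interval (u n)) sums (\<integral>t. suminf (\<lambda>n. u n t) \<partial>unit_interval)"
  proof (rule sums_integral_unit_interval)
    show "continuous_on {0..1} (u n)" for n unfolding u_def by (intro continuous_intros radius)
    show "norm (u n t) \<le> M * norm (fps_nth g n * a ^ n)" if "t \<in> {0..1}" for n t
      using mult_right_mono[OF M[OF that], of "norm (fps_nth g n * a ^ n)"]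
      by (simp add: u_def norm_mult norm_power)
    show "summable (\<lambda>n. M * norm (fps_nth g n * a ^ n))"
      by (intro summable_mult norm_summable_fps radius)
  qed
  moreover have "integral\<^sup>L unit_interval (u n) = fps_nth f n * cnj (fps_nth g n) * of_real (norm a ^ 2) ^ n" for n
  proof -
    have "u n = (\<lambda>t. cnj (fps_nth g n * a ^ n) * (eval_fps f (a * e2pi t) * cnj (e2pi t) ^ n))"
      by (simp add: u_def fun_eq_iff power_mult_distrib mult_ac)
    hence "integral\<^sup>L unit_interval (u n) = cnj (fps_nth g n * a ^ n) * (fps_nth f n * a ^ n)"
      by (simp add: integral_eval_fps_e2pi[OF radius(1)])
    also have "\<dots> = fps_nth f n * cnj (fps_nth g n) * (a * cnj a) ^ n"
      by (simp add: power_mult_distrib mult_ac)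
    finally show ?thesis by (simp only: complex_norm_square)
  qed
  moreover have "suminf (\<lambda>n. u n t) = eval_fps f (a * e2pi t) * cnj (eval_fps g (a * e2pi t))" for t
  proof -
    have "(\<lambda>n. fps_nth g n * (a * e2pi t) ^ n) sums eval_fps g (a * e2pi t)"
      using radius(2) by (intro sums_eval_fps) (simp add: norm_mult)
    hence "(\<lambda>n. u n t) sums (eval_fps f (a * e2pi t) * cnj (eval_fps g (a * e2pi t)))"
      unfolding u_def by (intro sums_mult) (simp only: sums_cnj)
    thus ?thesis by (rule sums_unique[symmetric])
  qed
  ultimately show ?thesis by simp
qed

lemma ln_norm_power_eq_sum:
  assumes "norm z < 1"
  shows "complex_of_real (ln (norm (1 + z)) ^ k) = fact k / 2 ^ k *
    (\<Sum>j\<le>k. eval_fps (log_power_fps j) z * cnj (eval_fps (log_power_fps (k - j)) z))"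
proof -
  define l where "l = Ln (1 + z)"
  have "1 + z \<noteq> 0" using assms by (metis add_eq_0_iff norm_minus_cancel norm_one less_irrefl)
  hence "complex_of_real (ln (norm (1 + z))) = (l + cnj l) / 2"
    by (simp add: l_def complex_add_cnj)
  hence "complex_of_real (ln (norm (1 + z)) ^ k) = (\<Sum>j\<le>k. of_nat (k choose j) * l ^ j * cnj l ^ (k - j)) / 2 ^ k"
    by (simp only: of_real_power power_divide binomial_ring)
  also have "(\<Sum>j\<le>k. of_nat (k choose j) * l ^ j * cnj l ^ (k - j)) =
      (\<Sum>j\<le>k. fact k * (l ^ j / fact j * cnj (l ^ (k - j) / fact (k - j))))"
    by (rule sum.cong) (simp_all add: binomial_fact)
  also have "\<dots> = fact k * (\<Sum>j\<le>k. l ^ j / fact j * cnj (l ^ (k - j) / fact (k - j)))"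
    by (rule sum_distrib_left[symmetric])
  finally show ?thesis by (simp add: eval_log_power_fps[OF assms] flip: l_def)
qed

lemma integral_log_power_products:
  assumes "norm a < 1"
  shows "(\<integral>t. (\<Sum>j\<le>k. eval_fps (log_power_fps j) (a * e2pi t) * cnj (eval_fps (log_power_fps (k - j)) (a * e2pi t)))
      \<partial>unit_interval) =
    of_real ((- 1 / 2) ^ k * (\<Sum>A\<in>rho_words k. 4 ^ length A * polylog (ones A) (norm a ^ 2)))"
    (is "?I = of_real ?R")
proof (rule sums_unique2)
  have radius: "ereal (norm a) < fps_conv_radius (log_power_fps j)" for j
    by (rule norm_less_fps_conv_radius_log_power_fps[OF assms])
  have "(\<lambda>n. \<Sum>j\<le>k. fps_nth (log_power_fps j) n * cnj (fps_nth (log_power_fps (k - j)) n) * of_real (norm a ^ 2) ^ n)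
      sums (\<Sum>j\<le>k. \<integral>t. eval_fps (log_power_fps j) (a * e2pi t) * cnj (eval_fps (log_power_fps (k - j)) (a * e2pi t))
        \<partial>unit_interval)"
    by (intro sums_sum parseval_eval_fps radius)
  moreover have "(\<Sum>j\<le>k. fps_nth (log_power_fps j) n * cnj (fps_nth (log_power_fps (k - j)) n) *
        of_real (norm a ^ 2) ^ n) =
      of_real (coeff (binom_poly n ^ 2) k * (norm a ^ 2) ^ n)" for n
    by (simp add: fps_nth_log_power_fps power2_eq_square[of "binom_poly n"] coeff_mult flip: sum_distrib_right)
  ultimately show "(\<lambda>n. complex_of_real (coeff (binom_poly n ^ 2) k * (norm a ^ 2) ^ n)) sums ?I"
    by (subst Bochner_Integration.integral_sum)
      (auto intro!: integrable_unit_interval_continuous continuous_intros radius)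
  have "norm (norm a ^ 2) < 1" using assms by (simp add: power_less_one_iff)
  hence "(\<lambda>n. \<Sum>A\<in>rho_words k. 4 ^ length A * (polylog_coeff (ones A) n * (norm a ^ 2) ^ n)) sums
      (\<Sum>A\<in>rho_words k. 4 ^ length A * polylog (ones A) (norm a ^ 2))"
    by (intro sums_sum sums_mult polylog_sums) (auto dest: rho_wordsD(1))
  from sums_mult[OF this, of "(- 1 / 2) ^ k"]
  have "(\<lambda>n. coeff (binom_poly n ^ 2) k * (norm a ^ 2) ^ n) sums ?R"
    by (simp add: coeff_binom_poly_square sum_distrib_right mult.assoc)
  thus "(\<lambda>n. complex_of_real (coeff (binom_poly n ^ 2) k * (norm a ^ 2) ^ n)) sums of_real ?R"
    by (rule sums_of_real)
qed

lemma integral_ln_norm_power: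
  assumes "norm a < 1"
  shows "(\<integral>t. ln (norm (1 + a * e2pi t)) ^ k \<partial>unit_interval) = rho k (norm a)"
proof -
  have "complex_of_real (\<integral>t. ln (norm (1 + a * e2pi t)) ^ k \<partial>unit_interval) =
      (\<integral>t. complex_of_real (ln (norm (1 + a * e2pi t)) ^ k) \<partial>unit_interval)"
    by (rule integral_complex_of_real[symmetric])
  also have "\<dots> = (\<integral>t. fact k / 2 ^ k * (\<Sum>j\<le>k. eval_fps (log_power_fps j) (a * e2pi t) *
      cnj (eval_fps (log_power_fps (k - j)) (a * e2pi t))) \<partial>unit_interval)"
    using assms by (simp only: ln_norm_power_eq_sum norm_mult norm_e2pi mult_1_right)
  also have "\<dots> = of_real (fact k / 2 ^ k * ((- 1 / 2) ^ k *
      (\<Sum>A\<in>rho_words k. 4 ^ length A * polylog (ones A) (norm a ^ 2))))"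
    by (simp only: integral_mult_right_zero integral_log_power_products[OF assms]) simp
  also have "fact k / 2 ^ k * ((- 1 / 2) ^ k * (\<Sum>A\<in>rho_words k. 4 ^ length A * polylog (ones A) (norm a ^ 2))) =
      rho k (norm a)"
  proof -
    have "(4::real) ^ k = 2 ^ k * 2 ^ k" by (simp flip: power_mult_distrib)
    hence "fact k / 2 ^ k * (- 1 / 2) ^ k = ((- 1) ^ k * fact k / 4 ^ k :: real)"
      unfolding power_divide by simp
    thus ?thesis using assms by (simp only: rho_eq_sum_polylog[OF norm_ge_zero] flip: mult.assoc)
  qed
  finally show ?thesis by (simp only: of_real_eq_iff)
qed

section \<open>Integrals of \<open>rho\<close>\<close>

locale rho_integrand =
  fixes a b :: real and f g :: "real \<Rightarrow> real" and C :: real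
  assumes f: "continuous_on {a<..<b} f" "\<And>x. a < x \<Longrightarrow> x < b \<Longrightarrow> 0 \<le> f x" "\<And>x. a < x \<Longrightarrow> x < b \<Longrightarrow> f x < 1"
    and g: "continuous_on {a<..<b} g" "\<And>x. a < x \<Longrightarrow> x < b \<Longrightarrow> \<bar>g x\<bar> \<le> C"
begin

lemma set_integrable_word:
  assumes "A \<in> rho_words k"
  shows "set_integrable lborel {a..b} (\<lambda>x. polylog (ones A) (f x ^ 2) * g x)"
proof (rule set_integrable_polylog_ones[OF rho_wordsD(1,2)[OF assms] _ _ g])
  show "continuous_on {a<..<b} (\<lambda>x. f x ^ 2)" by (intro continuous_intros f(1))
  show "\<bar>f x ^ 2\<bar> < 1" if "a < x" "x < b" for x
    using f(2,3)[OF that] by (simp add: power_less_one_iff)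
qed

lemma rho_times_eq_sum:
  assumes "a < x" "x < b"
  shows "rho k (f x) * g x =
    (\<Sum>A\<in>rho_words k. (- 1) ^ k * fact k / 4 ^ k * 4 ^ length A * (polylog (ones A) (f x ^ 2) * g x))"
  unfolding rho_eq_sum_polylog[OF f(2,3)[OF assms]] sum_distrib_left sum_distrib_right
  by (simp only: mult.assoc)

lemma set_integrable_rho: "set_integrable lborel {a..b} (\<lambda>x. rho k (f x) * g x)"
  using set_integral_sum_scale(1)[OF set_integrable_word[of _ k]]
  by (subst set_integrable_cong_Ioo[OF rho_times_eq_sum])

lemma integral_rho_in_times_MPL_space:
  assumes "\<And>A. A \<in> rho_words k \<Longrightarrow>
    complex_of_real (LBINT x:{a..b}. polylog (ones A) (f x ^ 2) * g x) \<in> (*) c ` MPL_space n N"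
  shows "complex_of_real (LBINT x:{a..b}. rho k (f x) * g x) \<in> (*) c ` MPL_space n N"
proof -
  define q :: "nat list \<Rightarrow> rat" where "q A = (- 1) ^ k * fact k / 4 ^ k * 4 ^ length A" for A
  have "(LBINT x:{a..b}. rho k (f x) * g x) = (LBINT x:{a..b}.
      (\<Sum>A\<in>rho_words k. (- 1) ^ k * fact k / 4 ^ k * 4 ^ length A * (polylog (ones A) (f x ^ 2) * g x)))"
    by (rule set_integral_cong_Ioo[OF rho_times_eq_sum])
  also have "\<dots> = (\<Sum>A\<in>rho_words k. (- 1) ^ k * fact k / 4 ^ k * 4 ^ length A *
      (LBINT x:{a..b}. polylog (ones A) (f x ^ 2) * g x))"
    by (rule set_integral_sum_scale(2)[OF set_integrable_word])
  finally have "complex_of_real (LBINT x:{a..b}. rho k (f x) * g x) =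
      (\<Sum>A\<in>rho_words k. of_rat (q A) * of_real (LBINT x:{a..b}. polylog (ones A) (f x ^ 2) * g x))"
    by (simp add: q_def of_rat_fact of_rat_mult of_rat_divide of_rat_power of_rat_minus)
  also have "\<dots> \<in> (*) c ` MPL_space n N"
    by (intro rat_complex.subspace_sum rat_complex.subspace_scale subspace_times_MPL_space assms)
  finally show ?thesis .
qed

end

interpretation small_angles: rho_integrand 0 "pi / 6" "\<lambda>\<theta>. 2 * sin \<theta>" "\<lambda>_. 1" 1
proof
  fix \<theta> :: real assume "0 < \<theta>" "\<theta> < pi / 6"
  from sin_cos_less_pi_6[OF this] show "0 \<le> 2 * sin \<theta>" "2 * sin \<theta> < 1" by auto
qed (auto intro!: continuous_intros)

interpretation large_angles: rho_integrand "pi / 6" "pi / 2" "\<lambda>\<theta>. 1 / (2 * sin \<theta>)" "\<lambda>\<theta>. ln (2 * sin \<theta>) ^ m" 1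
  for m
proof
  have sin: "1 / 2 < sin \<theta>" if "\<theta> \<in> {pi/6<..<pi/2}" for \<theta>
    using sin_cos_greater_pi_6(1) that by simp
  show "continuous_on {pi/6<..<pi/2} (\<lambda>\<theta>. 1 / (2 * sin \<theta>))"
    "continuous_on {pi/6<..<pi/2} (\<lambda>\<theta>. ln (2 * sin \<theta>) ^ m)"
    by (intro continuous_intros; use sin in force)+
  fix \<theta> :: real assume \<theta>: "pi / 6 < \<theta>" "\<theta> < pi / 2"
  from sin_cos_greater_pi_6(1)[OF \<theta>] show "0 \<le> 1 / (2 * sin \<theta>)" "1 / (2 * sin \<theta>) < 1" by auto
  show "\<bar>ln (2 * sin \<theta>) ^ m\<bar> \<le> 1"
    using abs_ln_double_sin_le_1[OF \<theta>] by (simp add: power_abs power_le_one)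
qed

lemma integral_rho_small_angles_in_MPL_space:
  "complex_of_real (LBINT \<theta>:{0..pi/6}. rho k (2 * sin \<theta>)) \<in> (*) \<i> ` MPL_space (k + 1) 3"
  using small_angles.integral_rho_in_times_MPL_space[of k] integral_polylog_small_angles
  by (force dest: rho_wordsD)

lemma integral_rho_large_angles_in_MPL_space:
  assumes "j \<le> k"
  shows "complex_of_real (LBINT \<theta>:{pi/6..pi/2}. rho j (1 / (2 * sin \<theta>)) * ln (2 * sin \<theta>) ^ (k - j))
    \<in> (*) \<i> ` MPL_space (k + 1) 3"
proof (rule large_angles.integral_rho_in_times_MPL_space)
  fix A assume "A \<in> rho_words j"
  from rho_wordsD(1-3)[OF this] integral_polylog_large_angles[of A "k - j"] assms
  show "complex_of_real (LBINT \<theta>:{pi/6..pi/2}. polylog (ones A) ((1 / (2 * sin \<theta>)) ^ 2) * ln (2 * sin \<theta>) ^ (k - j))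
    \<in> (*) \<i> ` MPL_space (k + 1) 3" by simp
qed

section \<open>The mean of a power of \<open>log \<bar>b + z\<bar>\<close>\<close>

definition log_mean :: "nat \<Rightarrow> real \<Rightarrow> real"
  where "log_mean k r = (if r < 1 then rho k r
    else (\<Sum>j=0..k. real (k choose j) * (rho j (1 / r) * ln r ^ (k - j))))"

lemma one_plus_times_e2pi_nonzero:
  assumes "norm a < 1"
  shows "1 + a * e2pi t \<noteq> 0"
  using assms by (metis add_eq_0_iff norm_minus_cancel norm_one less_irrefl norm_mult norm_e2pi mult.right_neutral)

lemma integrable_ln_norm_power:
  assumes "norm a < 1"
  shows "integrable unit_interval (\<lambda>t. ln (norm (1 + a * e2pi t)) ^ k)"
  using one_plus_times_e2pi_nonzero[OF assms]
  by (intro integrable_unit_interval_continuous continuous_intros) auto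

lemma norm_add_e2pi: "norm (b + e2pi t) = norm (1 + cnj b * e2pi t)"
proof -
  have "norm (b + e2pi t) = norm (cnj (b + e2pi t) * e2pi t)" by (simp add: norm_mult del: complex_cnj_add)
  also have "cnj (b + e2pi t) * e2pi t = 1 + cnj b * e2pi t"
    by (simp add: distrib_right mult.commute[of "cnj (e2pi t)"])
  finally show ?thesis .
qed

lemma ln_norm_add_e2pi_power:
  assumes "norm b > 1"
  shows "ln (norm (b + e2pi t)) ^ k =
    (\<Sum>j=0..k. real (k choose j) * ln (norm b) ^ (k - j) * ln (norm (1 + 1 / b * e2pi t)) ^ j)"
proof -
  have "b \<noteq> 0" "norm (1 / b) < 1" using assms by (auto simp: norm_divide divide_less_eq)
  note nonzero = this(1) one_plus_times_e2pi_nonzero[OF this(2), of t]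
  have "b + e2pi t = b * (1 + 1 / b * e2pi t)" using nonzero by (simp add: field_simps)
  hence "ln (norm (b + e2pi t)) = ln (norm (1 + 1 / b * e2pi t)) + ln (norm b)"
    using nonzero by (simp add: norm_mult ln_mult)
  thus ?thesis by (simp add: binomial_ring atMost_atLeast0 mult_ac)
qed

lemma has_bochner_integral_ln_norm_add_e2pi:
  assumes "norm b \<noteq> 1"
  shows "has_bochner_integral unit_interval (\<lambda>t. ln (norm (b + e2pi t)) ^ k) (log_mean k (norm b))"
proof (cases "norm b < 1")
  case True
  thus ?thesis
    unfolding norm_add_e2pi
    by (simp add: has_bochner_integral_iff integrable_ln_norm_power integral_ln_norm_power log_mean_def)
next
  case False
  hence b: "norm b > 1" using assms by simp
  hence "norm (1 / b) < 1" by (auto simp: norm_divide divide_less_eq)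
  hence "has_bochner_integral unit_interval (\<lambda>t. ln (norm (1 + 1 / b * e2pi t)) ^ j) (rho j (1 / norm b))" for j
    using integrable_ln_norm_power[of "1 / b"] integral_ln_norm_power[of "1 / b"]
    by (simp add: has_bochner_integral_iff norm_divide)
  hence "has_bochner_integral unit_interval (\<lambda>t. ln (norm (b + e2pi t)) ^ k)
      (\<Sum>j=0..k. real (k choose j) * ln (norm b) ^ (k - j) * rho j (1 / norm b))"
    unfolding ln_norm_add_e2pi_power[OF b]
    by (intro has_bochner_integral_sum has_bochner_integral_mult_right)
  thus ?thesis using False by (simp add: log_mean_def mult_ac)
qed

lemma rho_bounded: "\<exists>B\<ge>0. \<forall>X. 0 \<le> X \<longrightarrow> X < 1 \<longrightarrow> \<bar>rho k X\<bar> \<le> B"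
proof -
  have "\<exists>B. \<forall>x::real. norm x < 1 \<longrightarrow> norm (polylog (ones A) x) \<le> B" if "A \<in> rho_words k" for A
    using polylog_ones_bounded[OF rho_wordsD(1,2)[OF that]] by metis
  then obtain B where B: "\<And>A x::real. A \<in> rho_words k \<Longrightarrow> norm x < 1 \<Longrightarrow> norm (polylog (ones A) x) \<le> B A"
    by metis
  have bound: "\<bar>rho k X\<bar> \<le> fact k / 4 ^ k * (\<Sum>A\<in>rho_words k. 4 ^ length A * B A)" if X: "0 \<le> X" "X < 1" for X
  proof -
    have "norm (X ^ 2) < 1" using X by (simp add: power_less_one_iff)
    hence "\<bar>\<Sum>A\<in>rho_words k. 4 ^ length A * polylog (ones A) (X ^ 2)\<bar> \<le> (\<Sum>A\<in>rho_words k. 4 ^ length A * B A)"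
      using B by (intro order_trans[OF sum_abs] sum_mono) (auto simp: abs_mult)
    thus ?thesis unfolding rho_eq_sum_polylog[OF X]
      by (simp add: abs_mult power_abs mult_left_mono divide_right_mono)
  qed
  moreover have "0 \<le> fact k / 4 ^ k * (\<Sum>A\<in>rho_words k. 4 ^ length A * B A)"
    using order_trans[OF abs_ge_zero bound[of 0]] by simp
  ultimately show ?thesis by blast
qed

lemma log_mean_bounded: "\<exists>B. \<forall>r. 0 \<le> r \<longrightarrow> r \<le> 2 \<longrightarrow> r \<noteq> 1 \<longrightarrow> \<bar>log_mean k r\<bar> \<le> B"
proof -
  obtain B where B: "\<And>j. B j \<ge> 0" "\<And>j X. 0 \<le> X \<Longrightarrow> X < 1 \<Longrightarrow> \<bar>rho j X\<bar> \<le> B j"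
    using rho_bounded by metis
  define C where "C = (\<Sum>j=0..k. real (k choose j) * (B j * 1 ^ (k - j)))"
  have "C \<ge> 0" unfolding C_def using B(1) by (intro sum_nonneg) auto
  have "\<bar>log_mean k r\<bar> \<le> B k + C" if r: "0 \<le> r" "r \<le> 2" "r \<noteq> 1" for r
  proof (cases "r < 1")
    case True
    thus ?thesis using B(2)[of r k] r \<open>C \<ge> 0\<close> by (simp add: log_mean_def)
  next
    case False
    hence "r > 1" using r by simp
    have "\<bar>ln r\<bar> \<le> 1" using ln_le_minus_one[of r] ln_ge_zero[of r] r \<open>r > 1\<close> by auto
    have "\<bar>log_mean k r\<bar> \<le> (\<Sum>j=0..k. \<bar>real (k choose j) * (rho j (1 / r) * ln r ^ (k - j))\<bar>)"
      using False by (simp add: log_mean_def sum_abs)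
    also have "\<dots> \<le> C"
      unfolding C_def abs_mult power_abs using \<open>r > 1\<close> \<open>\<bar>ln r\<bar> \<le> 1\<close> B
      by (intro sum_mono mult_mono power_mono) auto
    finally show ?thesis using B(1)[of k] by simp
  qed
  thus ?thesis by blast
qed

section \<open>The Mahler measure\<close>

lemma laurent_eval_superset:
  assumes "finite S" "Poly_Mapping.keys P \<subseteq> S"
  shows "laurent_eval P z = (\<Sum>e\<in>S. Poly_Mapping.lookup P e * (\<Prod>i\<in>UNIV. z i powi Poly_Mapping.lookup e i))"
  unfolding laurent_eval_def using assms
  by (intro sum.mono_neutral_left) (auto simp: in_keys_iff)

lemma laurent_eval_add: "laurent_eval (P + Q) z = laurent_eval P z + laurent_eval Q z"
proof -
  define S where "S = Poly_Mapping.keys P \<union> Poly_Mapping.keys Q"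
  have S: "finite S" "Poly_Mapping.keys P \<subseteq> S" "Poly_Mapping.keys Q \<subseteq> S" "Poly_Mapping.keys (P + Q) \<subseteq> S"
    using Poly_Mapping.keys_add[of P Q] by (auto simp: S_def)
  show ?thesis
    by (simp add: S laurent_eval_superset[of S] lookup_add distrib_right sum.distrib)
qed

lemma laurent_eval_single:
  "laurent_eval (Poly_Mapping.single e c) z = c * (\<Prod>i\<in>UNIV. z i powi Poly_Mapping.lookup e i)"
  by (subst laurent_eval_superset[of "{e}"]) (auto split: if_splits)

lemma laurent_eval_1: "laurent_eval 1 z = 1"
  unfolding single_one[symmetric] laurent_eval_single by simp

lemma laurent_eval_var: "laurent_eval (laurent_var i) z = z i"
proof -
  have "(\<Prod>j\<in>UNIV. z j powi Poly_Mapping.lookup (Poly_Mapping.single i 1) j) = (\<Prod>j\<in>UNIV. if j = i then z i else 1)"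
    by (rule prod.cong) (auto simp: lookup_single when_def)
  thus ?thesis by (simp add: laurent_var_def laurent_eval_single)
qed

lemma norm_one_plus_e2pi: "norm (1 + e2pi s) = 2 * \<bar>cos (pi * s)\<bar>"
proof -
  have "norm (1 + e2pi s) ^ 2 = (1 + cos (2 * (pi * s))) ^ 2 + sin (2 * (pi * s)) ^ 2"
    by (simp add: cmod_power2 e2pi_def mult.assoc)
  also have "\<dots> = 2 + 2 * cos (2 * (pi * s))"
    using sin_cos_squared_add2[of "2 * (pi * s)"] by (simp add: power2_eq_square algebra_simps)
  also have "\<dots> = (2 * \<bar>cos (pi * s)\<bar>) ^ 2"
    by (simp add: cos_double_cos power_mult_distrib)
  finally show ?thesis by (subst (asm) power2_eq_iff_nonneg) auto
qed

lemma norm_one_plus_e2pi_ne_1: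
  assumes "s \<in> {0..1} - {1/3, 2/3}"
  shows "norm (1 + e2pi s) \<noteq> 1"
proof
  assume "norm (1 + e2pi s) = 1"
  hence "cos (pi * s) = cos (pi / 3) \<or> cos (pi * s) = cos (2 * pi / 3)"
    by (auto simp: norm_one_plus_e2pi cos_60 cos_120)
  moreover have "0 \<le> pi * s" "pi * s \<le> pi" using assms by (auto intro: mult_left_le)
  ultimately have "pi * s = pi / 3 \<or> pi * s = 2 * pi / 3"
    using cos_inj_pi[of "pi * s" "pi / 3"] cos_inj_pi[of "pi * s" "2 * pi / 3"] by auto
  thus False using assms by (auto simp: field_simps)
qed

lemma has_bochner_integral_ln_norm_linear:
  assumes "s \<in> {0..1} - {1/3, 2/3}"
  shows "has_bochner_integral unit_interval (\<lambda>t. ln (norm (1 + e2pi s + e2pi t)) ^ k)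
    (log_mean k (2 * \<bar>cos (pi * s)\<bar>))"
  using has_bochner_integral_ln_norm_add_e2pi[OF norm_one_plus_e2pi_ne_1[OF assms]]
  by (simp only: norm_one_plus_e2pi)

lemma (in product_sigma_finite) distr_PiM_pair:
  assumes "i \<noteq> j"
  shows "distr (Pi\<^sub>M {i, j} M) (M i \<Otimes>\<^sub>M M j) (\<lambda>t. (t i, t j)) = M i \<Otimes>\<^sub>M M j"
proof (rule measure_eqI)
  fix X assume "X \<in> sets (distr (Pi\<^sub>M {i, j} M) (M i \<Otimes>\<^sub>M M j) (\<lambda>t. (t i, t j)))"
  hence [measurable]: "X \<in> sets (M i \<Otimes>\<^sub>M M j)" by simp
  have "emeasure (distr (Pi\<^sub>M {i, j} M) (M i \<Otimes>\<^sub>M M j) (\<lambda>t. (t i, t j))) X =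
      (\<integral>\<^sup>+ t. indicator X (t i, t j) \<partial>Pi\<^sub>M {i, j} M)"
    by (subst nn_integral_indicator[symmetric], simp, subst nn_integral_distr) simp_all
  also have "\<dots> = emeasure (M i \<Otimes>\<^sub>M M j) X"
    using product_nn_integral_pair[of "\<lambda>x y. indicator X (x, y)" i j] assms by simp
  finally show "emeasure (distr (Pi\<^sub>M {i, j} M) (M i \<Otimes>\<^sub>M M j) (\<lambda>t. (t i, t j))) X = emeasure (M i \<Otimes>\<^sub>M M j) X" .
qed simp

lemma AE_unit_interval_not_in:
  assumes "countable X"
  shows "AE s in unit_interval. s \<in> {0..1} - X"
proof -
  have "AE s in lborel. s \<notin> X" using assms by (intro AE_not_in countable_imp_null_set_lborel)
  thus ?thesis by (subst AE_restrict_space_iff) auto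
qed

interpretation unit_square: pair_sigma_finite unit_interval unit_interval ..

interpretation unit_cube: product_sigma_finite "\<lambda>_. unit_interval" ..

lemma measurable_e2pi [measurable]: "e2pi \<in> borel_measurable unit_interval"
  by (intro measurable_restrict_space1 borel_measurable_continuous_onI continuous_intros)
    (auto intro!: borel_measurable_continuous_onI continuous_intros)

lemma integral_abs_ln_norm_linear_bounded:
  "\<exists>B. \<forall>s\<in>{0..1} - {1/3, 2/3}. (\<integral>t. norm (ln (norm (1 + e2pi s + e2pi t)) ^ k) \<partial>unit_interval) \<le> B"
proof -
  obtain B where B: "\<And>r. 0 \<le> r \<Longrightarrow> r \<le> 2 \<Longrightarrow> r \<noteq> 1 \<Longrightarrow> \<bar>log_mean (2 * k) r\<bar> \<le> B"
    using log_mean_bounded[of "2 * k"] by blast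
  have "(\<integral>t. norm (ln (norm (1 + e2pi s + e2pi t)) ^ k) \<partial>unit_interval) \<le> 1 + B"
    if s: "s \<in> {0..1} - {1/3, 2/3}" for s
  proof -
    define l where "l t = ln (norm (1 + e2pi s + e2pi t))" for t
    note mean = has_bochner_integral_ln_norm_linear[OF s, folded l_def]
    have "norm (x ^ k) \<le> 1 + x ^ (2 * k)" for x :: real
    proof -
      have "0 \<le> (\<bar>x ^ k\<bar> - 1 / 2) ^ 2" by simp
      hence "\<bar>x ^ k\<bar> \<le> 1 + \<bar>x ^ k\<bar> ^ 2" unfolding power2_diff by (simp add: power2_eq_square)
      thus ?thesis by (simp add: power_mult[symmetric] mult.commute)
    qed
    moreover have integrable: "integrable unit_interval (\<lambda>t. l t ^ j)" for j
      using mean by (auto simp: has_bochner_integral_iff)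
    ultimately have "(\<integral>t. norm (l t ^ k) \<partial>unit_interval) \<le> (\<integral>t. 1 + l t ^ (2 * k) \<partial>unit_interval)"
      by (intro integral_mono integrable_norm Bochner_Integration.integrable_add integrable) auto
    also have "\<dots> = 1 + log_mean (2 * k) (2 * \<bar>cos (pi * s)\<bar>)"
      using mean by (simp add: has_bochner_integral_iff space_restrict_space)
    also have "\<dots> \<le> 1 + B"
      using B[of "2 * \<bar>cos (pi * s)\<bar>"] norm_one_plus_e2pi_ne_1[OF s] by (simp add: norm_one_plus_e2pi)
    finally show ?thesis unfolding l_def .
  qed
  thus ?thesis by blast
qed

lemma integrable_ln_norm_linear:
  "integrable (unit_interval \<Otimes>\<^sub>M unit_interval) (\<lambda>(s, t). ln (norm (1 + e2pi s + e2pi t)) ^ k)"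
proof -
  define l where "l s t = ln (norm (1 + e2pi s + e2pi t)) ^ k" for s t
  obtain B where B: "\<And>s. s \<in> {0..1} - {1/3, 2/3} \<Longrightarrow> (\<integral>t. norm (l s t) \<partial>unit_interval) \<le> B"
    unfolding l_def using integral_abs_ln_norm_linear_bounded[of k] by blast
  have AE: "AE s in unit_interval. s \<in> {0..1} - {1/3, 2/3}" by (rule AE_unit_interval_not_in) simp
  have "integrable (unit_interval \<Otimes>\<^sub>M unit_interval) (\<lambda>(s, t). l s t)"
  proof (rule unit_square.Fubini_integrable)
    show "(\<lambda>(s, t). l s t) \<in> borel_measurable (unit_interval \<Otimes>\<^sub>M unit_interval)"
      unfolding l_def case_prod_beta by measurable
    show "AE s in unit_interval. integrable unit_interval (\<lambda>t. case (s, t) of (s, t) \<Rightarrow> l s t)"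
      using AE
      by eventually_elim (use has_bochner_integral_ln_norm_linear in \<open>auto simp: has_bochner_integral_iff l_def\<close>)
    have "AE s in unit_interval. norm (\<integral>t. norm (l s t) \<partial>unit_interval) \<le> B"
      using AE
    proof eventually_elim
      case (elim s)
      thus ?case using B[OF elim] by simp
    qed
    moreover have "(\<lambda>(s, t). norm (l s t)) \<in> borel_measurable (unit_interval \<Otimes>\<^sub>M unit_interval)"
      unfolding l_def case_prod_beta by measurable
    hence "(\<lambda>s. \<integral>t. norm (l s t) \<partial>unit_interval) \<in> borel_measurable unit_interval"
      by (rule unit_interval.borel_measurable_lebesgue_integral)
    ultimately have "integrable unit_interval (\<lambda>s. \<integral>t. norm (l s t) \<partial>unit_interval)"
      by (rule unit_interval.integrable_const_bound)
    thus "integrable unit_interval (\<lambda>s. \<integral>t. norm (case (s, t) of (s, t) \<Rightarrow> l s t) \<partial>unit_interval)"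
      by simp
  qed
  thus ?thesis unfolding l_def .
qed

lemma mahler_linear_eq_log_mean:
  "mahler k (1 + laurent_var 1 + laurent_var 2 :: 2 laurent_poly) =
     (LBINT s:{0..1}. log_mean k (2 * \<bar>cos (pi * s)\<bar>))"
proof -
  define l where "l = (\<lambda>(s, t). ln (norm (1 + e2pi s + e2pi t)) ^ k)"
  have integrable: "integrable (unit_interval \<Otimes>\<^sub>M unit_interval) l"
    unfolding l_def by (rule integrable_ln_norm_linear)
  have ne: "(1::2) \<noteq> 2" by simp
  have exp: "exp (2 * of_real pi * \<i> * of_real t) = e2pi t" for t
    by (simp add: e2pi_def cis_conv_exp mult_ac)
  have "mahler k (1 + laurent_var 1 + laurent_var 2 :: 2 laurent_poly) =
      (\<integral>t. l (t 1, t 2) \<partial>Pi\<^sub>M {1, 2 :: 2} (\<lambda>_. unit_interval))"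
    by (simp add: mahler_def laurent_eval_add laurent_eval_1 laurent_eval_var exp UNIV_2 l_def)
  also have "\<dots> = integral\<^sup>L (distr (Pi\<^sub>M {1, 2 :: 2} (\<lambda>_. unit_interval)) (unit_interval \<Otimes>\<^sub>M unit_interval)
      (\<lambda>t. (t 1, t 2))) l"
    using integrable by (intro integral_distr[symmetric]) auto
  also have "\<dots> = integral\<^sup>L (unit_interval \<Otimes>\<^sub>M unit_interval) l"
    unfolding unit_cube.distr_PiM_pair[OF ne] ..
  also have "\<dots> = (\<integral>s. \<integral>t. l (s, t) \<partial>unit_interval \<partial>unit_interval)"
    by (rule unit_square.integral_fst'[OF integrable, symmetric])
  also have "\<dots> = (\<integral>s. log_mean k (2 * \<bar>cos (pi * s)\<bar>) \<partial>unit_interval)"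
  proof (rule integral_discrete_difference[where X = "{1/3, 2/3}"])
    show "(\<integral>t. l (s, t) \<partial>unit_interval) = log_mean k (2 * \<bar>cos (pi * s)\<bar>)"
      if "s \<in> space unit_interval" "s \<notin> {1/3, 2/3}" for s
      using has_bochner_integral_ln_norm_linear[of s k] that
      by (simp add: l_def has_bochner_integral_iff space_restrict_space)
  qed (auto simp: sets_restrict_space emeasure_restrict_space)
  finally show ?thesis by (simp only: integral_unit_interval)
qed

lemma set_integral_abs_cos:
  fixes f :: "real \<Rightarrow> real"
  assumes "set_integrable lborel {0..pi/2} (\<lambda>\<theta>. f \<bar>sin \<theta>\<bar>)"
  shows "pi * (LBINT s:{0..1}. f \<bar>cos (pi * s)\<bar>) = 2 * (LBINT \<theta>:{0..pi/2}. f \<bar>sin \<theta>\<bar>)"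
proof -
  have "(LBINT s:{0..1}. f \<bar>cos (pi * s)\<bar>) = \<bar>1 / pi\<bar> *\<^sub>R
      (\<integral>\<theta>. indicator {0..1} (1 / 2 + 1 / pi * \<theta>) *\<^sub>R f \<bar>cos (pi * (1 / 2 + 1 / pi * \<theta>))\<bar> \<partial>lborel)"
    unfolding set_lebesgue_integral_def by (rule lborel_integral_real_affine) simp
  also have "(\<lambda>\<theta>. indicator {0..1} (1 / 2 + 1 / pi * \<theta>) *\<^sub>R f \<bar>cos (pi * (1 / 2 + 1 / pi * \<theta>))\<bar>) =
      (\<lambda>\<theta>. indicator {- (pi/2)..pi/2} \<theta> *\<^sub>R f \<bar>sin \<theta>\<bar>)"
  proof
    fix \<theta> :: real
    have "pi * (1 / 2 + 1 / pi * \<theta>) = pi / 2 + \<theta>" by (simp add: field_simps)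
    hence "\<bar>cos (pi * (1 / 2 + 1 / pi * \<theta>))\<bar> = \<bar>sin \<theta>\<bar>" by (simp add: cos_add)
    moreover have "indicator {0..1} (1 / 2 + 1 / pi * \<theta>) = (indicator {- (pi/2)..pi/2} \<theta> :: real)"
      by (auto simp: indicator_def field_simps)
    ultimately show "indicator {0..1} (1 / 2 + 1 / pi * \<theta>) *\<^sub>R f \<bar>cos (pi * (1 / 2 + 1 / pi * \<theta>))\<bar> =
      indicator {- (pi/2)..pi/2} \<theta> *\<^sub>R f \<bar>sin \<theta>\<bar>" by simp
  qed
  also have "(\<integral>\<theta>. indicator {- (pi/2)..pi/2} \<theta> *\<^sub>R f \<bar>sin \<theta>\<bar> \<partial>lborel) = 2 * (LBINT \<theta>:{0..pi/2}. f \<bar>sin \<theta>\<bar>)"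
    using set_integral_even[OF _ assms] by (simp add: set_lebesgue_integral_def)
  finally show ?thesis by simp
qed

lemma
  shows log_mean_sin_small: "0 < \<theta> \<Longrightarrow> \<theta> < pi / 6 \<Longrightarrow> log_mean k (2 * \<bar>sin \<theta>\<bar>) = rho k (2 * sin \<theta>)"
    and log_mean_sin_large: "pi / 6 < \<theta> \<Longrightarrow> \<theta> < pi / 2 \<Longrightarrow> log_mean k (2 * \<bar>sin \<theta>\<bar>) =
      (\<Sum>j=0..k. real (k choose j) * (rho j (1 / (2 * sin \<theta>)) * ln (2 * sin \<theta>) ^ (k - j)))"
  using sin_cos_less_pi_6[of \<theta>] sin_cos_greater_pi_6[of \<theta>] by (auto simp: log_mean_def)

lemma pi_mahler_linear:
  "pi * mahler k (1 + laurent_var 1 + laurent_var 2 :: 2 laurent_poly) =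
     2 * (LBINT \<theta>:{0..pi/6}. rho k (2 * sin \<theta>)) +
     2 * (\<Sum>j=0..k. real (k choose j) *
       (LBINT \<theta>:{pi/6..pi/2}. rho j (1 / (2 * sin \<theta>)) * (ln (2 * sin \<theta>)) ^ (k - j)))"
proof -
  define M where "M = (\<lambda>\<theta>. log_mean k (2 * \<bar>sin \<theta>\<bar>))"
  have small: "set_integrable lborel {0..pi/6} M"
    unfolding M_def using small_angles.set_integrable_rho[of k]
    by (subst set_integrable_cong_Ioo[OF log_mean_sin_small]) simp_all
  have large: "set_integrable lborel {pi/6..pi/2} M"
    unfolding M_def using set_integral_sum_scale(1)[OF large_angles.set_integrable_rho]
    by (subst set_integrable_cong_Ioo[OF log_mean_sin_large])
  have union: "{0..pi/6} \<union> {pi/6..pi/2} = {0..pi/2}" by auto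
  have integrable: "set_integrable lborel {0..pi/2} M"
    using set_integrable_Un[OF small large] by (simp add: union)
  have "AE \<theta> in lborel. \<not> (\<theta> \<in> {0..pi/6} \<and> \<theta> \<in> {pi/6..pi/2})"
    using AE_lborel_singleton[of "pi / 6"] by eventually_elim auto
  from set_integral_Un_AE[OF this _ _ small large]
  have "(LBINT \<theta>:{0..pi/2}. M \<theta>) = (LBINT \<theta>:{0..pi/6}. M \<theta>) + (LBINT \<theta>:{pi/6..pi/2}. M \<theta>)"
    by (simp add: union)
  also have "(LBINT \<theta>:{0..pi/6}. M \<theta>) = (LBINT \<theta>:{0..pi/6}. rho k (2 * sin \<theta>))"
    unfolding M_def by (rule set_integral_cong_Ioo[OF log_mean_sin_small])
  also have "(LBINT \<theta>:{pi/6..pi/2}. M \<theta>) = (\<Sum>j=0..k. real (k choose j) *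
       (LBINT \<theta>:{pi/6..pi/2}. rho j (1 / (2 * sin \<theta>)) * (ln (2 * sin \<theta>)) ^ (k - j)))"
    unfolding M_def
    by (rule trans[OF set_integral_cong_Ioo[OF log_mean_sin_large]
          set_integral_sum_scale(2)[OF large_angles.set_integrable_rho]])
  finally show ?thesis
    using set_integral_abs_cos[of "\<lambda>x. log_mean k (2 * x)"] integrable
    by (simp add: M_def mahler_linear_eq_log_mean)
qed

theorem mainTheorem3:
  fixes k :: nat
  assumes "k \<ge> 1"
  shows "pi * mahler k (1 + laurent_var 1 + laurent_var 2 :: 2 laurent_poly) =
           2 * (LBINT \<theta>:{0..pi/6}. rho k (2 * sin \<theta>)) +
           2 * (\<Sum>j=0..k. real (k choose j) *
             (LBINT \<theta>:{pi/6..pi/2}. rho j (1 / (2 * sin \<theta>)) * (ln (2 * sin \<theta>)) ^ (k - j)))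
         \<and> complex_of_real (pi * mahler k (1 + laurent_var 1 + laurent_var 2 :: 2 laurent_poly))
           \<in> (*) \<i> ` MPL_space (k + 1) 3"
proof
  define I where "I = (LBINT \<theta>:{0..pi/6}. rho k (2 * sin \<theta>))"
  define J where "J j = (LBINT \<theta>:{pi/6..pi/2}. rho j (1 / (2 * sin \<theta>)) * (ln (2 * sin \<theta>)) ^ (k - j))" for j
  show "pi * mahler k (1 + laurent_var 1 + laurent_var 2 :: 2 laurent_poly) =
      2 * (LBINT \<theta>:{0..pi/6}. rho k (2 * sin \<theta>)) +
      2 * (\<Sum>j=0..k. real (k choose j) *
        (LBINT \<theta>:{pi/6..pi/2}. rho j (1 / (2 * sin \<theta>)) * (ln (2 * sin \<theta>)) ^ (k - j)))"
    by (rule pi_mahler_linear)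
  hence "complex_of_real (pi * mahler k (1 + laurent_var 1 + laurent_var 2 :: 2 laurent_poly)) =
      of_rat 2 * of_real I + of_rat 2 * (\<Sum>j=0..k. of_rat (of_nat (k choose j)) * of_real (J j))"
    by (simp add: I_def J_def)
  also have "\<dots> \<in> (*) \<i> ` MPL_space (k + 1) 3"
    unfolding I_def J_def
    by (intro rat_complex.subspace_add rat_complex.subspace_scale rat_complex.subspace_sum subspace_times_MPL_space
        integral_rho_small_angles_in_MPL_space integral_rho_large_angles_in_MPL_space) simp
  finally show "complex_of_real (pi * mahler k (1 + laurent_var 1 + laurent_var 2 :: 2 laurent_poly))
      \<in> (*) \<i> ` MPL_space (k + 1) 3" .
qed

end
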